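(* Let $X$ be a finite ordered list of nonzero vectors spanning the $s$-dimensional vector space $V$. For every no broken basis $\underline b\in\mathcal{NB}(X)$, $$p_{\underline b,X}(-y)=\det(\underline b)\,\mathrm{res}_{\underline b}\Big(\frac{e^{\langle y\mid x\rangle}}{d(x)}\Big),\qquad d(x)=\prod_{a\in X}a(x),$$ where $e^{\langle y\mid x\rangle}/d(x)$ is expanded as a power series in $y=(y_1,\dots,y_s)$ with coefficients in $R_X$, and $\mathrm{res}_{\underline b}$ is applied coefficientwise.
   Context: $V$ is an $s$-dimensional complex vector space, $U=V^*$; fix linear coordinates $x_1,\dots,x_s$ on $U$ (a basis of $V$) and the dual coordinates $y_1,\dots,y_s$ on $V$, so $\langle y\mid x\rangle=\sum y_ix_i$. $S[V]$ (resp. $S[U]$) is the algebra of polynomial functions on $U$ (resp. $V$). $X=(a_1,\dots,a_N)$ is an ordered list of nonzero vectors (repetitions allowed) spanning $V$. A basis extracted from $X$ is a sublist $\underline b=(a_{i_1},\dots,a_{i_s})$, $i_1<\dots<i_s$, which is a basis of $V$. An element $a_i$ of $X$ breaks $\underline b$ if there is $1\le e\le s$ with $i\le i_e$ and $a_i$ in the span of $a_{i_e},\dots,a_{i_s}$; $\underline b$ is no broken if exactly $s$ elements of $X$ (by index) break it; $\mathcal{NB}(X)$ is the set of no broken bases. $R_X:=S[V][\prod_{a\in X}a^{-1}]$; $R_{X,s-1}$ is the span of the fractions $f\prod_{a\in X}a^{-h_a}$, $f\in S[V]$, $h_a\ge0$, such that the vectors $a$ with $h_a>0$ do not span $V$;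 $P_X:=R_X/R_{X,s-1}$. An element $p\in S[U]$ acts on $R_X$, $P_X$ as the constant coefficient differential operator $p(\partial_x)$. The polynomials $p_{\underline b,X}\in S[U]$ are the uniquely determined ones such that in $P_X$: $\big[\frac1{d(x)}\big]=\sum_{\underline b\in\mathcal{NB}(X)}p_{\underline b,X}(\partial_x)\big[\frac1{\prod_{a\in\underline b}a}\big]$; they are homogeneous of degree $N-s$. For $\underline b=(b_1,\dots,b_s)$ (in the order of $X$), $\det(\underline b)$ is defined by $db_1\wedge\dots\wedge db_s=\det(\underline b)\,dx_1\wedge\dots\wedge dx_s$. The substitution $b_i\mapsto u_1u_2\cdots u_i$ ($i=1,\dots,s$) defines an injection $j_{\underline b}:R_X\to\mathbb C[[u_1,\dots,u_s]][(u_1\cdots u_s)^{-1}]$, extended to differential forms. For $f\in R_X$, $\mathrm{res}_{\underline b}(f)$ is the coefficient of $(u_1\cdots u_s)^{-1}du_1\wedge\dots\wedge du_s$ in $j_{\underline b}(f\,dx_1\wedge\dots\wedge dx_s)$. *)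

theory Defs
  imports
    "HOL-Analysis.Determinants"
    "HOL-Library.Poly_Mapping"
    "HOL-Library.FuncSet"
    "HOL-Computational_Algebra.Fraction_Field"
begin

section \<open>Polynomials and rational functions in the variables indexed by a finite linear order\<close>

text \<open>
  The index type \<open>'s\<close> is a finite linear order with \<open>s = CARD('s)\<close> elements; it indexes the
  coordinates \<open>x\<close>, the dual coordinates \<open>y\<close>, the members of a basis and the variables \<open>u\<close>.
  The type \<open>'s mpoly\<close> serves both as \<open>S[V] = \<complex>[x]\<close> and as \<open>S[U] = \<complex>[y]\<close>.
\<close>

type_synonym 's mpoly = "('s \<Rightarrow>\<^sub>0 nat) \<Rightarrow>\<^sub>0 complex"
type_synonym 's ratfun = "'s mpoly fract"

definition mconst :: "complex \<Rightarrow> 's mpoly"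
  where "mconst c = Poly_Mapping.single 0 c"

definition mvar :: "'s \<Rightarrow> 's mpoly"
  where "mvar i = Poly_Mapping.single (Poly_Mapping.single i 1) 1"

text \<open>The value of \<open>p\<close> under the substitution \<open>\<phi>\<close> of the variables, in the ring \<open>'b\<close> which is a
  \<open>\<complex>\<close>-algebra through \<open>\<kappa>\<close>.\<close>

definition msubst :: "(complex \<Rightarrow> 'b::comm_ring_1) \<Rightarrow> ('s::finite \<Rightarrow> 'b) \<Rightarrow> 's mpoly \<Rightarrow> 'b"
  where "msubst \<kappa> \<phi> p =
    (\<Sum>\<alpha>\<in>Poly_Mapping.keys p.
       \<kappa> (Poly_Mapping.lookup p \<alpha>) * (\<Prod>i\<in>UNIV. \<phi> i ^ Poly_Mapping.lookup \<alpha> i))"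

lift_definition mderiv :: "'s \<Rightarrow> 's mpoly \<Rightarrow> 's mpoly"
  is "\<lambda>i p \<alpha>. of_nat (Poly_Mapping.lookup \<alpha> i + 1) * p (\<alpha> + Poly_Mapping.single i 1)"
proof -
  fix i :: 's and p :: "('s \<Rightarrow>\<^sub>0 nat) \<Rightarrow> complex"
  assume "finite {\<alpha>. p \<alpha> \<noteq> 0}"
  then have "finite ((\<lambda>\<alpha>. \<alpha> + Poly_Mapping.single i 1) -` {\<alpha>. p \<alpha> \<noteq> 0})"
    by (rule finite_vimageI) (simp add: inj_on_def)
  then show "finite {\<alpha>. of_nat (Poly_Mapping.lookup \<alpha> i + 1) * p (\<alpha> + Poly_Mapping.single i 1) \<noteq> 0}"
    by (rule rev_finite_subset) auto
qed

lemma mderiv_add: "mderiv i (p + q) = mderiv i p + mderiv i q"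
  by (rule poly_mapping_eqI) (simp add: mderiv.rep_eq lookup_add algebra_simps)

lemma mderiv_zero [simp]: "mderiv i 0 = 0"
  by (rule poly_mapping_eqI) (simp add: mderiv.rep_eq)

lemma mderiv_sum: "mderiv i (\<Sum>a\<in>A. f a) = (\<Sum>a\<in>A. mderiv i (f a))"
  by (induction A rule: infinite_finite_induct) (auto simp: mderiv_add)

lemma mderiv_single:
  "mderiv i (Poly_Mapping.single \<alpha> c) =
   Poly_Mapping.single (\<alpha> - Poly_Mapping.single i 1) (of_nat (Poly_Mapping.lookup \<alpha> i) * c)"
proof (rule poly_mapping_eqI)
  fix \<beta> :: "'a \<Rightarrow>\<^sub>0 nat"
  show "Poly_Mapping.lookup (mderiv i (Poly_Mapping.single \<alpha> c)) \<beta> =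
    Poly_Mapping.lookup
      (Poly_Mapping.single (\<alpha> - Poly_Mapping.single i 1) (of_nat (Poly_Mapping.lookup \<alpha> i) * c)) \<beta>"
  proof (cases "Poly_Mapping.lookup \<alpha> i = 0")
    case True
    then have "\<alpha> \<noteq> \<beta> + Poly_Mapping.single i 1"
      by (auto simp: lookup_add)
    with True show ?thesis
      by (simp add: mderiv.rep_eq lookup_single)
  next
    case False
    then have "\<alpha> - Poly_Mapping.single i 1 + Poly_Mapping.single i 1 = \<alpha>"
      by (intro poly_mapping_eqI) (auto simp: lookup_add lookup_minus lookup_single when_def)
    then have iff: "\<alpha> = \<beta> + Poly_Mapping.single i 1 \<longleftrightarrow> \<alpha> - Poly_Mapping.single i 1 = \<beta>"
      by (metis add_diff_cancel_right')
    show ?thesis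
    proof (cases "\<alpha> = \<beta> + Poly_Mapping.single i 1")
      case True
      then have "Poly_Mapping.lookup \<alpha> i = Poly_Mapping.lookup \<beta> i + 1"
        by (simp add: lookup_add)
      with True iff show ?thesis
        by (simp only: mderiv.rep_eq lookup_single when_def if_True simp_thms)
    next
      case False
      with iff show ?thesis
        by (simp only: mderiv.rep_eq lookup_single when_def if_False simp_thms mult_zero_right)
    qed
  qed
qed

lemma mpoly_sum_single:
  fixes p :: "'s mpoly"
  shows "p = (\<Sum>\<alpha>\<in>Poly_Mapping.keys p. Poly_Mapping.single \<alpha> (Poly_Mapping.lookup p \<alpha>))"
  by (rule poly_mapping_eqI)
    (simp add: lookup_sum lookup_single when_def in_keys_iff sum.delta if_distrib cong: if_cong)

lemma single_minus_add:
  fixes \<alpha> \<beta> :: "'s \<Rightarrow>\<^sub>0 nat"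
  assumes "Poly_Mapping.lookup \<alpha> i \<noteq> 0"
  shows "\<alpha> - Poly_Mapping.single i 1 + \<beta> = \<alpha> + \<beta> - Poly_Mapping.single i 1"
  using assms
  by (intro poly_mapping_eqI) (auto simp: lookup_add lookup_minus lookup_single when_def)

lemma mderiv_mult_single:
  "mderiv i (Poly_Mapping.single \<alpha> c * Poly_Mapping.single \<beta> d) =
   mderiv i (Poly_Mapping.single \<alpha> c) * Poly_Mapping.single \<beta> d +
   Poly_Mapping.single \<alpha> c * mderiv i (Poly_Mapping.single \<beta> d)"
proof -
  have "Poly_Mapping.single (\<alpha> - Poly_Mapping.single i 1 + \<beta>) (of_nat (Poly_Mapping.lookup \<alpha> i) * c * d)
      = Poly_Mapping.single (\<alpha> + \<beta> - Poly_Mapping.single i 1) (of_nat (Poly_Mapping.lookup \<alpha> i) * c * d)"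
    by (cases "Poly_Mapping.lookup \<alpha> i = 0") (simp_all add: single_minus_add del: One_nat_def)
  moreover have "Poly_Mapping.single (\<alpha> + (\<beta> - Poly_Mapping.single i 1)) (c * (of_nat (Poly_Mapping.lookup \<beta> i) * d))
      = Poly_Mapping.single (\<alpha> + \<beta> - Poly_Mapping.single i 1) (c * (of_nat (Poly_Mapping.lookup \<beta> i) * d))"
    using single_minus_add[of \<beta> i \<alpha>]
    by (cases "Poly_Mapping.lookup \<beta> i = 0") (simp_all add: add.commute del: One_nat_def)
  ultimately show ?thesis
    by (simp add: mderiv_single mult_single lookup_add single_add[symmetric] algebra_simps
        del: One_nat_def)
qed

lemma mderiv_mult: "mderiv i (p * q) = mderiv i p * q + p * mderiv i q"
proof -
  let ?s = "\<lambda>p::'a mpoly. \<lambda>\<alpha>. Poly_Mapping.single \<alpha> (Poly_Mapping.lookup p \<alpha>)"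
  let ?K = Poly_Mapping.keys
  have "mderiv i ((\<Sum>\<alpha>\<in>?K p. ?s p \<alpha>) * (\<Sum>\<beta>\<in>?K q. ?s q \<beta>)) =
        mderiv i (\<Sum>\<alpha>\<in>?K p. ?s p \<alpha>) * (\<Sum>\<beta>\<in>?K q. ?s q \<beta>) +
        (\<Sum>\<alpha>\<in>?K p. ?s p \<alpha>) * mderiv i (\<Sum>\<beta>\<in>?K q. ?s q \<beta>)"
    by (simp add: sum_product mderiv_sum mderiv_mult_single sum.distrib)
  then show ?thesis
    by (simp add: mpoly_sum_single[symmetric])
qed

definition of_mpoly :: "'s::{finite,linorder} mpoly \<Rightarrow> 's ratfun"
  where "of_mpoly p = Fract p 1"

lift_definition rderiv :: "'s::{finite,linorder} \<Rightarrow> 's ratfun \<Rightarrow> 's ratfun"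
  is "\<lambda>i f. (mderiv i (fst f) * snd f - fst f * mderiv i (snd f), snd f * snd f)"
proof -
  fix i :: 's and f g :: "'s mpoly \<times> 's mpoly"
  assume "fractrel f g"
  moreover obtain p q p' q' where fg: "f = (p, q)" "g = (p', q')"
    by (metis surj_pair)
  ultimately have nz: "q \<noteq> 0" "q' \<noteq> 0" and eq: "p * q' = p' * q"
    by auto
  let ?D = "mderiv i"
  have "?D p * q' + p * ?D q' = ?D p' * q + p' * ?D q"
    using arg_cong[OF eq, of ?D] by (simp add: mderiv_mult)
  then have D: "?D p * q' = ?D p' * q + p' * ?D q - p * ?D q'"
    by (simp only: eq_diff_eq)
  have "(?D p * q - p * ?D q) * (q' * q') = (?D p * q') * (q * q') - (p * q') * (q' * ?D q)"
    by (simp add: algebra_simps)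
  also have "\<dots> = (?D p' * q + p' * ?D q - p * ?D q') * (q * q') - (p' * q) * (q' * ?D q)"
    by (simp only: D eq)
  also have "\<dots> = ?D p' * q * (q * q') - (p * q') * (q * ?D q')"
    by (simp add: algebra_simps)
  also have "\<dots> = (?D p' * q' - p' * ?D q') * (q * q)"
    by (simp add: eq) (simp add: algebra_simps)
  finally show "fractrel
      (?D (fst f) * snd f - fst f * ?D (snd f), snd f * snd f)
      (?D (fst g) * snd g - fst g * ?D (snd g), snd g * snd g)"
    using nz by (simp add: fg)
qed

definition rscale :: "complex \<Rightarrow> 's::{finite,linorder} ratfun \<Rightarrow> 's ratfun"
  where "rscale c f = of_mpoly (mconst c) * f"

interpretation ratfun: vector_space rscale
proof
  fix a b :: complex and f g :: "'a ratfun"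
  show "rscale a (f + g) = rscale a f + rscale a g"
    by (simp add: rscale_def algebra_simps)
  show "rscale (a + b) f = rscale a f + rscale b f"
    by (simp add: rscale_def of_mpoly_def mconst_def single_add flip: distrib_right)
  show "rscale a (rscale b f) = rscale (a * b) f"
    by (simp add: rscale_def of_mpoly_def mconst_def mult_single flip: mult.assoc)
  show "rscale 1 f = f"
    by (simp add: rscale_def of_mpoly_def mconst_def One_fract_def[symmetric])
qed

text \<open>The operator \<open>p(\<partial>\<^sub>x)\<close> for \<open>p \<in> S[U]\<close>; the order of the commuting partial derivatives in
  a monomial is immaterial.\<close>

definition diffop :: "'s::{finite,linorder} mpoly \<Rightarrow> 's ratfun \<Rightarrow> 's ratfun"
  where "diffop p f =
    (\<Sum>\<alpha>\<in>Poly_Mapping.keys p. rscale (Poly_Mapping.lookup p \<alpha>)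
       (fold (\<lambda>i. rderiv i ^^ Poly_Mapping.lookup \<alpha> i) (sorted_list_of_set UNIV) f))"


section \<open>The arrangement\<close>

text \<open>The space \<open>V\<close> is \<open>\<complex>\<^sup>s\<close>: a vector is given by its coefficients in the basis \<open>x\<close> of \<open>V\<close>.
  Its linear form on \<open>U\<close> is \<open>linform\<close>. The list \<open>X\<close> is indexed from \<open>0\<close>.\<close>

definition linform :: "complex ^ 's \<Rightarrow> 's mpoly"
  where "linform a = (\<Sum>i\<in>UNIV. mconst (a $ i) * mvar i)"

text \<open>A basis extracted from \<open>X\<close> is given by the increasing family \<open>\<sigma>\<close> of its positions; repeated
  vectors of \<open>X\<close> are told apart by position, also when the elements breaking a basis are counted.\<close>

definition extracted :: "(complex ^ 's::{finite,linorder}) list \<Rightarrow> ('s \<Rightarrow> nat) \<Rightarrow> 's \<Rightarrow> complex ^ 's::{finite,linorder}"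
  where "extracted X \<sigma> e = X ! \<sigma> e"

definition extracted_basis :: "(complex ^ 's::{finite,linorder}) list \<Rightarrow> ('s \<Rightarrow> nat) \<Rightarrow> bool"
  where "extracted_basis X \<sigma> \<longleftrightarrow>
    strict_mono \<sigma> \<and> (\<forall>e. \<sigma> e < length X) \<and>
    inj (extracted X \<sigma>) \<and> vec.independent (range (extracted X \<sigma>)) \<and>
    vec.span (range (extracted X \<sigma>)) = UNIV"

definition breaks :: "(complex ^ 's::{finite,linorder}) list \<Rightarrow> ('s \<Rightarrow> nat) \<Rightarrow> nat \<Rightarrow> bool"
  where "breaks X \<sigma> i \<longleftrightarrow> (\<exists>e. i \<le> \<sigma> e \<and> X ! i \<in> vec.span (extracted X \<sigma> ` {e..}))"

definition no_broken :: "(complex ^ 's::{finite,linorder}) list \<Rightarrow> ('s \<Rightarrow> nat) set"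
  where "no_broken X =
    {\<sigma>. extracted_basis X \<sigma> \<and> card {i. i < length X \<and> breaks X \<sigma> i} = CARD('s)}"

definition arr_fraction :: "(complex ^ 's::{finite,linorder}) list \<Rightarrow> 's mpoly \<Rightarrow> (nat \<Rightarrow> nat) \<Rightarrow> 's ratfun"
  where "arr_fraction X f h = of_mpoly f / (\<Prod>i<length X. of_mpoly (linform (X ! i)) ^ h i)"

definition R_alg :: "(complex ^ 's::{finite,linorder}) list \<Rightarrow> 's ratfun set"
  where "R_alg X = {arr_fraction X f h | f h. True}"

definition R_low :: "(complex ^ 's::{finite,linorder}) list \<Rightarrow> 's ratfun set"
  where "R_low X = ratfun.span
    {arr_fraction X f h | f h. vec.span {X ! i | i. i < length X \<and> h i > 0} \<noteq> UNIV}"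

text \<open>The class of \<open>f\<close> in \<open>P\<^sub>X = R\<^sub>X / R\<^bsub>X,s-1\<^esub>\<close>.\<close>

definition P_class :: "(complex ^ 's::{finite,linorder}) list \<Rightarrow> 's ratfun \<Rightarrow> 's ratfun set"
  where "P_class X f = {g \<in> R_alg X. g - f \<in> R_low X}"

definition arr_prod :: "(complex ^ 's::{finite,linorder}) list \<Rightarrow> 's ratfun"
  where "arr_prod X = (\<Prod>i<length X. of_mpoly (linform (X ! i)))"

text \<open>As \<open>R\<^bsub>X,s-1\<^esub>\<close> is a subspace stable under the operators \<open>p(\<partial>\<^sub>x)\<close>, the combination of classes
  \<open>\<Sum> p\<^sub>\<sigma>(\<partial>\<^sub>x)[1 / \<Prod>b]\<close> is the class of the combination of representatives.
  Extensionality makes the family unique as a total function.\<close>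

definition nb_expansion ::
    "(complex ^ 's::{finite,linorder}) list \<Rightarrow> (('s \<Rightarrow> nat) \<Rightarrow> 's mpoly) \<Rightarrow> bool"
  where "nb_expansion X p \<longleftrightarrow>
    p \<in> extensional (no_broken X) \<and>
    P_class X (1 / arr_prod X) =
    P_class X (\<Sum>\<sigma>\<in>no_broken X. diffop (p \<sigma>) (1 / (\<Prod>e\<in>UNIV. of_mpoly (linform (extracted X \<sigma> e)))))"

definition nb_poly ::
    "(complex ^ 's::{finite,linorder}) list \<Rightarrow> ('s \<Rightarrow> nat) \<Rightarrow> 's mpoly"
  where "nb_poly X = (THE p. nb_expansion X p)"


section \<open>Laurent series with bounded poles\<close>

text \<open>The ring \<open>\<complex>[[u]][(\<Prod>u)\<^sup>-\<^sup>1]\<close>, as coefficient functions on exponent vectors: the exponents that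
  occur in one series are bounded below, by one bound for all variables.\<close>

typedef (overloaded) ('s::finite) laurent =
    "{f :: int ^ 's \<Rightarrow> complex. \<exists>m. \<forall>k i. f k \<noteq> 0 \<longrightarrow> m \<le> k $ i}"
  morphisms laurent_coeff Abs_laurent
  by (rule exI[of _ "\<lambda>_. 0"]) simp

setup_lifting type_definition_laurent

lemma laurent_eqI: "(\<And>k. laurent_coeff f k = laurent_coeff g k) \<Longrightarrow> f = g"
  by (simp add: laurent_coeff_inject[symmetric] fun_eq_iff)

lemma finite_int_box:
  fixes a b :: "int ^ 's::finite"
  shows "finite {k. \<forall>i. a $ i \<le> k $ i \<and> k $ i \<le> b $ i}"
proof (rule finite_subset)
  show "finite (vec_lambda ` (PiE UNIV (\<lambda>i. {a $ i .. b $ i})))"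
    by (intro finite_imageI finite_PiE) auto
  show "{k. \<forall>i. a $ i \<le> k $ i \<and> k $ i \<le> b $ i} \<subseteq> vec_lambda ` (PiE UNIV (\<lambda>i. {a $ i .. b $ i}))"
  proof
    fix k :: "int ^ 's" assume "k \<in> {k. \<forall>i. a $ i \<le> k $ i \<and> k $ i \<le> b $ i}"
    then have "vec_nth k \<in> PiE UNIV (\<lambda>i. {a $ i .. b $ i})" by auto
    then show "k \<in> vec_lambda ` (PiE UNIV (\<lambda>i. {a $ i .. b $ i}))"
      by (metis image_eqI vec_nth_inverse)
  qed
qed

lemma finite_conv_support:
  fixes f g :: "int ^ 's::finite \<Rightarrow> complex"
  assumes f: "\<And>k i. f k \<noteq> 0 \<Longrightarrow> m \<le> k $ i" and g: "\<And>k i. g k \<noteq> 0 \<Longrightarrow> n \<le> k $ i"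
  shows "finite {l. f l * g (k - l) \<noteq> 0}"
proof (rule finite_subset[OF _ finite_int_box])
  show "{l. f l * g (k - l) \<noteq> 0} \<subseteq> {l. \<forall>i. (\<chi> i. m) $ i \<le> l $ i \<and> l $ i \<le> (\<chi> i. k $ i - n) $ i}"
  proof
    fix l assume "l \<in> {l. f l * g (k - l) \<noteq> 0}"
    then have "m \<le> l $ i" "n \<le> (k - l) $ i" for i
      using f[of l i] g[of "k - l" i] by auto
    then have "m \<le> l $ i" "l $ i \<le> k $ i - n" for i
      by (simp_all add: le_diff_eq add.commute)
    then show "l \<in> {l. \<forall>i. (\<chi> i. m) $ i \<le> l $ i \<and> l $ i \<le> (\<chi> i. k $ i - n) $ i}" by simp
  qed
qed

instantiation laurent :: (finite) comm_ring_1
begin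

lift_definition zero_laurent :: "'a laurent" is "\<lambda>_. 0" by simp

lift_definition one_laurent :: "'a laurent" is "\<lambda>k. if k = 0 then 1 else 0"
  by (intro exI[of _ 0]) simp

lift_definition plus_laurent :: "'a laurent \<Rightarrow> 'a laurent \<Rightarrow> 'a laurent" is "\<lambda>f g k. f k + g k"
proof -
  fix f g :: "int ^ 'a \<Rightarrow> complex"
  assume "\<exists>m. \<forall>k i. f k \<noteq> 0 \<longrightarrow> m \<le> k $ i" "\<exists>m. \<forall>k i. g k \<noteq> 0 \<longrightarrow> m \<le> k $ i"
  then obtain m n where "\<forall>k i. f k \<noteq> 0 \<longrightarrow> m \<le> k $ i" "\<forall>k i. g k \<noteq> 0 \<longrightarrow> n \<le> k $ i"
    by blast
  then have "\<forall>k i. f k + g k \<noteq> 0 \<longrightarrow> min m n \<le> k $ i"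
    by (auto simp: min_le_iff_disj) (metis add_0)
  then show "\<exists>m. \<forall>k i. f k + g k \<noteq> 0 \<longrightarrow> m \<le> k $ i" by blast
qed

lift_definition uminus_laurent :: "'a laurent \<Rightarrow> 'a laurent" is "\<lambda>f k. - f k" by simp

definition minus_laurent :: "'a laurent \<Rightarrow> 'a laurent \<Rightarrow> 'a laurent"
  where "minus_laurent f g = f + - g"

lift_definition times_laurent :: "'a laurent \<Rightarrow> 'a laurent \<Rightarrow> 'a laurent"
  is "\<lambda>f g k. Sum_any (\<lambda>l. f l * g (k - l))"
proof -
  fix f g :: "int ^ 'a \<Rightarrow> complex"
  assume "\<exists>m. \<forall>k i. f k \<noteq> 0 \<longrightarrow> m \<le> k $ i" "\<exists>m. \<forall>k i. g k \<noteq> 0 \<longrightarrow> m \<le> k $ i"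
  then obtain m n where f: "\<And>k i. f k \<noteq> 0 \<Longrightarrow> m \<le> k $ i" and g: "\<And>k i. g k \<noteq> 0 \<Longrightarrow> n \<le> k $ i"
    by blast
  have "m + n \<le> k $ i" if k: "Sum_any (\<lambda>l. f l * g (k - l)) \<noteq> 0" for k i
  proof -
    obtain l where "f l * g (k - l) \<noteq> 0"
      using Sum_any.not_neutral_obtains_not_neutral[OF k] by blast
    then show ?thesis using f[of l i] g[of "k - l" i] by auto
  qed
  then show "\<exists>m. \<forall>k i. Sum_any (\<lambda>l. f l * g (k - l)) \<noteq> 0 \<longrightarrow> m \<le> k $ i" by blast
qed

lemma laurent_bound: "\<exists>m. \<forall>k i. laurent_coeff (f :: 'a laurent) k \<noteq> 0 \<longrightarrow> m \<le> k $ i"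
  using laurent_coeff[of f] by simp

lemma laurent_conv_finite: "finite {l. laurent_coeff (f :: 'a laurent) l * laurent_coeff g (k - l) \<noteq> 0}"
proof -
  obtain m where m: "\<And>k i. laurent_coeff f k \<noteq> 0 \<Longrightarrow> m \<le> k $ i"
    using laurent_bound[of f] by blast
  obtain n where n: "\<And>k i. laurent_coeff g k \<noteq> 0 \<Longrightarrow> n \<le> k $ i"
    using laurent_bound[of g] by blast
  show ?thesis
    by (rule finite_conv_support[of "laurent_coeff f" m "laurent_coeff g" n]) (use m n in simp_all)
qed

instance
proof
  fix a b c :: "'a laurent"
  show "a + b + c = a + (b + c)" "a + b = b + a" "0 + a = a"
    by (rule laurent_eqI, simp add: plus_laurent.rep_eq zero_laurent.rep_eq)+
  show "- a + a = 0"
    by (rule laurent_eqI) (simp add: plus_laurent.rep_eq zero_laurent.rep_eq uminus_laurent.rep_eq)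
  show "a - b = a + - b" by (simp add: minus_laurent_def)
  show "(0::'a laurent) \<noteq> 1"
  proof
    assume "(0::'a laurent) = 1"
    then have "laurent_coeff (0::'a laurent) 0 = laurent_coeff 1 0" by simp
    then show False by (simp add: zero_laurent.rep_eq one_laurent.rep_eq)
  qed
  show "1 * a = a"
  proof (rule laurent_eqI)
    fix k
    have "Sum_any (\<lambda>l. (if l = 0 then 1 else 0) * laurent_coeff a (k - l))
        = Sum_any (\<lambda>l. if l = 0 then laurent_coeff a (k - l) else 0)"
      by (rule Sum_any.cong) simp
    then show "laurent_coeff (1 * a) k = laurent_coeff a k"
      by (simp add: times_laurent.rep_eq one_laurent.rep_eq)
  qed
  show "(a + b) * c = a * c + b * c"
    unfolding laurent_coeff_inject[symmetric] fun_eq_iff times_laurent.rep_eq plus_laurent.rep_eq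
      distrib_right
    by (intro allI Sum_any.distrib laurent_conv_finite)
  show "a * b = b * a"
  proof (rule laurent_eqI)
    fix k :: "int ^ 'a"
    have "bij (\<lambda>l. k - l)" by (rule o_bij[of "\<lambda>l. k - l"]) auto
    then show "laurent_coeff (a * b) k = laurent_coeff (b * a) k"
      unfolding times_laurent.rep_eq
      by (rule Sum_any.reindex_cong) (simp add: fun_eq_iff mult.commute)
  qed
  show "a * b * c = a * (b * c)"
  proof (rule laurent_eqI)
    fix k :: "int ^ 'a"
    let ?a = "laurent_coeff a" and ?b = "laurent_coeff b" and ?c = "laurent_coeff c"
    let ?T = "\<lambda>i j. ?a j * ?b (i - j) * ?c (k - i)"
    obtain ma where ma: "\<And>k i. ?a k \<noteq> 0 \<Longrightarrow> ma \<le> k $ i" using laurent_bound[of a] by blast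
    obtain mb where mb: "\<And>k i. ?b k \<noteq> 0 \<Longrightarrow> mb \<le> k $ i" using laurent_bound[of b] by blast
    obtain mc where mc: "\<And>k i. ?c k \<noteq> 0 \<Longrightarrow> mc \<le> k $ i" using laurent_bound[of c] by blast
    let ?I = "{i. \<forall>t. (\<chi> t. ma + mb) $ t \<le> i $ t \<and> i $ t \<le> (\<chi> t. k $ t - mc) $ t}"
    let ?J = "{j. \<forall>t. (\<chi> t. ma) $ t \<le> j $ t \<and> j $ t \<le> (\<chi> t. k $ t - mc - mb) $ t}"
    have T: "i \<in> ?I" "j \<in> ?J" if "?T i j \<noteq> 0" for i j
    proof -
      have "ma \<le> j $ t" "mb \<le> (i - j) $ t" "mc \<le> (k - i) $ t" for t
        using that ma[of j t] mb[of "i - j" t] mc[of "k - i" t] by auto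
      then have *: "ma \<le> j $ t" "mb \<le> i $ t - j $ t" "mc \<le> k $ t - i $ t" for t
        by simp_all
      have "ma + mb \<le> i $ t" "i $ t \<le> k $ t - mc" "j $ t \<le> k $ t - mc - mb" for t
        using *[of t] by linarith+
      with * show "i \<in> ?I" "j \<in> ?J" by auto
    qed
    have "laurent_coeff (a * b * c) k = Sum_any (\<lambda>i. Sum_any (\<lambda>j. ?T i j))"
      unfolding times_laurent.rep_eq
      by (rule Sum_any.cong, rule Sum_any_left_distrib, rule laurent_conv_finite)
    also have "\<dots> = Sum_any (\<lambda>j. Sum_any (\<lambda>i. ?T i j))"
    proof (rule Sum_any.swap)
      show "finite (?I \<times> ?J)" by (intro finite_cartesian_product finite_int_box)
      show "{i. \<exists>j. ?T i j \<noteq> 0} \<times> {j. \<exists>i. ?T i j \<noteq> 0} \<subseteq> ?I \<times> ?J"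
        using T by blast
    qed
    also have "\<dots> = Sum_any (\<lambda>j. ?a j * Sum_any (\<lambda>l. ?b l * ?c (k - j - l)))"
    proof (rule Sum_any.cong)
      fix j :: "int ^ 'a"
      have "bij (\<lambda>l. l + j)" by (rule o_bij[of "\<lambda>l. l - j"]) auto
      then have "Sum_any (\<lambda>i. ?T i j) = Sum_any (\<lambda>l. ?a j * (?b l * ?c (k - j - l)))"
        by (rule Sum_any.reindex_cong) (simp add: fun_eq_iff diff_diff_eq add.commute mult.assoc)
      then show "Sum_any (\<lambda>i. ?T i j) = ?a j * Sum_any (\<lambda>l. ?b l * ?c (k - j - l))"
        by (subst Sum_any_right_distrib) (rule laurent_conv_finite)
    qed
    also have "\<dots> = laurent_coeff (a * (b * c)) k"
      unfolding times_laurent.rep_eq ..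
    finally show "laurent_coeff (a * b * c) k = laurent_coeff (a * (b * c)) k" .
  qed
qed

end

lift_definition laurent_monom :: "int ^ 's::finite \<Rightarrow> complex \<Rightarrow> 's laurent"
  is "\<lambda>k c l. if l = k then c else 0"
proof -
  fix k :: "int ^ 's" and c :: complex
  have "Min (range (vec_nth k)) \<le> k $ i" for i by simp
  then show "\<exists>m. \<forall>l i. (if l = k then c else 0) \<noteq> 0 \<longrightarrow> m \<le> l $ i"
    by (intro exI[of _ "Min (range (vec_nth k))"]) auto
qed

definition laurent_const :: "complex \<Rightarrow> 's::finite laurent"
  where "laurent_const c = laurent_monom 0 c"

definition u_var :: "'s \<Rightarrow> 's::finite laurent"
  where "u_var i = laurent_monom (axis i 1) 1"

lift_definition laurent_deriv :: "'s \<Rightarrow> 's::finite laurent \<Rightarrow> 's laurent"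
  is "\<lambda>t f k. of_int (k $ t + 1) * f (k + axis t 1)"
proof -
  fix t :: 's and f :: "int ^ 's \<Rightarrow> complex"
  assume "\<exists>m. \<forall>k i. f k \<noteq> 0 \<longrightarrow> m \<le> k $ i"
  then obtain m where m: "\<And>k i. f k \<noteq> 0 \<Longrightarrow> m \<le> k $ i" by blast
  have "m - 1 \<le> k $ i" if "of_int (k $ t + 1) * f (k + axis t 1) \<noteq> 0" for k i
  proof -
    have "m \<le> (k + axis t 1) $ i" using that by (intro m) auto
    then show ?thesis by (auto simp: axis_def split: if_splits)
  qed
  then show "\<exists>m. \<forall>k i. of_int (k $ t + 1) * f (k + axis t 1) \<noteq> 0 \<longrightarrow> m \<le> k $ i"
    by (intro exI allI impI)
qed


section \<open>Residues\<close>

text \<open>The members of a basis \<open>b\<close> are the rows of the matrix \<open>\<chi> k. b k\<close>, so that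
  \<open>x\<^sub>i = \<Sum>\<^sub>k (matrix_inv (\<chi> k. b k))\<^sub>i\<^sub>k b\<^sub>k\<close>. Hence \<open>x_image b i\<close> is the image of the coordinate \<open>x\<^sub>i\<close>
  under the substitution \<open>b\<^sub>k \<mapsto> \<Prod>\<^bsub>l \<le> k\<^esub> u\<^sub>l\<close>.\<close>

definition x_image :: "('s \<Rightarrow> complex ^ 's::{finite,linorder}) \<Rightarrow> 's \<Rightarrow> 's laurent"
  where "x_image b i =
    (\<Sum>k\<in>UNIV. laurent_const (matrix_inv (\<chi> k. b k) $ i $ k) * (\<Prod>l\<in>{..k}. u_var l))"

definition j_mpoly :: "('s \<Rightarrow> complex ^ 's::{finite,linorder}) \<Rightarrow> 's mpoly \<Rightarrow> 's laurent"
  where "j_mpoly b = msubst laurent_const (x_image b)"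

text \<open>For \<open>f \<in> R\<^sub>X\<close> there is exactly one such series, because the image of a nonzero linear form is
  a monomial in \<open>u\<close> times a power series with nonzero constant term, hence invertible.\<close>

definition j_map :: "('s \<Rightarrow> complex ^ 's::{finite,linorder}) \<Rightarrow> 's ratfun \<Rightarrow> 's laurent"
  where "j_map b f = (THE L. \<forall>p q. q \<noteq> 0 \<longrightarrow> f = Fract p q \<longrightarrow> L * j_mpoly b q = j_mpoly b p)"

text \<open>\<open>dx\<^sub>1 \<and> \<dots> \<and> dx\<^sub>s\<close> is sent to \<open>jacobian b\<close> times \<open>du\<^sub>1 \<and> \<dots> \<and> du\<^sub>s\<close>.\<close>

definition jacobian :: "('s \<Rightarrow> complex ^ 's::{finite,linorder}) \<Rightarrow> 's laurent"
  where "jacobian b = det (\<chi> i t. laurent_deriv t (x_image b i))"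

definition residue_at :: "('s \<Rightarrow> complex ^ 's::{finite,linorder}) \<Rightarrow> 's ratfun \<Rightarrow> complex"
  where "residue_at b f = laurent_coeff (j_map b f * jacobian b) (\<chi> i. -1)"


section \<open>The exponential as a power series in \<open>y\<close>\<close>

text \<open>\<open>\<langle>y | x\<rangle>\<close> as a polynomial in \<open>y\<close> with coefficients in the rational functions of \<open>x\<close>.\<close>

definition pairing :: "('s::{finite,linorder} \<Rightarrow>\<^sub>0 nat) \<Rightarrow>\<^sub>0 's ratfun"
  where "pairing = (\<Sum>i\<in>UNIV. Poly_Mapping.single (Poly_Mapping.single i 1) (of_mpoly (mvar i)))"

text \<open>The coefficient of \<open>y\<^sup>\<alpha>\<close> in \<open>e\<^bsup>\<langle>y | x\<rangle>\<^esup> = \<Sum>n. \<langle>y | x\<rangle>\<^sup>n / n!\<close>; the sum is finite, since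
  \<open>\<langle>y | x\<rangle>\<^sup>n\<close> is homogeneous of degree \<open>n\<close> in \<open>y\<close>.\<close>

definition exp_pairing_coeff :: "('s::{finite,linorder} \<Rightarrow>\<^sub>0 nat) \<Rightarrow> 's ratfun"
  where "exp_pairing_coeff \<alpha> =
    Sum_any (\<lambda>n. rscale (1 / fact n) (Poly_Mapping.lookup (pairing ^ n) \<alpha>))"

end

theory Submission
  imports Defs
begin

text \<open>
  The substitution for a basis \<open>b\<close> turns \<open>b\<^sub>k \<partial>/\<partial>b\<^sub>k\<close> into an Euler operator that multiplies the
  coefficient of \<open>u\<^sup>v\<close> by a linear form in \<open>v\<close>, and the residue into a single Laurent coefficient
  whose exponent this operator kills. So residues of derivatives vanish, and \<open>f \<mapsto> res\<^sub>b (e\<^bsup>\<langle>y|x\<rangle>\<^esup> f)\<close>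
  turns \<open>\<partial>\<^sub>i\<close> into multiplication by \<open>- y\<^sub>i\<close>. It kills \<open>R\<^bsub>X,s-1\<^esub>\<close>, because a denominator that does not
  span is constant in some direction, along which the fraction is a derivative. For no broken bases
  \<open>\<sigma>\<close> and \<open>\<tau>\<close> the residue at \<open>\<sigma>\<close> of \<open>e\<^bsup>\<langle>y|x\<rangle>\<^esup> / \<Prod>\<tau>\<close> is zero unless \<open>\<sigma> = \<tau>\<close>: comparing orders in each \<open>u\<^sub>t\<close>
  shows that otherwise \<open>\<tau>\<close> is adapted to the flag of \<open>\<sigma>\<close>, and no broken bases are minimal for their
  flags. Applied to an expansion of \<open>1/d\<close> this gives the formula and the uniqueness of the expansion.
  It exists, because a relation expressing \<open>a\<^sub>i\<close> by later elements of the denominator exchanges factors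
  and lowers the sum of the positions of the factors, until the support of the denominator is either
  not spanning or a no broken basis.
\<close>

section \<open>Polynomials\<close>

text \<open>The argument of \<open>p\<close> is \<open>-y\<close>, because each derivative that is
  moved from a basis fraction to the exponential changes the sign. Only the constant term of the
  exponential meets an undifferentiated basis fraction: the first variable \<open>u_1\<close>
  divides the image of every coordinate, so \<open>x^\<alpha>\<close> has \<open>u_1\<close>-order
  at least \<open>|\<alpha>|\<close>, whereas a product of s inverse linear forms has a
  \<open>u_1\<close>-pole of order at most s, and the residue asks for order s exactly. Hence the
  residues of the no broken basis fractions at the no broken bases form an identity matrix, constant
  in \<open>y\<close>, and each polynomial is read off by a single residue. The obstacle on the way
  is that \<open>j_map\<close> is a definite description over all representations of a fraction.
  Calculations are therefore confined to fractions with one representation whose denominator becomes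
  a unit in the Laurent ring. They are closed under sums, products and derivatives and, at a basis,
  contain every fraction whose denominator is a product of nonzero linear forms.\<close>

lemma mconst_add: "mconst (a + b) = mconst a + mconst b"
  by (simp add: mconst_def single_add)

lemma mconst_mult: "mconst (a * b) = mconst a * mconst b"
  by (simp add: mconst_def mult_single)

lemma mconst_0 [simp]: "mconst 0 = 0" and mconst_1 [simp]: "mconst 1 = 1"
  by (simp_all add: mconst_def)

lemma mvar_power: "mvar i ^ n = Poly_Mapping.single (Poly_Mapping.single i n) 1"
  by (induction n) (auto simp: mvar_def mult_single simp flip: single_add)

lemma prod_single_1:
  "(\<Prod>i\<in>A. Poly_Mapping.single (f i) (1::complex)) = Poly_Mapping.single (\<Sum>i\<in>A. f i) 1"
  by (induction A rule: infinite_finite_induct) (auto simp: mult_single)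

lemma exponent_eq_sum_single:
  fixes \<alpha> :: "'s::finite \<Rightarrow>\<^sub>0 nat"
  shows "(\<Sum>i\<in>UNIV. Poly_Mapping.single i (Poly_Mapping.lookup \<alpha> i)) = \<alpha>"
  by (rule poly_mapping_eqI) (simp add: lookup_sum lookup_single when_def)

lemma single_eq_monomial:
  fixes \<alpha> :: "'s::finite \<Rightarrow>\<^sub>0 nat"
  shows "Poly_Mapping.single \<alpha> c = mconst c * (\<Prod>i\<in>UNIV. mvar i ^ Poly_Mapping.lookup \<alpha> i)"
  by (simp add: mvar_power prod_single_1 exponent_eq_sum_single mconst_def mult_single)

lemma single_eq_mconst_mult: "Poly_Mapping.single \<alpha> c = mconst c * Poly_Mapping.single \<alpha> 1"
  by (simp add: mconst_def mult_single)

lemma mpoly_single_induct [case_names zero single_add]: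
  fixes p :: "'s mpoly"
  assumes "P 0" and "\<And>\<alpha> c q. P q \<Longrightarrow> P (Poly_Mapping.single \<alpha> c + q)"
  shows "P p"
proof -
  have "P (\<Sum>\<alpha>\<in>A. Poly_Mapping.single \<alpha> (Poly_Mapping.lookup p \<alpha>))" if "finite A" for A
    using that by induction (auto intro: assms)
  from this[of "Poly_Mapping.keys p"] show ?thesis
    by (simp add: mpoly_sum_single[symmetric])
qed

lemma mpoly_ring_induct [case_names const var add mult]:
  fixes p :: "'s::finite mpoly"
  assumes c: "\<And>c. P (mconst c)" and v: "\<And>i. P (mvar i)"
    and a: "\<And>p q. P p \<Longrightarrow> P q \<Longrightarrow> P (p + q)" and m: "\<And>p q. P p \<Longrightarrow> P q \<Longrightarrow> P (p * q)"
  shows "P p"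
proof (induction p rule: mpoly_single_induct)
  case zero
  show ?case using c[of 0] by simp
next
  case (single_add \<alpha> c q)
  have 1: "P 1" using c[of 1] by simp
  have pow: "P (mvar i ^ n)" for i n by (induction n) (auto intro: 1 v m)
  have "P (\<Prod>i\<in>A. mvar i ^ Poly_Mapping.lookup \<alpha> i)" if "finite A" for A
    using that by induction (auto intro: 1 m pow)
  from this[of UNIV] have "P (Poly_Mapping.single \<alpha> c)"
    by (auto simp: single_eq_monomial intro: m c)
  then show ?case using single_add by (rule a)
qed

lemma mderiv_mconst [simp]: "mderiv i (mconst c) = 0"
  by (simp add: mconst_def mderiv_single del: One_nat_def)

lemma mderiv_mvar: "mderiv i (mvar j) = (if i = j then 1 else 0)"
  by (auto simp: mvar_def mderiv_single lookup_single when_def simp del: One_nat_def)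

lemma mderiv_commute: "mderiv i (mderiv j p) = mderiv j (mderiv i p)"
  by (rule poly_mapping_eqI)
    (simp add: mderiv.rep_eq lookup_add lookup_single when_def ac_simps del: One_nat_def)

lemma mderiv_linform: "mderiv i (linform a) = mconst (a $ i)"
  by (simp add: linform_def mderiv_sum mderiv_mult mderiv_mvar if_distrib cong: if_cong)

lemma linform_add: "linform (a + b) = linform a + linform b"
  by (simp add: linform_def mconst_add algebra_simps sum.distrib)

lemma linform_scale: "linform (c *s a) = mconst c * linform a"
  by (simp add: linform_def mconst_mult sum_distrib_left mult.assoc)

lemma linform_0 [simp]: "linform 0 = 0"
  by (simp add: linform_def)

lemma mconst_eq_0_iff [simp]: "mconst c = 0 \<longleftrightarrow> c = 0"
  by (metis lookup_single_eq lookup_zero mconst_0 mconst_def)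

lemma linform_eq_0_iff [simp]: "linform a = 0 \<longleftrightarrow> a = 0"
proof
  assume "linform a = 0"
  then have "(mconst (a $ i) :: 'a mpoly) = 0" for i
    using mderiv_linform[of i a] by (simp del: mconst_eq_0_iff)
  then show "a = 0"
    by (auto simp: vec_eq_iff)
qed simp

lemma linform_axis: "linform (axis i 1) = mvar i"
  by (simp add: linform_def axis_def if_distrib[of mconst] if_distrib[of "\<lambda>c. c * _"] cong: if_cong)

section \<open>Substitution homomorphisms\<close>

locale const_hom =
  fixes \<kappa> :: "complex \<Rightarrow> 'b::comm_ring_1"
  assumes hom_add: "\<kappa> (a + b) = \<kappa> a + \<kappa> b"
    and hom_mult: "\<kappa> (a * b) = \<kappa> a * \<kappa> b"
    and hom_1: "\<kappa> 1 = 1"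
begin

lemma hom_0: "\<kappa> 0 = 0"
  using hom_add[of 0 0] by simp

lemma hom_sum: "\<kappa> (\<Sum>a\<in>A. f a) = (\<Sum>a\<in>A. \<kappa> (f a))"
  by (induction A rule: infinite_finite_induct) (auto simp: hom_add hom_0)

lemma hom_prod: "\<kappa> (\<Prod>a\<in>A. f a) = (\<Prod>a\<in>A. \<kappa> (f a))"
  by (induction A rule: infinite_finite_induct) (auto simp: hom_mult hom_1)

lemma hom_power: "\<kappa> (a ^ n) = \<kappa> a ^ n"
  by (induction n) (auto simp: hom_mult hom_1)

lemma hom_uminus: "\<kappa> (- a) = - \<kappa> a"
  using hom_add[of a "- a"] by (simp add: hom_0 eq_neg_iff_add_eq_0 add.commute)

lemma hom_of_nat: "\<kappa> (of_nat n) = of_nat n"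
  by (induction n) (auto simp: hom_add hom_0 hom_1)

lemma hom_of_int: "\<kappa> (of_int n) = of_int n"
  by (cases n) (simp_all add: hom_of_nat hom_uminus del: of_nat_Suc)

lemma msubst_single:
  "msubst \<kappa> \<phi> (Poly_Mapping.single \<alpha> c) = \<kappa> c * (\<Prod>i\<in>UNIV. \<phi> i ^ Poly_Mapping.lookup \<alpha> i)"
  by (cases "c = 0") (auto simp: msubst_def hom_0)

lemma msubst_superset:
  assumes "finite A" "Poly_Mapping.keys p \<subseteq> A"
  shows "msubst \<kappa> \<phi> p =
    (\<Sum>\<alpha>\<in>A. \<kappa> (Poly_Mapping.lookup p \<alpha>) * (\<Prod>i\<in>UNIV. \<phi> i ^ Poly_Mapping.lookup \<alpha> i))"
  unfolding msubst_def using assms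
  by (intro sum.mono_neutral_left) (auto simp: in_keys_iff hom_0)

lemma msubst_add: "msubst \<kappa> \<phi> (p + q) = msubst \<kappa> \<phi> p + msubst \<kappa> \<phi> q"
proof -
  let ?A = "Poly_Mapping.keys p \<union> Poly_Mapping.keys q"
  have "msubst \<kappa> \<phi> r = (\<Sum>\<alpha>\<in>?A. \<kappa> (Poly_Mapping.lookup r \<alpha>) * (\<Prod>i\<in>UNIV. \<phi> i ^ Poly_Mapping.lookup \<alpha> i))"
    if "r \<in> {p, q, p + q}" for r
    using that keys_add[of p q] by (intro msubst_superset) auto
  then show ?thesis
    by (simp add: lookup_add hom_add distrib_right sum.distrib)
qed

lemma msubst_0: "msubst \<kappa> \<phi> 0 = 0"
  by (simp add: msubst_def)

lemma msubst_mult: "msubst \<kappa> \<phi> (p * q) = msubst \<kappa> \<phi> p * msubst \<kappa> \<phi> q"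
proof (induction p rule: mpoly_single_induct)
  case zero
  show ?case by (simp add: msubst_0)
next
  case (single_add \<alpha> c p)
  have "msubst \<kappa> \<phi> (Poly_Mapping.single \<alpha> c * q) = msubst \<kappa> \<phi> (Poly_Mapping.single \<alpha> c) * msubst \<kappa> \<phi> q"
  proof (induction q rule: mpoly_single_induct)
    case zero
    show ?case by (simp add: msubst_0)
  next
    case (single_add \<beta> d q)
    have "msubst \<kappa> \<phi> (Poly_Mapping.single \<alpha> c * Poly_Mapping.single \<beta> d) =
        msubst \<kappa> \<phi> (Poly_Mapping.single \<alpha> c) * msubst \<kappa> \<phi> (Poly_Mapping.single \<beta> d)"
      by (simp add: mult_single msubst_single lookup_add power_add prod.distrib hom_mult algebra_simps)
    with single_add show ?case by (simp add: distrib_left msubst_add)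
  qed
  with single_add show ?case by (simp add: distrib_right msubst_add)
qed

lemma msubst_mconst: "msubst \<kappa> \<phi> (mconst c) = \<kappa> c"
  by (simp add: mconst_def msubst_single)

lemma msubst_mvar: "msubst \<kappa> \<phi> (mvar i) = \<phi> i"
proof -
  have "(\<Prod>j\<in>UNIV. \<phi> j ^ (1 when i = j)) = (\<Prod>j\<in>UNIV. if j = i then \<phi> j else 1)"
    by (rule prod.cong) (auto simp: when_def)
  also have "\<dots> = \<phi> i" by simp
  finally show ?thesis
    by (simp add: mvar_def msubst_single hom_1 lookup_single)
qed

lemma msubst_sum: "msubst \<kappa> \<phi> (\<Sum>a\<in>A. f a) = (\<Sum>a\<in>A. msubst \<kappa> \<phi> (f a))"
  by (induction A rule: infinite_finite_induct) (auto simp: msubst_add msubst_0)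

end

interpretation mconst: const_hom mconst
  by unfold_locales (simp_all add: mconst_add mconst_mult)

text \<open>The sign \<open>(-1)^|\<alpha>|\<close> is the one that \<open>|\<alpha>|\<close>
  integrations by parts produce in \<open>exp_res_diffop\<close>; this matches \<open>p(-y)\<close>
  with the residues coefficient by coefficient.\<close>

lemma lookup_msubst_uminus:
  fixes p :: "'s::finite mpoly"
  shows "Poly_Mapping.lookup (msubst mconst (\<lambda>i. - mvar i) p) \<alpha> =
    (-1) ^ (\<Sum>i\<in>UNIV. Poly_Mapping.lookup \<alpha> i) * Poly_Mapping.lookup p \<alpha>"
proof (induction p rule: mpoly_single_induct)
  case zero
  show ?case by (simp add: mconst.msubst_0)
next
  case (single_add \<beta> c p)
  have "(\<Prod>i\<in>UNIV. (- mvar i) ^ Poly_Mapping.lookup \<beta> i) =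
      (\<Prod>i\<in>UNIV. mconst (-1) ^ Poly_Mapping.lookup \<beta> i * mvar i ^ Poly_Mapping.lookup \<beta> i)"
    by (simp add: mconst.hom_uminus flip: power_mult_distrib)
  also have "\<dots> = mconst ((-1) ^ (\<Sum>i\<in>UNIV. Poly_Mapping.lookup \<beta> i)) *
      (\<Prod>i\<in>UNIV. mvar i ^ Poly_Mapping.lookup \<beta> i)"
    by (simp add: prod.distrib power_sum mconst.hom_prod mconst.hom_power mconst.hom_uminus)
  finally have "msubst mconst (\<lambda>i. - mvar i) (Poly_Mapping.single \<beta> c) =
      Poly_Mapping.single \<beta> ((-1) ^ (\<Sum>i\<in>UNIV. Poly_Mapping.lookup \<beta> i) * c)"
    unfolding mconst.msubst_single single_eq_monomial[of \<beta> "_ * c"] mconst_mult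
    by (simp only: ac_simps)
  then show ?case
    using single_add by (auto simp: mconst.msubst_add lookup_add lookup_single when_def distrib_left)
qed

section \<open>Rational functions\<close>

lemma of_mpoly_add: "of_mpoly (p + q) = of_mpoly p + of_mpoly q"
  by (simp add: of_mpoly_def)

lemma of_mpoly_mult: "of_mpoly (p * q) = of_mpoly p * of_mpoly q"
  by (simp add: of_mpoly_def)

lemma of_mpoly_0 [simp]: "of_mpoly 0 = 0" and of_mpoly_1 [simp]: "of_mpoly 1 = 1"
  by (simp_all add: of_mpoly_def Zero_fract_def One_fract_def)

lemma of_mpoly_eq_0_iff [simp]: "of_mpoly p = 0 \<longleftrightarrow> p = 0"
  by (simp add: of_mpoly_def Zero_fract_def eq_fract)

lemma Fract_eq_divide: "Fract p q = of_mpoly p / of_mpoly q"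
  by (simp add: of_mpoly_def)

definition rconst :: "complex \<Rightarrow> 's::{finite,linorder} ratfun"
  where "rconst c = of_mpoly (mconst c)"

interpretation rconst: const_hom rconst
  by unfold_locales (simp_all add: rconst_def mconst_add mconst_mult of_mpoly_add of_mpoly_mult)

lemma of_mpoly_single:
  "of_mpoly (Poly_Mapping.single \<alpha> c) = rconst c * of_mpoly (Poly_Mapping.single \<alpha> 1)"
  by (simp only: single_eq_mconst_mult[of \<alpha> c] of_mpoly_mult rconst_def)

lemma rscale_eq: "rscale c f = rconst c * f"
  by (simp add: rscale_def rconst_def)

lemma rconst_eq_0_iff [simp]: "rconst c = 0 \<longleftrightarrow> c = 0"
  by (simp add: rconst_def)

lemma rderiv_Fract:
  assumes "q \<noteq> 0"
  shows "rderiv i (Fract p q) = Fract (mderiv i p * q - p * mderiv i q) (q * q)"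
  using assms by (simp add: Fraction_Field.Fract.abs_eq rderiv.abs_eq eq_onp_def)

lemma rderiv_of_mpoly: "rderiv i (of_mpoly p) = of_mpoly (mderiv i p)"
  using mderiv_mconst[of i 1] by (simp add: of_mpoly_def rderiv_Fract)

text \<open>With \<open>dp\<close> read as the derivative of \<open>p\<close>, these are the
  identities behind the sum and product rules for fractions, freed from derivatives so that ring
  normalisation decides them.\<close>

lemma quotient_rule_identities:
  fixes p :: "'a::comm_ring"
  shows "(dp * q' + p * dq' + (dp' * q + p' * dq)) * (q * q') -
      (p * q' + p' * q) * (dq * q' + q * dq') =
      (dp * q - p * dq) * (q' * q') + (dp' * q' - p' * dq') * (q * q)"
    and "((dp * p' + p * dp') * (q * q') - p * p' * (dq * q' + q * dq')) * (q * q') =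
      (dp * q - p * dq) * p' * (q * (q' * q')) + p * (dp' * q' - p' * dq') * (q * q * q')"
  by (simp_all add: algebra_simps)

lemma rderiv_add: "rderiv i (f + g) = rderiv i f + rderiv i g"
proof -
  obtain p q p' q' where "f = Fract p q" "g = Fract p' q'" "q \<noteq> 0" "q' \<noteq> 0"
    by (metis Fract_cases)
  then show ?thesis
    by (simp add: rderiv_Fract eq_fract mderiv_add mderiv_mult quotient_rule_identities)
qed

lemma rderiv_mult: "rderiv i (f * g) = rderiv i f * g + f * rderiv i g"
proof -
  obtain p q p' q' where "f = Fract p q" "g = Fract p' q'" "q \<noteq> 0" "q' \<noteq> 0"
    by (metis Fract_cases)
  then show ?thesis
    by (simp add: rderiv_Fract eq_fract mderiv_add mderiv_mult quotient_rule_identities)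
qed

lemma rderiv_rconst [simp]: "rderiv i (rconst c) = 0"
  by (simp add: rconst_def rderiv_of_mpoly)

lemma rderiv_rconst_mult: "rderiv i (rconst c * f) = rconst c * rderiv i f"
  by (simp add: rderiv_mult)

lemma rderiv_0 [simp]: "rderiv i 0 = 0"
  using rderiv_of_mpoly[of i 0] by simp

text \<open>The commutator of two derivations is a derivation. It kills polynomials by
  \<open>mderiv_commute\<close>, so on \<open>f * q = p\<close> it leaves only the commutator of
  \<open>f\<close> times \<open>q\<close>, which must vanish.\<close>

lemma rderiv_commute: "rderiv i (rderiv j f) = rderiv j (rderiv i f)"
proof -
  obtain p q where f: "f = Fract p q" and q: "q \<noteq> 0"
    by (metis Fract_cases)
  then have fq: "f * of_mpoly q = of_mpoly p"
    by (simp add: Fract_eq_divide)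
  from arg_cong[OF this, of "\<lambda>g. rderiv i (rderiv j g) - rderiv j (rderiv i g)"]
  have "(rderiv i (rderiv j f) - rderiv j (rderiv i f)) * of_mpoly q = 0"
    by (simp add: rderiv_of_mpoly rderiv_mult rderiv_add mderiv_commute[of i j] algebra_simps)
  with q show ?thesis by simp
qed

text \<open>Coordinate directions do not suffice: residues vanish first along the directions dual to
  a basis, and a denominator that does not span is constant along a vector of its
  annihilator.\<close>

definition dirderiv :: "complex ^ 's::{finite,linorder} \<Rightarrow> 's ratfun \<Rightarrow> 's ratfun"
  where "dirderiv v f = (\<Sum>i\<in>UNIV. rconst (v $ i) * rderiv i f)"

lemma dirderiv_mult: "dirderiv v (f * g) = dirderiv v f * g + f * dirderiv v g"
  by (simp add: dirderiv_def rderiv_mult algebra_simps sum.distrib sum_distrib_left sum_distrib_right)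

lemma dirderiv_rconst [simp]: "dirderiv v (rconst c) = 0"
  by (simp add: dirderiv_def)

lemma dirderiv_1 [simp]: "dirderiv v 1 = 0"
  using dirderiv_rconst[of v 1] by (simp add: rconst.hom_1)

lemma dirderiv_linform: "dirderiv v (of_mpoly (linform a)) = rconst (\<Sum>i\<in>UNIV. v $ i * a $ i)"
  by (simp add: dirderiv_def rderiv_of_mpoly mderiv_linform rconst.hom_sum rconst.hom_mult)
    (simp add: rconst_def)

lemma dirderiv_power_Suc: "dirderiv v (f ^ Suc n) = of_nat (Suc n) * f ^ n * dirderiv v f"
  by (induction n) (simp_all add: dirderiv_mult algebra_simps)

lemma dirderiv_inverse:
  assumes "f \<noteq> 0"
  shows "dirderiv v (1 / f) = - dirderiv v f / f ^ 2"
proof -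
  have "dirderiv v (f * (1 / f)) = 0" using assms by simp
  then have "f * dirderiv v (1 / f) = - (dirderiv v f * (1 / f))"
    unfolding dirderiv_mult by (simp add: add_eq_0_iff)
  with assms show ?thesis
    by (simp add: field_simps power2_eq_square)
qed

lemma dirderiv_prod_0:
  "(\<And>a. a \<in> A \<Longrightarrow> dirderiv v (f a) = 0) \<Longrightarrow> dirderiv v (\<Prod>a\<in>A. f a) = 0"
  by (induction A rule: infinite_finite_induct) (auto simp: dirderiv_mult)

lemma dirderiv_power_0: "dirderiv v f = 0 \<Longrightarrow> dirderiv v (f ^ n) = 0"
  by (induction n) (auto simp: dirderiv_mult)

lemma dirderiv_inverse_0: "dirderiv v f = 0 \<Longrightarrow> dirderiv v (1 / f) = 0"
  by (cases "f = 0") (auto simp: dirderiv_inverse)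

section \<open>Laurent series\<close>

lemma laurent_coeff_0 [simp]: "laurent_coeff 0 k = 0"
  by (simp add: zero_laurent.rep_eq)

lemma laurent_coeff_add [simp]: "laurent_coeff (f + g) k = laurent_coeff f k + laurent_coeff g k"
  by (simp add: plus_laurent.rep_eq)

lemma laurent_coeff_uminus [simp]: "laurent_coeff (- f) k = - laurent_coeff f k"
  by (simp add: uminus_laurent.rep_eq)

lemma laurent_coeff_diff [simp]: "laurent_coeff (f - g) k = laurent_coeff f k - laurent_coeff g k"
  by (simp only: minus_laurent_def laurent_coeff_add laurent_coeff_uminus diff_conv_add_uminus)

lemma laurent_coeff_sum: "laurent_coeff (\<Sum>a\<in>A. f a) k = (\<Sum>a\<in>A. laurent_coeff (f a) k)"
  by (induction A rule: infinite_finite_induct) auto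

lemma laurent_coeff_1: "laurent_coeff 1 k = (if k = 0 then 1 else 0)"
  by (simp add: one_laurent.rep_eq)

lemma laurent_coeff_monom_mult:
  "laurent_coeff (laurent_monom a c * f) k = c * laurent_coeff f (k - a)"
proof -
  have "Sum_any (\<lambda>l. (if l = a then c else 0) * laurent_coeff f (k - l)) =
      Sum_any (\<lambda>l. if l = a then c * laurent_coeff f (k - l) else 0)"
    by (rule Sum_any.cong) simp
  then show ?thesis
    by (simp add: times_laurent.rep_eq laurent_monom.rep_eq)
qed

lemma laurent_monom_mult: "laurent_monom a c * laurent_monom b d = laurent_monom (a + b) (c * d)"
  by (rule laurent_eqI) (auto simp: laurent_coeff_monom_mult laurent_monom.rep_eq algebra_simps)

lemma laurent_monom_0_1: "laurent_monom 0 1 = 1"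
  by (rule laurent_eqI) (simp add: laurent_monom.rep_eq laurent_coeff_1)

lemma laurent_monom_prod:
  "(\<Prod>a\<in>A. laurent_monom (f a) 1) = laurent_monom (\<Sum>a\<in>A. f a) 1"
  by (induction A rule: infinite_finite_induct) (auto simp: laurent_monom_0_1 laurent_monom_mult)

interpretation laurent_const: const_hom laurent_const
proof
  fix a b :: complex
  show "laurent_const (a + b) = laurent_const a + laurent_const b"
    by (rule laurent_eqI) (simp add: laurent_const_def laurent_monom.rep_eq)
  show "laurent_const (a * b) = laurent_const a * laurent_const b"
    by (simp add: laurent_const_def laurent_monom_mult)
  show "laurent_const 1 = 1"
    by (simp add: laurent_const_def laurent_monom_0_1)
qed

lemma laurent_coeff_const_mult: "laurent_coeff (laurent_const c * f) k = c * laurent_coeff f k"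
  by (simp add: laurent_const_def laurent_coeff_monom_mult)

lemma laurent_coeff_mult_superset:
  assumes "finite A" and "\<And>l. laurent_coeff f l * laurent_coeff g (k - l) \<noteq> 0 \<Longrightarrow> l \<in> A"
  shows "laurent_coeff (f * g) k = (\<Sum>l\<in>A. laurent_coeff f l * laurent_coeff g (k - l))"
  unfolding times_laurent.rep_eq by (rule Sum_any.expand_superset) (use assms in auto)

lemma laurent_coeff_mult_nonzero:
  assumes "laurent_coeff (f * g) k \<noteq> 0"
  obtains l where "laurent_coeff f l \<noteq> 0" "laurent_coeff g (k - l) \<noteq> 0"
proof -
  have "Sum_any (\<lambda>l. laurent_coeff f l * laurent_coeff g (k - l)) \<noteq> 0"
    using assms by (simp add: times_laurent.rep_eq)
  from Sum_any.not_neutral_obtains_not_neutral[OF this] show ?thesis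
    using that by (metis mult_eq_0_iff)
qed

section \<open>Lower bounds for the order in one variable\<close>

definition ord_ge :: "'s \<Rightarrow> int \<Rightarrow> 's::finite laurent \<Rightarrow> bool"
  where "ord_ge t m f \<longleftrightarrow> (\<forall>k. laurent_coeff f k \<noteq> 0 \<longrightarrow> m \<le> k $ t)"

lemma ord_geD: "ord_ge t m f \<Longrightarrow> k $ t < m \<Longrightarrow> laurent_coeff f k = 0"
  unfolding ord_ge_def by (meson not_le)

lemma ord_ge_0 [simp]: "ord_ge t m 0"
  by (simp add: ord_ge_def)

lemma ord_ge_1: "ord_ge t 0 1"
  by (simp add: ord_ge_def laurent_coeff_1)

lemma ord_ge_add: "ord_ge t m f \<Longrightarrow> ord_ge t m g \<Longrightarrow> ord_ge t m (f + g)"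
  unfolding ord_ge_def by (metis add.right_neutral laurent_coeff_add)

lemma ord_ge_uminus: "ord_ge t m f \<Longrightarrow> ord_ge t m (- f)"
  by (simp add: ord_ge_def)

lemma ord_ge_sum: "(\<And>a. a \<in> A \<Longrightarrow> ord_ge t m (f a)) \<Longrightarrow> ord_ge t m (\<Sum>a\<in>A. f a)"
  by (induction A rule: infinite_finite_induct) (auto intro: ord_ge_add)

lemma ord_ge_mult: "ord_ge t m f \<Longrightarrow> ord_ge t n g \<Longrightarrow> ord_ge t (m + n) (f * g)"
  unfolding ord_ge_def
proof (intro allI impI)
  fix k
  assume f: "\<forall>k. laurent_coeff f k \<noteq> 0 \<longrightarrow> m \<le> k $ t"
    and g: "\<forall>k. laurent_coeff g k \<noteq> 0 \<longrightarrow> n \<le> k $ t" and "laurent_coeff (f * g) k \<noteq> 0"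
  then obtain l where "laurent_coeff f l \<noteq> 0" "laurent_coeff g (k - l) \<noteq> 0"
    by (elim laurent_coeff_mult_nonzero)
  with f g have "m \<le> l $ t" "n \<le> (k - l) $ t" by blast+
  then show "m + n \<le> k $ t" by simp
qed

lemma ord_ge_prod:
  "finite A \<Longrightarrow> (\<And>a. a \<in> A \<Longrightarrow> ord_ge t (m a) (f a)) \<Longrightarrow> ord_ge t (\<Sum>a\<in>A. m a) (\<Prod>a\<in>A. f a)"
  by (induction A rule: finite_induct) (auto intro: ord_ge_1 ord_ge_mult)

lemma ord_ge_power: "ord_ge t m f \<Longrightarrow> ord_ge t (int n * m) (f ^ n)"
  by (induction n) (auto intro: ord_ge_1 ord_ge_mult simp: distrib_right)

lemma ord_ge_monom: "m \<le> a $ t \<Longrightarrow> ord_ge t m (laurent_monom a c)"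
  by (simp add: ord_ge_def laurent_monom.rep_eq)

lemma ord_ge_const_mult: "ord_ge t m f \<Longrightarrow> ord_ge t m (laurent_const c * f)"
  by (simp add: ord_ge_def laurent_coeff_const_mult)

text \<open>Every monomial of \<open>g\<close> has nonnegative exponents and, without constant term,
  total degree at least 1, so each further factor raises the degree. Hence only finitely many powers
  of \<open>g\<close> reach a given coefficient.\<close>

lemma laurent_power_coeff_nonzero:
  assumes "\<And>t. ord_ge t 0 g" and "laurent_coeff g 0 = 0" and "laurent_coeff (g ^ n) k \<noteq> 0"
  shows "int n \<le> (\<Sum>t\<in>UNIV. k $ t)"
  using assms(3)
proof (induction n arbitrary: k)
  case 0
  then show ?case by (simp add: laurent_coeff_1 split: if_splits)
next
  case (Suc n)
  then have "laurent_coeff (g * g ^ n) k \<noteq> 0" by simp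
  then obtain l where l: "laurent_coeff g l \<noteq> 0" "laurent_coeff (g ^ n) (k - l) \<noteq> 0"
    by (rule laurent_coeff_mult_nonzero)
  have nonneg: "0 \<le> l $ t" for t
    using assms(1) l(1) by (auto simp: ord_ge_def)
  have "l \<noteq> 0" using l(1) assms(2) by auto
  then obtain t where "l $ t \<noteq> 0" by (auto simp: vec_eq_iff)
  with nonneg have "0 < (\<Sum>t\<in>UNIV. l $ t)"
    by (intro sum_pos2[of UNIV t]) (auto simp: order_less_le)
  moreover have "int n \<le> (\<Sum>t\<in>UNIV. (k - l) $ t)"
    using Suc.IH l(2) by blast
  ultimately show ?case by (simp add: sum_subtractf)
qed

lemma power_series_inverse:
  fixes g :: "'s::finite laurent"
  assumes ord: "\<And>t. ord_ge t 0 g" and g0: "laurent_coeff g 0 = 0"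
  obtains h where "(1 - g) * h = 1" "\<And>t. ord_ge t 0 h"
proof -
  define S where "S n = (\<Sum>m\<le>n. g ^ m)" for n
  define d where "d k = nat (\<Sum>t\<in>UNIV. k $ t)" for k :: "int ^ 's"
  \<comment> \<open>A coefficient of the geometric series is reached by a partial sum, as \<open>g\<close> has no constant term.\<close>
  define h where "h = Abs_laurent (\<lambda>k. laurent_coeff (S (d k)) k)"
  have ordS: "ord_ge t 0 (S n)" for n t
    unfolding S_def using ord_ge_power[OF ord] by (intro ord_ge_sum) auto
  have coeff_h: "laurent_coeff h k = laurent_coeff (S (d k)) k" for k
  proof -
    have "(\<lambda>k. laurent_coeff (S (d k)) k) \<in>
        {f. \<exists>m. \<forall>k i. f k \<noteq> 0 \<longrightarrow> m \<le> k $ i}"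
      using ordS by (auto simp: ord_ge_def)
    then show ?thesis by (simp add: h_def Abs_laurent_inverse)
  qed
  have ordh: "ord_ge t 0 h" for t
    using ordS by (simp add: ord_ge_def coeff_h)
  have stable: "laurent_coeff (S n) k = laurent_coeff h k" if "d k \<le> n" for n k
  proof -
    have "laurent_coeff (g ^ m) k = 0" if "d k < m" for m
      using laurent_power_coeff_nonzero[OF ord g0, of m k] that by (force simp: d_def)
    then show ?thesis
      unfolding coeff_h S_def laurent_coeff_sum
      using \<open>d k \<le> n\<close> by (intro sum.mono_neutral_right) auto
  qed
  have telescope: "(1 - g) * S n = 1 - g ^ Suc n" for n
    unfolding S_def by (simp add: sum_gp_basic)
  have "laurent_coeff ((1 - g) * h) k = laurent_coeff 1 k" for k
  proof -
    have ord1: "ord_ge t 0 (1 - g)" for t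
      using ord_ge_add[OF ord_ge_1 ord_ge_uminus[OF ord]] by simp
    \<comment> \<open>The exponents of \<open>1 - g\<close> are nonnegative, so the remaining
      exponent \<open>k - l\<close> has at most the total degree of \<open>k\<close>, and the one
      partial sum \<open>S (d k)\<close> serves all terms of the convolution.\<close>
    have "laurent_coeff ((1 - g) * h) k = laurent_coeff ((1 - g) * S (d k)) k"
      unfolding times_laurent.rep_eq
    proof (intro Sum_any.cong)
      fix l
      show "laurent_coeff (1 - g) l * laurent_coeff h (k - l) =
          laurent_coeff (1 - g) l * laurent_coeff (S (d k)) (k - l)"
      proof (cases "laurent_coeff (1 - g) l = 0")
        case False
        then have "0 \<le> l $ t" for t
          using ord1 unfolding ord_ge_def by blast
        then have "0 \<le> (\<Sum>t\<in>UNIV. l $ t)" by (simp add: sum_nonneg)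
        then have "d (k - l) \<le> d k"
          by (simp add: d_def sum_subtractf)
        then show ?thesis by (simp add: stable)
      qed simp
    qed
    also have "\<dots> = laurent_coeff 1 k - laurent_coeff (g ^ Suc (d k)) k"
      by (simp only: telescope laurent_coeff_diff)
    \<comment> \<open>\<open>Suc (d k)\<close> exceeds the total degree of \<open>k\<close>, even
      where \<open>nat\<close> truncates a negative degree to 0, so the error term of the telescope
      does not reach this coefficient.\<close>
    also have "laurent_coeff (g ^ Suc (d k)) k = 0"
    proof (rule ccontr)
      assume "laurent_coeff (g ^ Suc (d k)) k \<noteq> 0"
      from laurent_power_coeff_nonzero[OF ord g0 this] show False
        by (simp add: d_def split: if_splits)
    qed
    finally show ?thesis by simp
  qed
  then show ?thesis
    using that ordh laurent_eqI by blast
qed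

section \<open>Euler operators and partial derivatives\<close>

lift_definition laurent_euler :: "(int ^ 's \<Rightarrow> int) \<Rightarrow> 's::finite laurent \<Rightarrow> 's laurent"
  is "\<lambda>w f k. of_int (w k) * f k"
  by (metis mult_zero_right)

lemma laurent_euler_add: "laurent_euler w (f + g) = laurent_euler w f + laurent_euler w g"
  by (rule laurent_eqI) (simp add: laurent_euler.rep_eq algebra_simps)

lemma laurent_euler_sum: "laurent_euler w (\<Sum>a\<in>A. f a) = (\<Sum>a\<in>A. laurent_euler w (f a))"
  by (rule laurent_eqI) (simp add: laurent_euler.rep_eq laurent_coeff_sum sum_distrib_left)

lemma laurent_euler_monom:
  "laurent_euler w (laurent_monom a c) = laurent_const (of_int (w a)) * laurent_monom a c"
  by (rule laurent_eqI)
    (simp add: laurent_euler.rep_eq laurent_coeff_const_mult laurent_monom.rep_eq)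

text \<open>An additive weight splits as \<open>w l + w (k - l)\<close> in each term of the
  convolution. For \<open>w k = k $ t\<close> this is the Leibniz rule of \<open>u_t\<close> times
  the derivative by \<open>u_t\<close>.\<close>

lemma laurent_euler_mult:
  assumes w: "\<And>k l. w (k + l) = w k + w l"
  shows "laurent_euler w (f * g) = laurent_euler w f * g + f * laurent_euler w g"
proof (rule laurent_eqI)
  fix k
  let ?A = "{l. laurent_coeff f l * laurent_coeff g (k - l) \<noteq> 0}"
  have A: "finite ?A" by (rule laurent_conv_finite)
  have wk: "w k = w l + w (k - l)" for l
    using w[of l "k - l"] by simp
  have "laurent_coeff (laurent_euler w (f * g)) k =
      (\<Sum>l\<in>?A. of_int (w k) * (laurent_coeff f l * laurent_coeff g (k - l)))"
    using laurent_coeff_mult_superset[OF A, of f g k]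
    by (simp add: laurent_euler.rep_eq sum_distrib_left)
  also have "\<dots> = (\<Sum>l\<in>?A. laurent_coeff (laurent_euler w f) l * laurent_coeff g (k - l)) +
      (\<Sum>l\<in>?A. laurent_coeff f l * laurent_coeff (laurent_euler w g) (k - l))"
    unfolding sum.distrib[symmetric]
  proof (intro sum.cong refl)
    fix l
    show "of_int (w k) * (laurent_coeff f l * laurent_coeff g (k - l)) =
        laurent_coeff (laurent_euler w f) l * laurent_coeff g (k - l) +
        laurent_coeff f l * laurent_coeff (laurent_euler w g) (k - l)"
      unfolding wk[of l] by (simp add: laurent_euler.rep_eq algebra_simps)
  qed
  also have "\<dots> = laurent_coeff (laurent_euler w f * g + f * laurent_euler w g) k"
    using laurent_coeff_mult_superset[OF A, of "laurent_euler w f" g k]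
      laurent_coeff_mult_superset[OF A, of f "laurent_euler w g" k]
    by (simp add: laurent_euler.rep_eq)
  finally show "laurent_coeff (laurent_euler w (f * g)) k =
      laurent_coeff (laurent_euler w f * g + f * laurent_euler w g) k" .
qed

lemma laurent_deriv_add: "laurent_deriv t (f + g) = laurent_deriv t f + laurent_deriv t g"
  by (rule laurent_eqI) (simp add: laurent_deriv.rep_eq algebra_simps)

lemma laurent_deriv_0: "laurent_deriv t 0 = 0"
  by (rule laurent_eqI) (simp add: laurent_deriv.rep_eq)

lemma laurent_deriv_sum: "laurent_deriv t (\<Sum>a\<in>A. f a) = (\<Sum>a\<in>A. laurent_deriv t (f a))"
  by (induction A rule: infinite_finite_induct) (auto simp: laurent_deriv_add laurent_deriv_0)

lemma laurent_deriv_const_mult: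
  "laurent_deriv t (laurent_const c * f) = laurent_const c * laurent_deriv t f"
  by (rule laurent_eqI) (simp add: laurent_deriv.rep_eq laurent_coeff_const_mult)

lemma laurent_deriv_monom:
  "laurent_deriv t (laurent_monom a c) = laurent_monom (a - axis t 1) (of_int (a $ t) * c)"
  by (rule laurent_eqI) (auto simp: laurent_deriv.rep_eq laurent_monom.rep_eq algebra_simps)

section \<open>The expansion at a basis\<close>

text \<open>The exponent of \<open>b\<^sub>k = \<Prod>\<^bsub>l \<le> k\<^esub> u\<^sub>l\<close>.\<close>

definition flag_exp :: "'s::{finite,linorder} \<Rightarrow> int ^ 's::{finite,linorder}"
  where "flag_exp k = (\<chi> l. if l \<le> k then 1 else 0)"

abbreviation flag_monom :: "'s::{finite,linorder} \<Rightarrow> 's laurent"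
  where "flag_monom k \<equiv> laurent_monom (flag_exp k) 1"

lemma prod_u_var: "(\<Prod>l\<in>{..k}. u_var l) = flag_monom k"
proof -
  have "(\<Sum>l\<in>{..k}. axis l 1) = flag_exp k"
    by (simp add: vec_eq_iff flag_exp_def axis_def cong: if_cong)
  then show ?thesis by (simp add: u_var_def laurent_monom_prod)
qed

lemma x_image_eq:
  "x_image b i = (\<Sum>k\<in>UNIV. laurent_const (matrix_inv (\<chi> k. b k) $ i $ k) * flag_monom k)"
  by (simp add: x_image_def prod_u_var)

text \<open>The weights are dual to the exponents \<open>flag_exp k\<close>; the Euler operator of \<open>flag_weight k\<close>
  is \<open>b\<^sub>k \<partial>/\<partial>b\<^sub>k\<close>.\<close>

definition flag_weight :: "'s::{finite,linorder} \<Rightarrow> int ^ 's::{finite,linorder} \<Rightarrow> int"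
  where "flag_weight k v = v $ k - (if {k<..} = {} then 0 else v $ Min {k<..})"

lemma flag_weight_add: "flag_weight k (v + w) = flag_weight k v + flag_weight k w"
  by (simp add: flag_weight_def)

lemma flag_weight_0: "flag_weight k 0 = 0"
  by (simp add: flag_weight_def)

lemma flag_weight_uminus: "flag_weight k (- v) = - flag_weight k v"
  by (simp add: flag_weight_def)

lemma flag_weight_sum: "flag_weight k (\<Sum>a\<in>A. f a) = (\<Sum>a\<in>A. flag_weight k (f a))"
  by (induction A rule: infinite_finite_induct) (auto simp: flag_weight_add flag_weight_0)

text \<open>\<open>flag_exp m\<close> steps from 1 to 0 after \<open>m\<close>, and
  \<open>flag_weight k\<close> is the drop from \<open>k\<close> to its successor
  \<open>Min {k<..}\<close>. After the last \<open>k\<close> the next entry counts as 0, so the step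
  of the constant vector is seen there.\<close>

lemma flag_weight_flag_exp: "flag_weight k (flag_exp m) = (if k = m then 1 else 0)"
proof (cases "{k<..} = {}")
  case True
  then have "m \<le> k" by (metis empty_iff greaterThan_iff not_le)
  with True show ?thesis by (auto simp: flag_weight_def flag_exp_def)
next
  case False
  then have "Min {k<..} \<le> m \<longleftrightarrow> k < m"
    by (subst Min_le_iff) (auto intro: less_le_trans)
  with False show ?thesis by (auto simp: flag_weight_def flag_exp_def)
qed

lemma laurent_euler_flag_monom:
  "laurent_euler (flag_weight k) (flag_monom m) = (if k = m then flag_monom m else 0)"
  by (auto simp: laurent_euler_monom flag_weight_flag_exp laurent_const.hom_0 laurent_const.hom_1)

lemma laurent_euler_const: "laurent_euler (flag_weight k) (laurent_const c) = 0"
  by (simp add: laurent_const_def laurent_euler_monom flag_weight_0)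
    (simp add: laurent_const.hom_0 flip: laurent_const_def)

lemma laurent_euler_flag_mult:
  "laurent_euler (flag_weight k) (f * g) =
    laurent_euler (flag_weight k) f * g + f * laurent_euler (flag_weight k) g"
  by (rule laurent_euler_mult) (rule flag_weight_add)

lemmas j_mpoly_add = laurent_const.msubst_add[of "x_image b" for b, folded j_mpoly_def]
  and j_mpoly_mult = laurent_const.msubst_mult[of "x_image b" for b, folded j_mpoly_def]
  and j_mpoly_0 [simp] = laurent_const.msubst_0[of "x_image b" for b, folded j_mpoly_def]
  and j_mpoly_sum = laurent_const.msubst_sum[of "x_image b" for b, folded j_mpoly_def]
  and j_mpoly_mconst = laurent_const.msubst_mconst[of "x_image b" for b, folded j_mpoly_def]
  and j_mpoly_mvar = laurent_const.msubst_mvar[of "x_image b" for b, folded j_mpoly_def]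

lemma j_mpoly_1 [simp]: "j_mpoly b 1 = 1"
  using j_mpoly_mconst[of b 1] by (simp add: laurent_const.hom_1)

text \<open>The row vector \<open>a\<close> times the inverse of the matrix whose rows are the
  members of \<open>b\<close>: for a basis, the coefficients of \<open>a\<close> in \<open>b\<close>
  (\<open>basis_expansion_coord\<close>).\<close>

definition basis_coord :: "('s \<Rightarrow> complex ^ 's::{finite,linorder}) \<Rightarrow> complex ^ 's::{finite,linorder} \<Rightarrow> 's \<Rightarrow> complex"
  where "basis_coord b a k = (\<Sum>i\<in>UNIV. a $ i * matrix_inv (\<chi> k. b k) $ i $ k)"

lemma j_mpoly_linform:
  "j_mpoly b (linform a) = (\<Sum>k\<in>UNIV. laurent_const (basis_coord b a k) * flag_monom k)"
proof -
  have "j_mpoly b (linform a) = (\<Sum>i\<in>UNIV. \<Sum>k\<in>UNIV.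
      laurent_const (a $ i) * (laurent_const (matrix_inv (\<chi> k. b k) $ i $ k) * flag_monom k))"
    by (simp add: linform_def j_mpoly_sum j_mpoly_mult j_mpoly_mconst j_mpoly_mvar x_image_eq
        sum_distrib_left)
  also have "\<dots> = (\<Sum>k\<in>UNIV. \<Sum>i\<in>UNIV.
      laurent_const (a $ i) * (laurent_const (matrix_inv (\<chi> k. b k) $ i $ k) * flag_monom k))"
    by (rule sum.swap)
  finally show ?thesis
    by (simp add: basis_coord_def laurent_const.hom_sum laurent_const.hom_mult sum_distrib_right
        mult.assoc)
qed

text \<open>The chain rule for \<open>b_k \<partial>/\<partial>b_k\<close>: column k of the inverse
  matrix holds the derivatives of the \<open>x_i\<close> by \<open>b_k\<close>. Both sides obey the
  Leibniz rule along the substitution, so constants and variables decide.\<close>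

lemma laurent_euler_j_mpoly:
  "laurent_euler (flag_weight k) (j_mpoly b p) =
    flag_monom k * (\<Sum>i\<in>UNIV. laurent_const (matrix_inv (\<chi> k. b k) $ i $ k) * j_mpoly b (mderiv i p))"
proof (induction p rule: mpoly_ring_induct)
  case (const c)
  show ?case by (simp add: j_mpoly_mconst laurent_euler_const)
next
  case (var i)
  have "laurent_euler (flag_weight k) (j_mpoly b (mvar i)) =
      (\<Sum>m\<in>UNIV. if k = m then laurent_const (matrix_inv (\<chi> k. b k) $ i $ m) * flag_monom m else 0)"
    by (simp add: j_mpoly_mvar x_image_eq laurent_euler_sum laurent_euler_flag_mult
        laurent_euler_const laurent_euler_flag_monom if_distrib[of "\<lambda>x. _ * x"] cong: if_cong)
  then show ?case
    by (simp add: mderiv_mvar if_distrib[of "j_mpoly b"] if_distrib[of "\<lambda>x. x * _"] mult.commute cong: if_cong)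
next
  case (add p q)
  then show ?case
    by (simp add: j_mpoly_add laurent_euler_add mderiv_add algebra_simps sum.distrib)
next
  case (mult p q)
  then show ?case
    by (simp add: j_mpoly_add j_mpoly_mult laurent_euler_flag_mult mderiv_mult algebra_simps
        sum.distrib sum_distrib_left)
qed

section \<open>The expansion of fractions with invertible denominators\<close>

definition regular :: "('s \<Rightarrow> complex ^ 's::{finite,linorder}) \<Rightarrow> 's ratfun \<Rightarrow> bool"
  where "regular b f \<longleftrightarrow> (\<exists>p q. f = Fract p q \<and> j_mpoly b q dvd 1)"

lemma j_mpoly_unit_nonzero: "j_mpoly b q dvd 1 \<Longrightarrow> q \<noteq> 0"
  by auto

text \<open>A unit denominator settles the definite description in \<open>j_map\<close>: the
  representation by \<open>p\<close> and \<open>q\<close> forces the value, and cross multiplication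
  shows that this value fits every other representation, whatever becomes of its
  denominator.\<close>

lemma j_map_Fract:
  assumes q: "j_mpoly b q dvd 1"
  shows "j_map b (Fract p q) * j_mpoly b q = j_mpoly b p"
proof -
  from q obtain w where w: "j_mpoly b q * w = 1" by (metis dvdE)
  have [simp]: "q \<noteq> 0" using q by (rule j_mpoly_unit_nonzero)
  define L where "L = j_mpoly b p * w"
  have L: "L * j_mpoly b q' = j_mpoly b p'" if "q' \<noteq> 0" "Fract p q = Fract p' q'" for p' q'
  proof -
    from that have "p * q' = p' * q" by (simp add: eq_fract)
    then have *: "j_mpoly b p * j_mpoly b q' = j_mpoly b p' * j_mpoly b q"
      by (simp flip: j_mpoly_mult)
    have "L * j_mpoly b q' = w * (j_mpoly b p * j_mpoly b q')"
      by (simp only: L_def ac_simps)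
    also have "\<dots> = j_mpoly b p' * (j_mpoly b q * w)"
      by (simp only: * ac_simps)
    finally show ?thesis by (simp only: w mult_1_right)
  qed
  have "j_map b (Fract p q) = L"
    unfolding j_map_def
  proof (rule the_equality)
    fix L' assume "\<forall>p' q'. q' \<noteq> 0 \<longrightarrow> Fract p q = Fract p' q' \<longrightarrow> L' * j_mpoly b q' = j_mpoly b p'"
    then have "L' * j_mpoly b q = j_mpoly b p" by simp
    then have "L = L' * (j_mpoly b q * w)" by (simp add: L_def mult.assoc[symmetric])
    then show "L' = L" by (simp only: w mult_1_right)
  qed (use L in blast)
  with L[of q p] show ?thesis by simp
qed

text \<open>\<open>laurent\<close> is an instance of \<open>comm_ring_1\<close> only, so equations
  between series are cancelled by units.\<close>

lemma unit_cancel: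
  fixes u :: "'a::comm_ring_1"
  assumes "u dvd 1" and eq: "f * u = g * u"
  shows "f = g"
proof -
  from assms(1) obtain w where w: "u * w = 1" by (metis dvdE)
  have "f * (u * w) = g * (u * w)" using eq by (simp only: mult.assoc[symmetric])
  then show ?thesis by (simp only: w mult_1_right)
qed

lemma j_map_FractI: "j_mpoly b q dvd 1 \<Longrightarrow> L * j_mpoly b q = j_mpoly b p \<Longrightarrow> j_map b (Fract p q) = L"
  by (metis j_map_Fract unit_cancel)

lemma regular_of_mpoly: "regular b (of_mpoly p)"
  and j_map_of_mpoly: "j_map b (of_mpoly p) = j_mpoly b p"
  by (auto simp: regular_def of_mpoly_def intro!: j_map_FractI) (metis dvd_refl j_mpoly_1)

lemma regular_add: "regular b f \<Longrightarrow> regular b g \<Longrightarrow> regular b (f + g)"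
  and j_map_add: "regular b f \<Longrightarrow> regular b g \<Longrightarrow> j_map b (f + g) = j_map b f + j_map b g"
proof -
  have "regular b (f + g) \<and> j_map b (f + g) = j_map b f + j_map b g" if "regular b f" "regular b g"
  proof -
    from that obtain p q p' q' where f: "f = Fract p q" "j_mpoly b q dvd 1"
      and g: "g = Fract p' q'" "j_mpoly b q' dvd 1"
      by (auto simp: regular_def)
    have nz: "q \<noteq> 0" "q' \<noteq> 0" using f g by (auto dest: j_mpoly_unit_nonzero)
    have u: "j_mpoly b (q * q') dvd 1"
      using mult_dvd_mono[OF f(2) g(2)] by (simp add: j_mpoly_mult)
    have fg: "f + g = Fract (p * q' + p' * q) (q * q')" using f g nz by simp
    have "(j_map b f + j_map b g) * j_mpoly b (q * q') =
        (j_map b f * j_mpoly b q) * j_mpoly b q' + (j_map b g * j_mpoly b q') * j_mpoly b q"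
      by (simp only: j_mpoly_mult distrib_right distrib_left ac_simps)
    also have "\<dots> = j_mpoly b (p * q' + p' * q)"
      using f g by (simp only: j_map_Fract j_mpoly_mult j_mpoly_add)
    finally have "j_map b (f + g) = j_map b f + j_map b g"
      unfolding fg by (intro j_map_FractI u)
    with fg u show ?thesis unfolding regular_def by blast
  qed
  then show "regular b f \<Longrightarrow> regular b g \<Longrightarrow> regular b (f + g)"
    and "regular b f \<Longrightarrow> regular b g \<Longrightarrow> j_map b (f + g) = j_map b f + j_map b g" by blast+
qed

lemma regular_mult: "regular b f \<Longrightarrow> regular b g \<Longrightarrow> regular b (f * g)"
  and j_map_mult: "regular b f \<Longrightarrow> regular b g \<Longrightarrow> j_map b (f * g) = j_map b f * j_map b g"
proof -
  have "regular b (f * g) \<and> j_map b (f * g) = j_map b f * j_map b g" if "regular b f" "regular b g"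
  proof -
    from that obtain p q p' q' where f: "f = Fract p q" "j_mpoly b q dvd 1"
      and g: "g = Fract p' q'" "j_mpoly b q' dvd 1"
      by (auto simp: regular_def)
    have u: "j_mpoly b (q * q') dvd 1"
      using mult_dvd_mono[OF f(2) g(2)] by (simp add: j_mpoly_mult)
    have fg: "f * g = Fract (p * p') (q * q')" using f g by simp
    have "j_map b f * j_map b g * j_mpoly b (q * q') =
        (j_map b f * j_mpoly b q) * (j_map b g * j_mpoly b q')"
      by (simp only: j_mpoly_mult ac_simps)
    also have "\<dots> = j_mpoly b (p * p')"
      using f g by (simp only: j_map_Fract j_mpoly_mult)
    finally have "j_map b (f * g) = j_map b f * j_map b g"
      unfolding fg by (intro j_map_FractI u)
    with fg u show ?thesis unfolding regular_def by blast
  qed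
  then show "regular b f \<Longrightarrow> regular b g \<Longrightarrow> regular b (f * g)"
    and "regular b f \<Longrightarrow> regular b g \<Longrightarrow> j_map b (f * g) = j_map b f * j_map b g" by blast+
qed

lemma regular_inverse_of_mpoly: "j_mpoly b q dvd 1 \<Longrightarrow> regular b (1 / of_mpoly q)"
  and j_map_inverse_of_mpoly: "j_mpoly b q dvd 1 \<Longrightarrow> j_map b (1 / of_mpoly q) * j_mpoly b q = 1"
proof -
  have "(1 / of_mpoly q) = Fract 1 q" by (simp add: Fract_eq_divide)
  then show "j_mpoly b q dvd 1 \<Longrightarrow> regular b (1 / of_mpoly q)"
    and "j_mpoly b q dvd 1 \<Longrightarrow> j_map b (1 / of_mpoly q) * j_mpoly b q = 1"
    by (auto simp: regular_def j_map_Fract)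
qed

lemma regular_rconst: "regular b (rconst c)"
  and j_map_rconst: "j_map b (rconst c) = laurent_const c"
  by (simp_all add: rconst_def regular_of_mpoly j_map_of_mpoly j_mpoly_mconst)

lemma regular_0: "regular b 0" and j_map_0 [simp]: "j_map b 0 = 0"
  using regular_of_mpoly[of b 0] j_map_of_mpoly[of b 0] by simp_all

lemma regular_1: "regular b 1" and j_map_1 [simp]: "j_map b 1 = 1"
  using regular_of_mpoly[of b 1] j_map_of_mpoly[of b 1] by simp_all

lemma regular_sum: "(\<And>a. a \<in> A \<Longrightarrow> regular b (f a)) \<Longrightarrow> regular b (\<Sum>a\<in>A. f a)"
  by (induction A rule: infinite_finite_induct) (auto simp: regular_0 intro: regular_add)

lemma j_map_sum:
  "(\<And>a. a \<in> A \<Longrightarrow> regular b (f a)) \<Longrightarrow> j_map b (\<Sum>a\<in>A. f a) = (\<Sum>a\<in>A. j_map b (f a))"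
  by (induction A rule: infinite_finite_induct) (auto simp: j_map_add regular_sum)

lemma regular_prod: "(\<And>a. a \<in> A \<Longrightarrow> regular b (f a)) \<Longrightarrow> regular b (\<Prod>a\<in>A. f a)"
  by (induction A rule: infinite_finite_induct) (auto simp: regular_1 intro: regular_mult)

lemma j_map_prod:
  "(\<And>a. a \<in> A \<Longrightarrow> regular b (f a)) \<Longrightarrow> j_map b (\<Prod>a\<in>A. f a) = (\<Prod>a\<in>A. j_map b (f a))"
  by (induction A rule: infinite_finite_induct) (auto simp: j_map_mult regular_prod)

lemma regular_power: "regular b f \<Longrightarrow> regular b (f ^ n)"
  by (induction n) (auto simp: regular_1 intro: regular_mult)

lemma regular_rderiv:
  assumes "regular b f" shows "regular b (rderiv i f)"
proof -
  from assms obtain p q where f: "f = Fract p q" "j_mpoly b q dvd 1"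
    by (auto simp: regular_def)
  then have "j_mpoly b (q * q) dvd 1"
    using mult_dvd_mono[OF f(2) f(2)] by (simp add: j_mpoly_mult)
  with f show ?thesis
    using j_mpoly_unit_nonzero[OF f(2)] by (auto simp: regular_def rderiv_Fract)
qed

lemma regular_dirderiv: "regular b f \<Longrightarrow> regular b (dirderiv v f)"
  unfolding dirderiv_def by (intro regular_sum regular_mult regular_rconst regular_rderiv)

text \<open>Both sides obey the Leibniz rule and agree on polynomials. Compare them on
  \<open>f * q = p\<close> and cancel the unit \<open>j_mpoly b q\<close>.\<close>

lemma laurent_euler_j_map:
  assumes "regular b f"
  shows "laurent_euler (flag_weight k) (j_map b f) =
    flag_monom k * j_map b (dirderiv (column k (matrix_inv (\<chi> k. b k))) f)"
proof -
  let ?v = "column k (matrix_inv (\<chi> k. b k))"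
  have poly: "laurent_euler (flag_weight k) (j_map b (of_mpoly p)) =
      flag_monom k * j_map b (dirderiv ?v (of_mpoly p))" for p
    by (simp add: dirderiv_def j_map_sum j_map_mult regular_mult regular_rconst regular_rderiv
        regular_of_mpoly rderiv_of_mpoly j_map_of_mpoly j_map_rconst laurent_euler_j_mpoly column_def)
  from assms obtain p q where f: "f = Fract p q" "j_mpoly b q dvd 1"
    by (auto simp: regular_def)
  then have fq: "f * of_mpoly q = of_mpoly p"
    using j_mpoly_unit_nonzero[OF f(2)] by (simp add: Fract_eq_divide)
  have "laurent_euler (flag_weight k) (j_map b f) * j_map b (of_mpoly q) +
      j_map b f * (flag_monom k * j_map b (dirderiv ?v (of_mpoly q))) =
      laurent_euler (flag_weight k) (j_map b f * j_map b (of_mpoly q))"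
    by (simp add: laurent_euler_flag_mult poly)
  also have "\<dots> = flag_monom k * j_map b (dirderiv ?v (f * of_mpoly q))"
    using assms by (simp add: fq poly regular_of_mpoly flip: j_map_mult)
  also have "\<dots> = flag_monom k * j_map b (dirderiv ?v f) * j_map b (of_mpoly q) +
      j_map b f * (flag_monom k * j_map b (dirderiv ?v (of_mpoly q)))"
    using assms by (simp add: dirderiv_mult j_map_add j_map_mult regular_mult regular_of_mpoly
        regular_dirderiv algebra_simps)
  finally show ?thesis
    unfolding add_right_cancel j_map_of_mpoly by (rule unit_cancel[OF f(2)])
qed

section \<open>Residues as Laurent coefficients\<close>

definition res_exp :: "int ^ 's::{finite,linorder}"
  where "res_exp = (\<Sum>k\<in>UNIV. flag_exp k)"

text \<open>The Jacobian is a constant times \<open>u^(res_exp - 1)\<close> by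
  \<open>jacobian_eq\<close>, so the residue is that constant times this coefficient
  (\<open>residue_at_eq\<close>).\<close>

definition res_coeff :: "('s \<Rightarrow> complex ^ 's::{finite,linorder}) \<Rightarrow> 's ratfun \<Rightarrow> complex"
  where "res_coeff b f = laurent_coeff (j_map b f) (- res_exp)"

lemma res_exp_nth: "res_exp $ l = int (card {l..})"
proof -
  have "res_exp $ l = (\<Sum>k\<in>UNIV. if k \<in> {l..} then 1 else 0)"
    by (simp add: res_exp_def flag_exp_def)
  also have "\<dots> = int (card {l..})"
    by (simp add: sum.If_cases atLeast_def)
  finally show ?thesis .
qed

lemma flag_weight_res_exp: "flag_weight k res_exp = 1"
  by (simp add: res_exp_def flag_weight_sum flag_weight_flag_exp)

lemma res_coeff_add: "regular b f \<Longrightarrow> regular b g \<Longrightarrow> res_coeff b (f + g) = res_coeff b f + res_coeff b g"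
  by (simp add: res_coeff_def j_map_add)

lemma res_coeff_0: "res_coeff b 0 = 0"
  by (simp add: res_coeff_def)

lemma res_coeff_rconst_mult: "regular b f \<Longrightarrow> res_coeff b (rconst c * f) = c * res_coeff b f"
  by (simp add: res_coeff_def j_map_mult regular_rconst j_map_rconst laurent_coeff_const_mult)

lemma res_coeff_sum:
  "(\<And>a. a \<in> A \<Longrightarrow> regular b (f a)) \<Longrightarrow> res_coeff b (\<Sum>a\<in>A. f a) = (\<Sum>a\<in>A. res_coeff b (f a))"
  by (simp add: res_coeff_def j_map_sum laurent_coeff_sum)

text \<open>Multiplying by \<open>b_k\<close> moves the coefficient to the exponent
  \<open>flag_exp k - res_exp\<close> and turns the derivative into the Euler operator, which scales
  that coefficient by its weight \<open>1 - 1 = 0\<close>.\<close>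

lemma res_coeff_dirderiv_basis:
  assumes "regular b f"
  shows "res_coeff b (dirderiv (column k (matrix_inv (\<chi> k. b k))) f) = 0"
proof -
  let ?g = "j_map b (dirderiv (column k (matrix_inv (\<chi> k. b k))) f)"
  have "res_coeff b (dirderiv (column k (matrix_inv (\<chi> k. b k))) f) =
      laurent_coeff (flag_monom k * ?g) (flag_exp k - res_exp)"
    by (simp add: res_coeff_def laurent_coeff_monom_mult)
  also have "\<dots> = of_int (flag_weight k (flag_exp k - res_exp)) *
      laurent_coeff (j_map b f) (flag_exp k - res_exp)"
    using assms by (simp add: laurent_euler.rep_eq flip: laurent_euler_j_map)
  also have "flag_weight k (flag_exp k - res_exp) = 0"
    using flag_weight_add[of k "flag_exp k" "- res_exp"]
    by (simp add: flag_weight_uminus flag_weight_res_exp flag_weight_flag_exp)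
  finally show ?thesis by simp
qed

lemma matrix_inv_right_left:
  fixes B :: "complex ^ 's ^ 's"
  assumes "invertible B"
  shows "B ** matrix_inv B = mat 1" "matrix_inv B ** B = mat 1"
  using assms unfolding invertible_def matrix_inv_def by (metis (mono_tags, lifting) someI_ex)+

lemma res_coeff_rderiv:
  assumes f: "regular b f" and b: "invertible (\<chi> k. b k)"
  shows "res_coeff b (rderiv i f) = 0"
proof -
  let ?B = "\<chi> k. b k"
  \<comment> \<open>The derivative by \<open>x_i\<close> is a combination of the derivatives dual to
    the basis; its coefficients are the i-th entries of the members of \<open>b\<close>.\<close>
  have "(\<Sum>k\<in>UNIV. rconst (?B $ k $ i) * dirderiv (column k (matrix_inv ?B)) f) =
     (\<Sum>k\<in>UNIV. \<Sum>m\<in>UNIV. rconst (matrix_inv ?B $ m $ k * ?B $ k $ i) * rderiv m f)"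
    by (simp add: dirderiv_def column_def sum_distrib_left rconst.hom_mult mult.left_commute mult.commute)
  also have "\<dots> = (\<Sum>m\<in>UNIV. \<Sum>k\<in>UNIV. rconst (matrix_inv ?B $ m $ k * ?B $ k $ i) * rderiv m f)"
    by (rule sum.swap)
  also have "\<dots> = (\<Sum>m\<in>UNIV. rconst ((matrix_inv ?B ** ?B) $ m $ i) * rderiv m f)"
    by (simp add: matrix_matrix_mult_def rconst.hom_sum sum_distrib_right)
  also have "\<dots> = rderiv i f"
    using matrix_inv_right_left(2)[OF b]
    by (simp add: mat_def if_distrib[of rconst] rconst.hom_0 rconst.hom_1 if_distrib[of "\<lambda>x. x * _"]
        cong: if_cong)
  finally have "res_coeff b (rderiv i f) =
      res_coeff b (\<Sum>k\<in>UNIV. rconst (?B $ k $ i) * dirderiv (column k (matrix_inv ?B)) f)" by simp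
  also have "\<dots> = 0"
    using f by (simp add: res_coeff_sum res_coeff_rconst_mult res_coeff_dirderiv_basis
        regular_dirderiv regular_mult regular_rconst)
  finally show ?thesis .
qed

lemma res_coeff_dirderiv:
  assumes "regular b f" "invertible (\<chi> k. b k)"
  shows "res_coeff b (dirderiv v f) = 0"
  using assms unfolding dirderiv_def
  by (simp add: res_coeff_sum res_coeff_rconst_mult res_coeff_rderiv regular_rderiv regular_mult
      regular_rconst)

text \<open>The library's \<open>det_lowerdiagonal\<close> asks for an index type of class \<open>wellorder\<close>.\<close>

lemma permutation_le_imp_id:
  fixes p :: "'s::{finite,linorder} \<Rightarrow> 's"
  assumes p: "p permutes UNIV" and le: "\<And>i. p i \<le> i"
  shows "p = id"
proof
  fix i
  show "p i = id i"
  proof (induction "card {..<i}" arbitrary: i rule: less_induct)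
    case less
    \<comment> \<open>Points below \<open>i\<close> are fixed already, so a value
      \<open>p i < i\<close> would be taken twice.\<close>
    have fixed: "p j = j" if "j < i" for j
    proof -
      have "{..<j} \<subset> {..<i}" using that by auto
      then show ?thesis using less by (simp add: psubset_card_mono)
    qed
    show ?case
    proof (rule ccontr)
      assume "p i \<noteq> id i"
      with le[of i] have "p i < i" by simp
      then have "p (p i) = p i" by (rule fixed)
      with permutes_inj[OF p] \<open>p i \<noteq> id i\<close> show False by (auto dest: injD)
    qed
  qed
qed

lemma det_lower_triangular:
  fixes A :: "'a::comm_ring_1 ^ 's::{finite,linorder} ^ 's::{finite,linorder}"
  assumes "\<And>i j. i < j \<Longrightarrow> A $ i $ j = 0"
  shows "det A = (\<Prod>i\<in>UNIV. A $ i $ i)"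
proof -
  have "(\<Prod>i\<in>UNIV. A $ i $ p i) = 0" if p: "p permutes UNIV" "p \<noteq> id" for p
  proof -
    obtain i where "i < p i" using permutation_le_imp_id[OF p(1)] p(2) by (meson not_le)
    then show ?thesis using assms by (intro prod_zero) auto
  qed
  then have "det A = (\<Sum>p\<in>{id}. of_int (sign p) * (\<Prod>i\<in>UNIV. A $ i $ p i))"
    unfolding det_def by (intro sum.mono_neutral_right) (auto simp: permutes_id)
  then show ?thesis by simp
qed

text \<open>Change of variables in two stages. From \<open>x\<close> to \<open>b\<close> the matrix
  is constant. From \<open>b\<close> to \<open>u\<close> it is lower triangular, since
  \<open>u_t\<close> does not occur in \<open>b_k\<close> for \<open>t > k\<close>, with diagonal
  entries \<open>u_1 ... u_(k-1)\<close>, whose product has exponent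
  \<open>res_exp - 1\<close>.\<close>

lemma jacobian_eq:
  "jacobian b = laurent_const (det (matrix_inv (\<chi> k. b k))) * laurent_monom (res_exp - 1) 1"
proof -
  let ?I = "matrix_inv (\<chi> k. b k)"
  let ?C = "(\<chi> i k. laurent_const (?I $ i $ k)) :: 'a laurent ^ 'a::{finite,linorder} ^ 'a::{finite,linorder}"
  let ?T = "(\<chi> k t. laurent_deriv t (flag_monom k)) :: 'a laurent ^ 'a::{finite,linorder} ^ 'a::{finite,linorder}"
  have "(\<chi> i t. laurent_deriv t (x_image b i)) = ?C ** ?T"
    by (simp add: vec_eq_iff matrix_matrix_mult_def x_image_eq laurent_deriv_sum
        laurent_deriv_const_mult)
  then have "jacobian b = det ?C * det ?T"
    by (simp add: jacobian_def det_mul)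
  also have "det ?C = laurent_const (det ?I)"
    by (simp add: det_def laurent_const.hom_sum laurent_const.hom_mult laurent_const.hom_prod
        laurent_const.hom_of_int)
  also have "det ?T = (\<Prod>k\<in>UNIV. ?T $ k $ k)"
    by (rule det_lower_triangular)
      (simp add: laurent_deriv_monom flag_exp_def laurent_eqI laurent_monom.rep_eq)
  also have "\<dots> = (\<Prod>k\<in>UNIV. laurent_monom (flag_exp k - axis k 1) 1)"
    by (simp add: laurent_deriv_monom flag_exp_def)
  also have "\<dots> = laurent_monom (res_exp - 1) 1"
  proof -
    have "(\<Sum>k\<in>UNIV. axis k (1::int)) = (1 :: int ^ 'a::{finite,linorder})"
      by (simp add: vec_eq_iff axis_def)
    then show ?thesis by (simp add: laurent_monom_prod sum_subtractf res_exp_def)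
  qed
  finally show ?thesis .
qed

lemma residue_at_eq: "residue_at b f = det (matrix_inv (\<chi> k. b k)) * res_coeff b f"
proof -
  have [simp]: "(\<chi> i. - 1) - (res_exp - 1) = - (res_exp :: int ^ 'a::{finite,linorder})"
    by (simp add: vec_eq_iff)
  have "j_map b f * jacobian b =
      laurent_const (det (matrix_inv (\<chi> k. b k))) * (laurent_monom (res_exp - 1) 1 * j_map b f)"
    by (simp add: jacobian_eq ac_simps)
  then show ?thesis
    by (simp add: residue_at_def res_coeff_def laurent_coeff_const_mult laurent_coeff_monom_mult)
qed

section \<open>Leading monomials of linear forms\<close>

lemma basis_expansion_coord:
  fixes b :: "'s::{finite,linorder} \<Rightarrow> complex ^ 's::{finite,linorder}"
  assumes "invertible (\<chi> k. b k)"
  shows "a = (\<Sum>k\<in>UNIV. basis_coord b a k *s b k)"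
proof -
  let ?B = "\<chi> k. b k"
  have "a = a v* (matrix_inv ?B ** ?B)"
    using matrix_inv_right_left(2)[OF assms] by (simp add: vector_matrix_mul_rid)
  also have "\<dots> = (a v* matrix_inv ?B) v* ?B"
    by (simp add: vector_matrix_mul_assoc)
  also have "\<dots> = (\<Sum>k\<in>UNIV. basis_coord b a k *s b k)"
    by (simp add: vec_eq_iff vector_matrix_mult_def basis_coord_def mult.commute)
  finally show ?thesis .
qed

definition lead_index :: "('s \<Rightarrow> complex ^ 's::{finite,linorder}) \<Rightarrow> complex ^ 's::{finite,linorder} \<Rightarrow> 's"
  where "lead_index b a = Min {k. basis_coord b a k \<noteq> 0}"

lemma lead_index:
  assumes "invertible (\<chi> k. b k)" "a \<noteq> 0"
  shows "basis_coord b a (lead_index b a) \<noteq> 0"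
    and "k < lead_index b a \<Longrightarrow> basis_coord b a k = 0"
proof -
  have ne: "{k. basis_coord b a k \<noteq> 0} \<noteq> {}"
  proof
    assume "{k. basis_coord b a k \<noteq> 0} = {}"
    then have "a = 0" using basis_expansion_coord[OF assms(1), of a] by simp
    with assms(2) show False ..
  qed
  then show "basis_coord b a (lead_index b a) \<noteq> 0"
    using Min_in[OF _ ne] by (simp add: lead_index_def)
  show "basis_coord b a k = 0" if "k < lead_index b a"
  proof (rule ccontr)
    assume "basis_coord b a k \<noteq> 0"
    then have "lead_index b a \<le> k" unfolding lead_index_def by (intro Min_le) auto
    with that show False by simp
  qed
qed

lemma in_span_lead_index:
  assumes "invertible (\<chi> k. b k)" "a \<noteq> 0" "l \<le> lead_index b a"
  shows "a \<in> vec.span (b ` {l..})"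
proof -
  have "a = (\<Sum>k\<in>UNIV. basis_coord b a k *s b k)"
    by (rule basis_expansion_coord) fact
  also have "\<dots> = (\<Sum>k\<in>{l..}. basis_coord b a k *s b k)"
    using lead_index(2)[OF assms(1,2)] assms(3)
    by (intro sum.mono_neutral_right) (auto simp: not_le)
  also have "\<dots> \<in> vec.span (b ` {l..})"
    by (intro vec.span_sum vec.span_scale vec.span_base) auto
  finally show ?thesis .
qed

text \<open>Pull out the leading term: the image is \<open>c_m b_m (1 - g)\<close>, where the
  quotients \<open>b_k / b_m = u_(m+1) ... u_k\<close> for \<open>k > m\<close> make
  \<open>g\<close> a power series without constant term. So the inverse is
  \<open>1 / (c_m b_m)\<close> times a power series, with at most a simple pole in
  \<open>u_t\<close> for \<open>t \<le> m\<close> and none after.\<close>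

lemma j_mpoly_linform_inverse:
  assumes "invertible (\<chi> k. b k)" "a \<noteq> 0"
  obtains h where "j_mpoly b (linform a) * h = 1"
    and "\<And>t. ord_ge t (if t \<le> lead_index b a then -1 else 0) h"
proof -
  let ?m = "lead_index b a" and ?c = "basis_coord b a"
  define e where "e k = flag_exp k - flag_exp ?m" for k
  define g where "g = (\<Sum>k\<in>{?m<..}. laurent_const (- ?c k / ?c ?m) * laurent_monom (e k) 1)"
  have c: "?c ?m \<noteq> 0" by (rule lead_index(1)) fact+
  have factor: "j_mpoly b (linform a) = laurent_const (?c ?m) * flag_monom ?m * (1 - g)"
  proof -
    have "laurent_const (?c ?m) * flag_monom ?m * g =
        (\<Sum>k\<in>{?m<..}. laurent_const (- ?c k) * flag_monom k)"
      unfolding g_def sum_distrib_left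
    proof (rule sum.cong)
      fix k
      have "laurent_const (?c ?m) * flag_monom ?m * (laurent_const (- ?c k / ?c ?m) * laurent_monom (e k) 1) =
          (laurent_const (?c ?m) * laurent_const (- ?c k / ?c ?m)) * (flag_monom ?m * laurent_monom (e k) 1)"
        by (simp only: ac_simps)
      also have "\<dots> = laurent_const (- ?c k) * flag_monom k"
        using c by (simp add: laurent_monom_mult e_def flip: laurent_const.hom_mult)
      finally show "laurent_const (?c ?m) * flag_monom ?m *
          (laurent_const (- ?c k / ?c ?m) * laurent_monom (e k) 1) = laurent_const (- ?c k) * flag_monom k" .
    qed simp
    moreover have "j_mpoly b (linform a) = (\<Sum>k\<in>{?m..}. laurent_const (?c k) * flag_monom k)"
      unfolding j_mpoly_linform using lead_index(2)[OF assms]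
      by (intro sum.mono_neutral_right) (auto simp: not_le laurent_const.hom_0)
    moreover have "{?m..} = insert ?m {?m<..}" by auto
    ultimately show ?thesis
      by (simp add: right_diff_distrib laurent_const.hom_uminus sum_negf)
  qed
  have nonneg: "0 \<le> e k $ t" if "?m < k" for k t
    using that by (auto simp: e_def flag_exp_def)
  have "ord_ge t 0 g" for t
    unfolding g_def by (intro ord_ge_sum ord_ge_const_mult ord_ge_monom) (simp add: nonneg)
  moreover have "laurent_coeff g 0 = 0"
  proof -
    have "e k \<noteq> 0" if "?m < k" for k
      using that by (auto simp: vec_eq_iff e_def flag_exp_def not_le intro!: exI[of _ k])
    then show ?thesis
      by (auto simp: g_def laurent_coeff_sum laurent_coeff_const_mult laurent_monom.rep_eq intro!: sum.neutral)
  qed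
  ultimately obtain h where h: "(1 - g) * h = 1" "\<And>t. ord_ge t 0 h"
    by (rule power_series_inverse) auto
  let ?i = "laurent_const (1 / ?c ?m) * laurent_monom (- flag_exp ?m) 1"
  have "laurent_const (?c ?m) * laurent_const (1 / ?c ?m) = 1"
    using c by (simp add: laurent_const.hom_1 flip: laurent_const.hom_mult)
  moreover have "flag_monom ?m * laurent_monom (- flag_exp ?m) 1 = 1"
    by (simp add: laurent_monom_mult laurent_monom_0_1)
  moreover have "j_mpoly b (linform a) * (?i * h) =
      (laurent_const (?c ?m) * laurent_const (1 / ?c ?m)) *
      (flag_monom ?m * laurent_monom (- flag_exp ?m) 1) * ((1 - g) * h)"
    by (simp only: factor ac_simps)
  ultimately have "j_mpoly b (linform a) * (?i * h) = 1"
    by (simp only: h mult_1_right)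
  moreover have "ord_ge t (if t \<le> ?m then -1 else 0) (?i * h)" for t
  proof -
    have "ord_ge t ((if t \<le> ?m then -1 else 0) + 0) (?i * h)"
      by (intro ord_ge_mult ord_ge_const_mult ord_ge_monom h) (simp add: flag_exp_def)
    then show ?thesis by simp
  qed
  ultimately show ?thesis by (rule that)
qed

lemma j_mpoly_linform_unit:
  "invertible (\<chi> k. b k) \<Longrightarrow> a \<noteq> 0 \<Longrightarrow> j_mpoly b (linform a) dvd 1"
  by (metis dvdI j_mpoly_linform_inverse)

lemma ord_ge_j_map_inverse_linform:
  assumes "invertible (\<chi> k. b k)" "a \<noteq> 0"
  shows "ord_ge t (if t \<le> lead_index b a then -1 else 0) (j_map b (1 / of_mpoly (linform a)))"
proof -
  obtain h where h: "j_mpoly b (linform a) * h = 1"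
    "ord_ge t (if t \<le> lead_index b a then -1 else 0) h"
    using j_mpoly_linform_inverse[OF assms] by blast
  have u: "j_mpoly b (linform a) dvd 1" by (rule j_mpoly_linform_unit) fact+
  have "j_map b (1 / of_mpoly (linform a)) = h"
    by (rule unit_cancel[OF u])
      (simp add: j_map_inverse_of_mpoly[OF u], metis h(1) mult.commute)
  with h show ?thesis by simp
qed

lemma regular_inverse_linform:
  "invertible (\<chi> k. b k) \<Longrightarrow> a \<noteq> 0 \<Longrightarrow> regular b (1 / of_mpoly (linform a))"
  by (intro regular_inverse_of_mpoly j_mpoly_linform_unit)

section \<open>The exponential pairing\<close>

text \<open>The divided power \<open>x^\<alpha> / \<alpha>!\<close>, the closed form of the
  coefficients of the exponential (\<open>exp_pairing_coeff_eq\<close>). With this normalisation the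
  derivative by \<open>x_i\<close> merely lowers \<open>\<alpha>\<close>.\<close>

definition exp_monom :: "('s::{finite,linorder} \<Rightarrow>\<^sub>0 nat) \<Rightarrow> 's ratfun"
  where "exp_monom \<alpha> =
    rconst (1 / (\<Prod>i\<in>UNIV. fact (Poly_Mapping.lookup \<alpha> i))) * of_mpoly (Poly_Mapping.single \<alpha> 1)"

lemma exp_monom_0: "exp_monom 0 = 1"
  by (simp add: exp_monom_def rconst.hom_1)

lemma regular_exp_monom: "regular b (exp_monom \<alpha>)"
  unfolding exp_monom_def by (intro regular_mult regular_rconst regular_of_mpoly)

lemma exponent_minus_add:
  "Poly_Mapping.lookup \<alpha> i \<noteq> 0 \<Longrightarrow>
    Poly_Mapping.single i 1 + (\<alpha> - Poly_Mapping.single i (1::nat)) = \<alpha>"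
  by (rule poly_mapping_eqI) (auto simp: lookup_add lookup_minus lookup_single when_def)

lemma prod_fact_exponent:
  fixes \<alpha> :: "'s::finite \<Rightarrow>\<^sub>0 nat"
  assumes "Poly_Mapping.lookup \<alpha> i \<noteq> 0"
  shows "(\<Prod>k\<in>UNIV. fact (Poly_Mapping.lookup \<alpha> k) :: complex) =
    of_nat (Poly_Mapping.lookup \<alpha> i) *
    (\<Prod>k\<in>UNIV. fact (Poly_Mapping.lookup (\<alpha> - Poly_Mapping.single i 1) k))"
proof -
  have "(\<Prod>k\<in>UNIV - {i}. fact (Poly_Mapping.lookup (\<alpha> - Poly_Mapping.single i 1) k) :: complex) =
      (\<Prod>k\<in>UNIV - {i}. fact (Poly_Mapping.lookup \<alpha> k))"
    by (intro prod.cong) (auto simp: lookup_minus lookup_single)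
  moreover have "(fact (Poly_Mapping.lookup \<alpha> i) :: complex) =
      of_nat (Poly_Mapping.lookup \<alpha> i) * fact (Poly_Mapping.lookup (\<alpha> - Poly_Mapping.single i 1) i)"
    using assms by (simp add: lookup_minus fact_reduce[of "Poly_Mapping.lookup \<alpha> i"])
  ultimately show ?thesis
    by (simp only: prod.remove[of UNIV i] finite UNIV_I mult.assoc)
qed

lemma mvar_mult_exp_monom:
  fixes \<alpha> :: "'s::{finite,linorder} \<Rightarrow>\<^sub>0 nat"
  assumes "Poly_Mapping.lookup \<alpha> i \<noteq> 0"
  shows "of_mpoly (mvar i) * exp_monom (\<alpha> - Poly_Mapping.single i 1) =
    rconst (of_nat (Poly_Mapping.lookup \<alpha> i)) * exp_monom \<alpha>"
proof -
  let ?P = "\<Prod>k\<in>UNIV. fact (Poly_Mapping.lookup (\<alpha> - Poly_Mapping.single i 1) k) :: complex"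
  have "mvar i * Poly_Mapping.single (\<alpha> - Poly_Mapping.single i 1) 1 = Poly_Mapping.single \<alpha> 1"
    unfolding mvar_def mult_single exponent_minus_add[OF assms] by simp
  then have "of_mpoly (mvar i) * of_mpoly (Poly_Mapping.single (\<alpha> - Poly_Mapping.single i 1) 1) =
      of_mpoly (Poly_Mapping.single \<alpha> 1)"
    by (simp only: of_mpoly_mult[symmetric])
  moreover have "(rconst (1 / ?P) :: 's ratfun) = rconst (of_nat (Poly_Mapping.lookup \<alpha> i)) *
      rconst (1 / (\<Prod>k\<in>UNIV. fact (Poly_Mapping.lookup \<alpha> k)))"
    unfolding rconst.hom_mult[symmetric] prod_fact_exponent[OF assms] using assms by simp
  moreover have "of_mpoly (mvar i) * exp_monom (\<alpha> - Poly_Mapping.single i 1) =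
      rconst (1 / ?P) * (of_mpoly (mvar i) * of_mpoly (Poly_Mapping.single (\<alpha> - Poly_Mapping.single i 1) 1))"
    by (simp only: exp_monom_def ac_simps)
  ultimately show ?thesis
    by (simp only: exp_monom_def mult.assoc)
qed

lemma rderiv_exp_monom:
  "rderiv i (exp_monom \<alpha>) =
    (if Poly_Mapping.lookup \<alpha> i = 0 then 0 else exp_monom (\<alpha> - Poly_Mapping.single i 1))"
proof (cases "Poly_Mapping.lookup \<alpha> i = 0")
  case True
  then show ?thesis
    by (simp add: exp_monom_def rderiv_rconst_mult rderiv_of_mpoly mderiv_single)
next
  case False
  let ?n = "of_nat (Poly_Mapping.lookup \<alpha> i) :: complex"
  have "rderiv i (exp_monom \<alpha>) =
      rconst (1 / (\<Prod>i\<in>UNIV. fact (Poly_Mapping.lookup \<alpha> i))) *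
      of_mpoly (Poly_Mapping.single (\<alpha> - Poly_Mapping.single i 1) ?n)"
    by (simp add: exp_monom_def rderiv_rconst_mult rderiv_of_mpoly mderiv_single del: One_nat_def)
  also have "\<dots> = rconst (1 / (\<Prod>i\<in>UNIV. fact (Poly_Mapping.lookup \<alpha> i)) * ?n) *
      of_mpoly (Poly_Mapping.single (\<alpha> - Poly_Mapping.single i 1) 1)"
    by (simp only: of_mpoly_single[of _ ?n] rconst.hom_mult mult.assoc)
  finally have "rderiv i (exp_monom \<alpha>) =
      rconst (1 / (\<Prod>i\<in>UNIV. fact (Poly_Mapping.lookup \<alpha> i)) * ?n) *
      of_mpoly (Poly_Mapping.single (\<alpha> - Poly_Mapping.single i 1) 1)" .
  with False show ?thesis
    unfolding prod_fact_exponent[OF False] by (simp add: exp_monom_def)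
qed

lemma lookup_single_mult:
  fixes q :: "('s \<Rightarrow>\<^sub>0 nat) \<Rightarrow>\<^sub>0 'b::comm_semiring_1"
  shows "Poly_Mapping.lookup (Poly_Mapping.single (Poly_Mapping.single i 1) c * q) \<alpha> =
    (if Poly_Mapping.lookup \<alpha> i = 0 then 0
     else c * Poly_Mapping.lookup q (\<alpha> - Poly_Mapping.single i 1))"
proof -
  let ?e = "Poly_Mapping.single i (1::nat)"
  have "Poly_Mapping.lookup (Poly_Mapping.single ?e c * q) \<alpha> =
      c * Sum_any (\<lambda>k. Poly_Mapping.lookup q k when \<alpha> = ?e + k)"
    by (simp add: lookup_mult lookup_single when_mult)
  also have "Sum_any (\<lambda>k. Poly_Mapping.lookup q k when \<alpha> = ?e + k) =
      (if Poly_Mapping.lookup \<alpha> i = 0 then 0 else Poly_Mapping.lookup q (\<alpha> - ?e))"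
  proof (cases "Poly_Mapping.lookup \<alpha> i = 0")
    case True
    then have "\<alpha> \<noteq> ?e + k" for k
      by (auto simp: lookup_add)
    with True show ?thesis by simp
  next
    case False
    then have "\<alpha> = ?e + k \<longleftrightarrow> k = \<alpha> - ?e" for k
      using exponent_minus_add[of \<alpha> i] by (metis add_diff_cancel_left')
    with False show ?thesis by simp
  qed
  finally show ?thesis by simp
qed

lemma sum_lookup_minus_single:
  fixes \<alpha> :: "'s::finite \<Rightarrow>\<^sub>0 nat"
  assumes "Poly_Mapping.lookup \<alpha> i \<noteq> 0"
  shows "(\<Sum>k\<in>UNIV. Poly_Mapping.lookup \<alpha> k) =
    Suc (\<Sum>k\<in>UNIV. Poly_Mapping.lookup (\<alpha> - Poly_Mapping.single i 1) k)"
proof -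
  have "(\<Sum>k\<in>UNIV. Poly_Mapping.lookup (Poly_Mapping.single i 1 + (\<alpha> - Poly_Mapping.single i (1::nat))) k) =
      Suc (\<Sum>k\<in>UNIV. Poly_Mapping.lookup (\<alpha> - Poly_Mapping.single i 1) k)"
    by (simp add: lookup_add sum.distrib lookup_single when_def del: One_nat_def)
  then show ?thesis unfolding exponent_minus_add[OF assms] .
qed

text \<open>The multinomial theorem. In the induction \<open>x_i\<close> times the divided power of
  \<open>\<alpha> - e_i\<close> is \<open>\<alpha>_i\<close> times that of \<open>\<alpha>\<close>,
  and the \<open>\<alpha>_i\<close> sum to \<open>n + 1\<close>, which completes \<open>n!\<close>
  to \<open>(n + 1)!\<close>.\<close>

lemma lookup_pairing_power:
  "Poly_Mapping.lookup (pairing ^ n) \<alpha> =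
    (if (\<Sum>i\<in>UNIV. Poly_Mapping.lookup \<alpha> i) = n then rconst (fact n) * exp_monom \<alpha> else 0)"
proof (induction n arbitrary: \<alpha>)
  case 0
  have "(\<Sum>i\<in>UNIV. Poly_Mapping.lookup \<alpha> i) = 0 \<longleftrightarrow> \<alpha> = 0"
    by (auto intro: poly_mapping_eqI)
  then show ?case
    by (simp add: lookup_one exp_monom_0 rconst.hom_1)
next
  case (Suc n)
  let ?s = "\<lambda>\<alpha>. \<Sum>i\<in>UNIV. Poly_Mapping.lookup \<alpha> i"
  have "Poly_Mapping.lookup (pairing ^ Suc n) \<alpha> = (\<Sum>i\<in>UNIV. if Poly_Mapping.lookup \<alpha> i = 0 then 0
      else of_mpoly (mvar i) * Poly_Mapping.lookup (pairing ^ n) (\<alpha> - Poly_Mapping.single i 1))"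
    unfolding power_Suc
    by (subst (1) pairing_def) (simp only: sum_distrib_right lookup_sum lookup_single_mult)
  also have "\<dots> = (\<Sum>i\<in>UNIV. if ?s \<alpha> = Suc n
      then rconst (fact n * of_nat (Poly_Mapping.lookup \<alpha> i)) * exp_monom \<alpha> else 0)"
  proof (rule sum.cong)
    fix i
    show "(if Poly_Mapping.lookup \<alpha> i = 0 then 0
        else of_mpoly (mvar i) * Poly_Mapping.lookup (pairing ^ n) (\<alpha> - Poly_Mapping.single i 1)) =
      (if ?s \<alpha> = Suc n then rconst (fact n * of_nat (Poly_Mapping.lookup \<alpha> i)) * exp_monom \<alpha> else 0)"
    proof (cases "Poly_Mapping.lookup \<alpha> i = 0")
      case False
      have "of_mpoly (mvar i) * (rconst (fact n) * exp_monom (\<alpha> - Poly_Mapping.single i 1)) =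
          rconst (fact n) * (of_mpoly (mvar i) * exp_monom (\<alpha> - Poly_Mapping.single i 1))"
        by (simp only: ac_simps)
      also have "\<dots> = rconst (fact n * of_nat (Poly_Mapping.lookup \<alpha> i)) * exp_monom \<alpha>"
        unfolding mvar_mult_exp_monom[OF False] rconst.hom_mult by (simp only: mult.assoc)
      finally have "of_mpoly (mvar i) * (rconst (fact n) * exp_monom (\<alpha> - Poly_Mapping.single i 1)) =
          rconst (fact n * of_nat (Poly_Mapping.lookup \<alpha> i)) * exp_monom \<alpha>" .
      with False show ?thesis
        by (simp only: Suc.IH sum_lookup_minus_single[OF False] nat.inject if_False mult_zero_right split: if_split) simp
    qed (simp add: rconst.hom_0)
  qed simp
  also have "\<dots> = (if ?s \<alpha> = Suc n then rconst (fact n * of_nat (?s \<alpha>)) * exp_monom \<alpha> else 0)"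
  proof -
    have "rconst (fact n * of_nat (?s \<alpha>)) * exp_monom \<alpha> =
        (\<Sum>i\<in>UNIV. rconst (fact n * of_nat (Poly_Mapping.lookup \<alpha> i)) * exp_monom \<alpha>)"
      by (simp only: of_nat_sum sum_distrib_left rconst.hom_sum sum_distrib_right)
    then show ?thesis by (cases "?s \<alpha> = Suc n") simp_all
  qed
  also have "\<dots> = (if ?s \<alpha> = Suc n then rconst (fact (Suc n)) * exp_monom \<alpha> else 0)"
    by (simp add: mult.commute)
  finally show ?case .
qed

lemma exp_pairing_coeff_eq: "exp_pairing_coeff \<alpha> = exp_monom \<alpha>"
proof -
  let ?s = "\<Sum>i\<in>UNIV. Poly_Mapping.lookup \<alpha> i"
  have "rscale (1 / fact n) (Poly_Mapping.lookup (pairing ^ n) \<alpha>) = (exp_monom \<alpha> when n = ?s)" for n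
    by (simp add: lookup_pairing_power rscale_eq rconst.hom_1 when_def
        flip: mult.assoc rconst.hom_mult)
  then show ?thesis by (simp add: exp_pairing_coeff_def)
qed

section \<open>The residue functional\<close>

text \<open>Up to the determinant of the inverse matrix of \<open>b\<close>, the coefficient of
  \<open>y^\<alpha>\<close> in the residue of \<open>f\<close> times the exponential.\<close>

definition exp_res :: "('s \<Rightarrow> complex ^ 's::{finite,linorder}) \<Rightarrow> 's ratfun \<Rightarrow> ('s \<Rightarrow>\<^sub>0 nat) \<Rightarrow> complex"
  where "exp_res b f \<alpha> = res_coeff b (exp_monom \<alpha> * f)"

lemma exp_res_add: "regular b f \<Longrightarrow> regular b g \<Longrightarrow> exp_res b (f + g) \<alpha> = exp_res b f \<alpha> + exp_res b g \<alpha>"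
  by (simp add: exp_res_def distrib_left res_coeff_add regular_mult regular_exp_monom)

lemma exp_res_0: "exp_res b 0 \<alpha> = 0"
  by (simp add: exp_res_def res_coeff_0)

lemma exp_res_rconst_mult:
  assumes "regular b f"
  shows "exp_res b (rconst c * f) \<alpha> = c * exp_res b f \<alpha>"
proof -
  have *: "exp_monom \<alpha> * (rconst c * f) = rconst c * (exp_monom \<alpha> * f)"
    by (simp only: ac_simps)
  show ?thesis
    unfolding exp_res_def * using assms by (simp add: res_coeff_rconst_mult regular_mult regular_exp_monom)
qed

lemma exp_res_sum:
  "(\<And>a. a \<in> A \<Longrightarrow> regular b (f a)) \<Longrightarrow> exp_res b (\<Sum>a\<in>A. f a) \<alpha> = (\<Sum>a\<in>A. exp_res b (f a) \<alpha>)"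
  by (induction A rule: infinite_finite_induct) (auto simp: exp_res_0 exp_res_add regular_sum)

text \<open>Integration by parts: the derivative of \<open>exp_monom \<alpha> * f\<close> has
  residue zero. On generating series in \<open>y\<close> this is multiplication by
  \<open>-y_i\<close>.\<close>

lemma exp_res_rderiv:
  assumes "regular b f" "invertible (\<chi> k. b k)"
  shows "exp_res b (rderiv i f) \<alpha> = (if Poly_Mapping.lookup \<alpha> i = 0 then 0
    else - exp_res b f (\<alpha> - Poly_Mapping.single i 1))"
proof -
  have "0 = res_coeff b (rderiv i (exp_monom \<alpha> * f))"
    using assms by (simp add: res_coeff_rderiv regular_mult regular_exp_monom)
  also have "\<dots> = res_coeff b (rderiv i (exp_monom \<alpha>) * f) + exp_res b (rderiv i f) \<alpha>"
    using assms by (simp add: rderiv_mult res_coeff_add regular_mult regular_exp_monom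
        regular_rderiv exp_res_def)
  finally show ?thesis
    by (auto simp: rderiv_exp_monom res_coeff_0 exp_res_def eq_neg_iff_add_eq_0 add.commute)
qed

text \<open>The generating series of \<open>f\<close> in \<open>y\<close> is the single term
  \<open>c y^\<gamma>\<close>. Derivatives preserve this shape, which makes it the invariant for the
  fold in \<open>diffop\<close>.\<close>

definition point_res :: "('s \<Rightarrow> complex ^ 's::{finite,linorder}) \<Rightarrow> ('s \<Rightarrow>\<^sub>0 nat) \<Rightarrow> complex \<Rightarrow> 's ratfun \<Rightarrow> bool"
  where "point_res b \<gamma> c f \<longleftrightarrow> regular b f \<and> (\<forall>\<alpha>. exp_res b f \<alpha> = (if \<alpha> = \<gamma> then c else 0))"

lemma point_res_rderiv:
  assumes "point_res b \<gamma> c f" "invertible (\<chi> k. b k)"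
  shows "point_res b (\<gamma> + Poly_Mapping.single i 1) (- c) (rderiv i f)"
proof -
  have "\<alpha> - Poly_Mapping.single i 1 = \<gamma> \<longleftrightarrow> \<alpha> = \<gamma> + Poly_Mapping.single i 1"
    if "Poly_Mapping.lookup \<alpha> i \<noteq> 0" for \<alpha>
    using exponent_minus_add[OF that] by (metis add.commute add_diff_cancel_right')
  moreover have "\<alpha> \<noteq> \<gamma> + Poly_Mapping.single i 1" if "Poly_Mapping.lookup \<alpha> i = 0" for \<alpha>
    using that by (auto simp: lookup_add)
  ultimately show ?thesis
    using assms unfolding point_res_def
    by (auto simp: exp_res_rderiv regular_rderiv simp del: One_nat_def)
qed

lemma point_res_rderiv_power:
  assumes "point_res b \<gamma> c f" "invertible (\<chi> k. b k)"
  shows "point_res b (\<gamma> + Poly_Mapping.single i n) ((-1) ^ n * c) ((rderiv i ^^ n) f)"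
proof (induction n)
  case (Suc n)
  from point_res_rderiv[OF this assms(2), of i] show ?case
    by (simp add: add.assoc flip: single_add)
qed (use assms in simp)

lemma point_res_fold:
  assumes "point_res b \<gamma> c f" "invertible (\<chi> k. b k)"
  shows "point_res b (\<gamma> + (\<Sum>i\<leftarrow>xs. Poly_Mapping.single i (h i))) ((-1) ^ (\<Sum>i\<leftarrow>xs. h i) * c)
    (fold (\<lambda>i. rderiv i ^^ h i) xs f)"
  using assms(1)
proof (induction xs arbitrary: \<gamma> c f)
  case (Cons i xs)
  from Cons.IH[OF point_res_rderiv_power[OF Cons.prems assms(2), of i "h i"]] show ?case
    by (simp add: power_add add.assoc mult.assoc mult.left_commute)
qed simp

text \<open>Each monomial operator turns the constant series \<open>c\<close> into one signed
  monomial, and these add up to \<open>c p(-y)\<close>.\<close>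

lemma exp_res_diffop:
  fixes b :: "'s::{finite,linorder} \<Rightarrow> complex ^ 's::{finite,linorder}"
  assumes f: "point_res b 0 c f" and b: "invertible (\<chi> k. b k)"
  shows "regular b (diffop p f)"
    and "exp_res b (diffop p f) \<alpha> =
      (-1) ^ (\<Sum>i\<in>UNIV. Poly_Mapping.lookup \<alpha> i) * Poly_Mapping.lookup p \<alpha> * c"
proof -
  let ?D = "\<lambda>\<beta>. fold (\<lambda>i. rderiv i ^^ Poly_Mapping.lookup \<beta> i) (sorted_list_of_set UNIV) f"
  let ?sgn = "\<lambda>\<beta>. (-1) ^ (\<Sum>i\<in>UNIV. Poly_Mapping.lookup \<beta> i) :: complex"
  have D: "point_res b \<beta> (?sgn \<beta> * c) (?D \<beta>)" for \<beta> :: "'s \<Rightarrow>\<^sub>0 nat"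
    using point_res_fold[OF f b, of "Poly_Mapping.lookup \<beta>" "sorted_list_of_set UNIV"]
    by (simp add: sum_list_distinct_conv_sum_set exponent_eq_sum_single)
  have reg: "regular b (?D \<beta>)" for \<beta>
    using D by (simp add: point_res_def)
  then show "regular b (diffop p f)"
    unfolding diffop_def rscale_eq by (intro regular_sum regular_mult regular_rconst)
  have "exp_res b (diffop p f) \<alpha> =
      (\<Sum>\<beta>\<in>Poly_Mapping.keys p. Poly_Mapping.lookup p \<beta> * exp_res b (?D \<beta>) \<alpha>)"
    unfolding diffop_def rscale_eq
    by (simp add: exp_res_sum exp_res_rconst_mult reg regular_mult regular_rconst)
  also have "\<dots> = (\<Sum>\<beta>\<in>Poly_Mapping.keys p. if \<beta> = \<alpha> then ?sgn \<alpha> * Poly_Mapping.lookup p \<alpha> * c else 0)"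
    using D by (intro sum.cong) (auto simp: point_res_def)
  also have "\<dots> = ?sgn \<alpha> * Poly_Mapping.lookup p \<alpha> * c"
    by (simp add: in_keys_iff)
  finally show "exp_res b (diffop p f) \<alpha> = ?sgn \<alpha> * Poly_Mapping.lookup p \<alpha> * c" .
qed

text \<open>Extend a basis of the span by a vector \<open>w\<close> outside it and take a linear map
  that fixes \<open>w\<close> and kills the basis. The row of its matrix at a nonzero entry of
  \<open>w\<close> is the functional: its value at \<open>w\<close> is that entry.\<close>

lemma span_neq_UNIV_annihilator:
  fixes S :: "(complex ^ 's::finite) set"
  assumes "vec.span S \<noteq> UNIV"
  obtains v where "v \<noteq> 0" "\<And>a. a \<in> S \<Longrightarrow> (\<Sum>i\<in>UNIV. v $ i * a $ i) = 0"
proof -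
  from assms obtain w where w: "w \<notin> vec.span S" by blast
  obtain B where B: "B \<subseteq> S" "vec.independent B" "S \<subseteq> vec.span B"
    using vec.maximal_independent_subset[of S] by blast
  have wB: "w \<notin> vec.span B"
    using w vec.span_mono[OF B(1)] by blast
  then have "vec.independent (insert w B)"
    using B(2) vec.independent_insert[of w B] by (metis vec.span_base)
  then obtain g where g: "Vector_Spaces.linear (*s) (*s) g"
      "\<forall>x\<in>insert w B. g x = (if x = w then w else 0)"
    using vec.linear_independent_extend[of "insert w B" "\<lambda>x. if x = w then w else 0"] by blast
  have "g a = 0" if "a \<in> vec.span B" for a
    using that vec.linear_eq_0_on_span[OF g(1), of B a] g(2) wB vec.span_base by fastforce
  then have gS: "g a = 0" if "a \<in> S" for a using B(3) that by blast
  have gw: "g w = w" using g(2) by simp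
  have "w \<noteq> 0" using w vec.span_zero by metis
  then obtain r where r: "w $ r \<noteq> 0" by (auto simp: vec_eq_iff)
  have gm: "g a = matrix g *v a" for a
    using matrix_works[OF g(1)] by simp
  define v where "v = matrix g $ r"
  have eq: "(\<Sum>i\<in>UNIV. v $ i * a $ i) = g a $ r" for a
    by (simp add: gm matrix_vector_mult_def v_def)
  have "v \<noteq> 0" using eq[of w] r gw by auto
  with that eq gS show ?thesis by simp
qed

lemma arr_fraction_eq:
  "arr_fraction X f h = of_mpoly f * (\<Prod>i<length X. (1 / of_mpoly (linform (X ! i))) ^ h i)"
  by (simp add: arr_fraction_def power_one_over prod_dividef)

lemma regular_arr_fraction:
  assumes "invertible (\<chi> k. b k)" "0 \<notin> set X"
  shows "regular b (arr_fraction X f h)"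
  unfolding arr_fraction_eq using assms
  by (intro regular_mult regular_of_mpoly regular_prod regular_power regular_inverse_linform)
    (auto, metis nth_mem)

lemma res_coeff_of_mpoly_mult_eq_0:
  fixes b :: "'s::{finite,linorder} \<Rightarrow> complex ^ 's::{finite,linorder}"
  assumes b: "invertible (\<chi> k. b k)" and g: "regular b g"
    and v: "v \<noteq> 0" "dirderiv v g = 0"
  shows "res_coeff b (of_mpoly f * g) = 0"
proof -
  from v obtain m where m: "v $ m \<noteq> 0" by (auto simp: vec_eq_iff)
  let ?x = "of_mpoly (mvar m) :: 's ratfun"
  let ?M = "\<lambda>\<alpha>. of_mpoly (Poly_Mapping.single \<alpha> 1) :: 's ratfun"
  note reg = regular_mult regular_of_mpoly regular_power regular_rconst regular_sum g
  have dx: "dirderiv v ?x = rconst (v $ m)"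
    using dirderiv_linform[of v "axis m 1", unfolded linform_axis]
    by (simp add: axis_def if_distrib[of "\<lambda>c. _ * c"] cong: if_cong)
  have dM: "dirderiv v (?M \<alpha>) = (\<Sum>i\<in>UNIV. rconst (v $ i * of_nat (Poly_Mapping.lookup \<alpha> i)) *
      ?M (\<alpha> - Poly_Mapping.single i 1))" for \<alpha>
    unfolding dirderiv_def rderiv_of_mpoly mderiv_single
  proof (intro sum.cong refl)
    fix i
    let ?n = "of_nat (Poly_Mapping.lookup \<alpha> i) :: complex"
    show "rconst (v $ i) * of_mpoly (Poly_Mapping.single (\<alpha> - Poly_Mapping.single i 1) (?n * 1)) =
        rconst (v $ i * ?n) * ?M (\<alpha> - Poly_Mapping.single i 1)"
      by (simp only: of_mpoly_single[of _ ?n] mult_1_right rconst.hom_mult mult.assoc)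
  qed
  \<comment> \<open>Integration by parts: the derivative of \<open>x\<^sub>m\<^bsup>k+1\<^esup> x\<^sup>\<alpha> g\<close> along \<open>v\<close> has residue zero, and all its terms but
    \<open>(k + 1) v\<^sub>m x\<^sub>m\<^sup>k x\<^sup>\<alpha> g\<close> involve a monomial of lower degree than \<open>x\<^sup>\<alpha>\<close>.\<close>
  have monom: "res_coeff b (?x ^ k * ?M \<alpha> * g) = 0" for k \<alpha>
  proof (induction "\<Sum>i\<in>UNIV. Poly_Mapping.lookup \<alpha> i" arbitrary: \<alpha> k rule: less_induct)
    case less
    have IH: "of_nat (Poly_Mapping.lookup \<alpha> i) *
        res_coeff b (?x ^ Suc k * ?M (\<alpha> - Poly_Mapping.single i 1) * g) = 0" for i
      using less[of "\<alpha> - Poly_Mapping.single i 1" "Suc k"] sum_lookup_minus_single[of \<alpha> i]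
      by (cases "Poly_Mapping.lookup \<alpha> i = 0") (simp_all del: One_nat_def power_Suc)
    have "dirderiv v (?x ^ Suc k * ?M \<alpha> * g) =
        rconst (of_nat (Suc k) * v $ m) * (?x ^ k * ?M \<alpha> * g) +
        (\<Sum>i\<in>UNIV. rconst (v $ i * of_nat (Poly_Mapping.lookup \<alpha> i)) *
          (?x ^ Suc k * ?M (\<alpha> - Poly_Mapping.single i 1) * g))"
      unfolding dirderiv_mult dirderiv_power_Suc dx v(2) dM rconst.hom_mult rconst.hom_of_nat
      by (simp only: distrib_right distrib_left mult_zero_left mult_zero_right add_0_left add_0_right sum_distrib_left sum_distrib_right ac_simps)
    then have "0 = res_coeff b (rconst (of_nat (Suc k) * v $ m) * (?x ^ k * ?M \<alpha> * g) +
        (\<Sum>i\<in>UNIV. rconst (v $ i * of_nat (Poly_Mapping.lookup \<alpha> i)) *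
          (?x ^ Suc k * ?M (\<alpha> - Poly_Mapping.single i 1) * g)))"
      using res_coeff_dirderiv[OF _ b, of "?x ^ Suc k * ?M \<alpha> * g" v] by (simp add: reg del: power_Suc)
    also have "\<dots> = of_nat (Suc k) * v $ m * res_coeff b (?x ^ k * ?M \<alpha> * g) +
        (\<Sum>i\<in>UNIV. v $ i * (of_nat (Poly_Mapping.lookup \<alpha> i) *
          res_coeff b (?x ^ Suc k * ?M (\<alpha> - Poly_Mapping.single i 1) * g)))"
      by (simp add: res_coeff_add res_coeff_sum res_coeff_rconst_mult reg mult.assoc
          del: power_Suc One_nat_def of_nat_Suc)
    also have "\<dots> = of_nat (Suc k) * v $ m * res_coeff b (?x ^ k * ?M \<alpha> * g)"
      by (simp only: IH mult_zero_right sum.neutral_const add_0_right)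
    finally show ?case using m by (simp del: of_nat_Suc)
  qed
  show ?thesis
  proof (induction f rule: mpoly_single_induct)
    case (single_add \<alpha> c f)
    have "of_mpoly (Poly_Mapping.single \<alpha> c + f) * g = rconst c * (?M \<alpha> * g) + of_mpoly f * g"
      by (simp only: of_mpoly_add of_mpoly_single[of \<alpha> c] distrib_right mult.assoc)
    then show ?case
      using single_add monom[of 0 \<alpha>] by (simp add: res_coeff_add res_coeff_rconst_mult reg)
  qed (simp add: res_coeff_0)
qed

lemma exp_res_R_low:
  fixes b :: "'s::{finite,linorder} \<Rightarrow> complex ^ 's::{finite,linorder}"
  assumes b: "invertible (\<chi> k. b k)" and X: "0 \<notin> set X" and f: "f \<in> R_low X"
  shows "regular b f" "exp_res b f \<alpha> = 0"
proof -
  let ?P = "\<lambda>f. regular b f \<and> (\<forall>\<alpha>. exp_res b f \<alpha> = 0)"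
  have "?P f"
    using f unfolding R_low_def
  proof (rule ratfun.span_induct)
    show "ratfun.subspace (Collect ?P)"
      by (rule ratfun.subspaceI)
        (auto simp: rscale_eq exp_res_0 exp_res_add exp_res_rconst_mult regular_0 regular_rconst
          intro: regular_add regular_mult)
  next
    fix x assume "x \<in> {arr_fraction X f h | f h. vec.span {X ! i | i. i < length X \<and> h i > 0} \<noteq> UNIV}"
    then obtain p h where x: "x = arr_fraction X p h"
      and h: "vec.span {X ! i | i. i < length X \<and> h i > 0} \<noteq> UNIV" by blast
    obtain v where v: "v \<noteq> 0"
      "\<And>a. a \<in> {X ! i | i. i < length X \<and> h i > 0} \<Longrightarrow> (\<Sum>i\<in>UNIV. v $ i * a $ i) = 0"
      using span_neq_UNIV_annihilator[OF h] by blast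
    let ?g = "\<Prod>i<length X. (1 / of_mpoly (linform (X ! i))) ^ h i"
    have "dirderiv v ?g = 0"
    proof (rule dirderiv_prod_0)
      fix i assume "i \<in> {..<length X}"
      then have "(\<Sum>k\<in>UNIV. v $ k * X ! i $ k) = 0" if "h i \<noteq> 0"
        using that by (intro v(2)) auto
      then show "dirderiv v ((1 / of_mpoly (linform (X ! i))) ^ h i) = 0"
        by (cases "h i = 0")
          (simp_all add: rconst.hom_0 dirderiv_linform dirderiv_power_0 dirderiv_inverse_0)
    qed
    moreover have "regular b ?g"
      using regular_arr_fraction[OF b X, of 1 h] by (simp add: arr_fraction_eq)
    ultimately have "res_coeff b (of_mpoly q * ?g) = 0" for q
      using res_coeff_of_mpoly_mult_eq_0[OF b _ v(1)] by blast
    \<comment> \<open>The factor \<open>exp_monom \<alpha>\<close> is a polynomial and joins the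
      numerator \<open>p\<close>, so one statement covers all coefficients in
      \<open>y\<close>.\<close>
    note this[of "_ * p"]
    then have "exp_res b x \<alpha> = 0" for \<alpha>
      unfolding exp_res_def exp_monom_def x arr_fraction_eq rconst_def
      by (simp only: mult.assoc[symmetric] of_mpoly_mult[symmetric])
    then show "?P x"
      using regular_arr_fraction[OF b X] x by blast
  qed
  then show "regular b f" "exp_res b f \<alpha> = 0" by blast+
qed

section \<open>No broken bases\<close>

lemma extracted_basis_invertible:
  assumes "extracted_basis X \<sigma>"
  shows "invertible (\<chi> e. extracted X \<sigma> e)"
proof -
  have "rows (\<chi> e. extracted X \<sigma> e) = range (extracted X \<sigma>)"
    by (auto simp: rows_def row_def vec_eq_iff)
  then show ?thesis
    using assms by (simp add: extracted_basis_def invertible_left_inverse matrix_left_invertible_span_rows_gen)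
qed

text \<open>Every member of a basis breaks it, by lying in the span that it begins. With s breaking
  positions in all there are no others.\<close>

lemma no_broken_breaks_range:
  assumes "\<sigma> \<in> no_broken X"
  shows "{i. i < length X \<and> breaks X \<sigma> i} = range \<sigma>"
proof (rule sym, rule card_subset_eq)
  from assms have \<sigma>: "extracted_basis X \<sigma>" "card {i. i < length X \<and> breaks X \<sigma> i} = CARD('a)"
    by (auto simp: no_broken_def)
  then have "inj \<sigma>" by (auto simp: extracted_basis_def strict_mono_imp_inj_on)
  with \<sigma>(2) show "card (range \<sigma>) = card {i. i < length X \<and> breaks X \<sigma> i}"
    by (simp add: card_image)
  show "range \<sigma> \<subseteq> {i. i < length X \<and> breaks X \<sigma> i}"
  proof safe
    fix e
    show "\<sigma> e < length X" using \<sigma>(1) by (simp add: extracted_basis_def)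
    have "X ! \<sigma> e \<in> vec.span (extracted X \<sigma> ` {e..})"
      by (rule vec.span_base) (simp add: extracted_def)
    then show "breaks X \<sigma> (\<sigma> e)" unfolding breaks_def by blast
  qed
qed simp

text \<open>So \<open>\<sigma> l\<close> is the first position of \<open>X\<close> in the space
  spanned by the members from \<open>l\<close> on. A breaking position is some
  \<open>\<sigma> m\<close>, and \<open>m < l\<close> would put a member of the basis into the span
  of others.\<close>

lemma no_broken_minimal:
  assumes \<sigma>: "\<sigma> \<in> no_broken X" and i: "i < length X" "i \<le> \<sigma> l"
    and span: "X ! i \<in> vec.span (extracted X \<sigma> ` {l..})"
  shows "i = \<sigma> l"
proof -
  have basis: "extracted_basis X \<sigma>" using \<sigma> by (simp add: no_broken_def)
  have "breaks X \<sigma> i" using i span unfolding breaks_def by blast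
  with i no_broken_breaks_range[OF \<sigma>] obtain m where m: "i = \<sigma> m" by blast
  have "m \<le> l" using i(2) m basis by (simp add: extracted_basis_def strict_mono_less_eq)
  moreover have False if "m < l"
  proof -
    have "extracted X \<sigma> ` {l..} \<subseteq> range (extracted X \<sigma>) - {extracted X \<sigma> m}"
      using that basis by (auto simp: extracted_basis_def dest: injD)
    then have "extracted X \<sigma> m \<in> vec.span (range (extracted X \<sigma>) - {extracted X \<sigma> m})"
      using span vec.span_mono unfolding m extracted_def by blast
    then show False
      using basis unfolding extracted_basis_def vec.dependent_def by blast
  qed
  ultimately show ?thesis using m by (metis order_le_less)
qed

text \<open>\<open>inv \<tau> \<circ> \<sigma>\<close> is a strictly increasing self-map of a finite
  order. If it raised \<open>i\<close>, the elements from \<open>i\<close> on would be mapped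
  injectively into a smaller set; hence it is the identity.\<close>

lemma strict_mono_eq_of_range:
  fixes \<sigma> \<tau> :: "'s::{finite,linorder} \<Rightarrow> 'b::linorder"
  assumes "strict_mono \<sigma>" "strict_mono \<tau>" "range \<sigma> \<subseteq> range \<tau>"
  shows "\<sigma> = \<tau>"
proof -
  have inj: "inj \<sigma>" using assms by (simp add: strict_mono_imp_inj_on)
  define p where "p = inv \<tau> \<circ> \<sigma>"
  have p: "\<tau> (p i) = \<sigma> i" for i
    using assms(3) by (simp add: p_def f_inv_into_f image_subset_iff)
  have mono: "i < j \<Longrightarrow> p i < p j" for i j
    using assms p by (metis strict_mono_less)
  have inj_p: "inj p" using inj p by (metis inj_on_def)
  then have "p permutes UNIV"
    by (intro bij_imp_permutes bijI finite_UNIV_inj_surj) auto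
  moreover have "p i \<le> i" for i
  proof (rule ccontr)
    assume "\<not> p i \<le> i"
    then have "{p i..} \<subset> {i..}" by auto
    then have "card {p i..} < card {i..}" by (simp add: psubset_card_mono)
    moreover have "p ` {i..} \<subseteq> {p i..}" using mono by (auto simp: le_less)
    then have "card {i..} \<le> card {p i..}"
      using inj_p by (metis card_image card_mono finite inj_on_subset subset_UNIV)
    ultimately show False by simp
  qed
  ultimately have "p = id" by (rule permutation_le_imp_id)
  with p show ?thesis by (simp add: fun_eq_iff)
qed

section \<open>Residues of the no broken bases\<close>

lemma basis_coord_basis:
  assumes "invertible (\<chi> k. b k)"
  shows "basis_coord b (b e) k = (if e = k then 1 else 0)"
proof -
  have "basis_coord b (b e) k = ((\<chi> k. b k) ** matrix_inv (\<chi> k. b k)) $ e $ k"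
    by (simp add: basis_coord_def matrix_matrix_mult_def)
  then show ?thesis using matrix_inv_right_left(1)[OF assms] by (simp add: mat_def)
qed

definition basis_fraction :: "('s \<Rightarrow> complex ^ 's::{finite,linorder}) \<Rightarrow> 's ratfun"
  where "basis_fraction b = 1 / (\<Prod>e\<in>UNIV. of_mpoly (linform (b e)))"

lemma basis_fraction_eq: "basis_fraction b = (\<Prod>e\<in>UNIV. 1 / of_mpoly (linform (b e)))"
  by (simp add: basis_fraction_def prod_dividef)

lemma regular_basis_fraction:
  "invertible (\<chi> k. b k) \<Longrightarrow> (\<And>e. a e \<noteq> 0) \<Longrightarrow> regular b (basis_fraction a)"
  unfolding basis_fraction_eq by (intro regular_prod regular_inverse_linform)

text \<open>Only members with lead index at least \<open>t\<close> can have a pole in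
  \<open>u_t\<close>, and then at most a simple one.\<close>

lemma ord_ge_j_map_basis_fraction:
  assumes "invertible (\<chi> k. b k)" "\<And>e. a e \<noteq> 0"
  shows "ord_ge t (- int (card {e. t \<le> lead_index b (a e)})) (j_map b (basis_fraction a))"
proof -
  have "ord_ge t (\<Sum>e\<in>UNIV. if t \<le> lead_index b (a e) then -1 else 0)
      (\<Prod>e\<in>UNIV. j_map b (1 / of_mpoly (linform (a e))))"
    using assms by (intro ord_ge_prod ord_ge_j_map_inverse_linform) auto
  then show ?thesis
    using assms by (simp add: basis_fraction_eq j_map_prod regular_inverse_linform sum.If_cases)
qed

lemma res_coeff_basis_fraction_same:
  assumes b: "invertible (\<chi> k. b k)"
  shows "res_coeff b (basis_fraction b) = 1"
proof -
  have nz: "b e \<noteq> 0" for e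
  proof
    assume "b e = 0"
    then have "basis_coord b (b e) e = 0" by (simp add: basis_coord_def)
    then show False by (simp add: basis_coord_basis[OF b])
  qed
  have "j_map b (1 / of_mpoly (linform (b e))) = laurent_monom (- flag_exp e) 1" for e
  proof -
    have u: "j_mpoly b (linform (b e)) dvd 1" by (rule j_mpoly_linform_unit[OF b nz])
    have "j_mpoly b (linform (b e)) = (\<Sum>k\<in>UNIV. if e = k then flag_monom k else 0)"
      unfolding j_mpoly_linform
      by (intro sum.cong) (auto simp: basis_coord_basis[OF b] laurent_const.hom_0 laurent_const.hom_1)
    then have "j_mpoly b (linform (b e)) = flag_monom e" by simp
    then have "laurent_monom (- flag_exp e) 1 * j_mpoly b (linform (b e)) = 1"
      by (simp add: laurent_monom_mult laurent_monom_0_1)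
    then show ?thesis
      using unit_cancel[OF u] j_map_inverse_of_mpoly[OF u] by metis
  qed
  then have "j_map b (basis_fraction b) = laurent_monom (- res_exp) 1"
    using b nz by (simp add: basis_fraction_eq j_map_prod regular_inverse_linform laurent_monom_prod
        res_exp_def sum_negf)
  then show ?thesis by (simp add: res_coeff_def laurent_monom.rep_eq)
qed

lemma extracted_nonzero:
  "0 \<notin> set X \<Longrightarrow> extracted_basis X \<sigma> \<Longrightarrow> extracted X \<sigma> e \<noteq> 0"
  by (metis extracted_basis_def extracted_def nth_mem)

lemma res_coeff_no_broken_eq_0:
  fixes X :: "(complex ^ 's::{finite,linorder}) list"
  assumes X: "0 \<notin> set X" and nb: "\<sigma> \<in> no_broken X" "\<tau> \<in> no_broken X" and ne: "\<tau> \<noteq> \<sigma>"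
  shows "res_coeff (extracted X \<sigma>) (basis_fraction (extracted X \<tau>)) = 0"
proof (rule ccontr)
  let ?b = "extracted X \<sigma>" and ?a = "extracted X \<tau>"
  assume nz: "res_coeff ?b (basis_fraction ?a) \<noteq> 0"
  have bases: "extracted_basis X \<sigma>" "extracted_basis X \<tau>"
    using nb by (auto simp: no_broken_def)
  have b: "invertible (\<chi> k. ?b k)" by (rule extracted_basis_invertible) fact
  have a: "?a e \<noteq> 0" for e by (rule extracted_nonzero) fact+
  have bound: "\<tau> e < length X" "\<sigma> e < length X" for e
    using bases by (auto simp: extracted_basis_def)
  have "\<sigma> t \<in> range \<tau>" for t
  proof -
    \<comment> \<open>\<open>T\<close> collects the members of \<open>\<tau>\<close> that can
      contribute a pole in \<open>u_t\<close>; the exponent \<open>- res_exp\<close> calls for a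
      pole of order \<open>card {t..}\<close>.\<close>
    define T where "T = {e. t \<le> lead_index ?b (?a e)}"
    have "card {t..} \<le> card T"
    proof (rule ccontr)
      assume "\<not> ?thesis"
      then have "(- res_exp) $ t < - int (card T)" by (simp add: res_exp_nth)
      with ord_geD[OF ord_ge_j_map_basis_fraction[OF b a], of "- res_exp" t] nz
      show False by (simp add: res_coeff_def T_def)
    qed
    have inj: "inj ?a" and indep: "vec.independent (range ?a)"
      using bases(2) by (auto simp: extracted_basis_def)
    have sub: "?a ` T \<subseteq> vec.span (?b ` {t..})"
      using in_span_lead_index[OF b a] by (auto simp: T_def)
    \<comment> \<open>Independent and at least as many as the dimension, the members in
      \<open>T\<close> span the whole flag space of \<open>\<sigma>\<close> at
      \<open>t\<close>.\<close>
    have "vec.span (?b ` {t..}) \<subseteq> vec.span (?a ` T)"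
    proof (rule vec.card_ge_dim_independent[OF sub])
      show "vec.independent (?a ` T)"
        using indep by (rule vec.independent_mono) auto
      have "vec.dim (vec.span (?b ` {t..})) \<le> card (?b ` {t..})"
        by (simp add: vec.dim_le_card')
      also have "\<dots> \<le> card {t..}" by (rule card_image_le) simp
      also have "\<dots> \<le> card (?a ` T)"
        using \<open>card {t..} \<le> card T\<close> inj by (simp add: card_image inj_on_subset)
      finally show "vec.dim (vec.span (?b ` {t..})) \<le> card (?a ` T)" .
    qed
    moreover have "?b t \<in> vec.span (?b ` {t..})" by (rule vec.span_base) simp
    ultimately have bt: "?b t \<in> vec.span (?a ` T)" by blast
    have "0 < card {t..}" by (simp add: card_gt_0_iff)
    with \<open>card {t..} \<le> card T\<close> have "T \<noteq> {}" by auto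
    \<comment> \<open>The earliest member in \<open>T\<close> lies in the flag space of
      \<open>\<sigma>\<close> at \<open>t\<close>, so minimality of \<open>\<sigma>\<close> gives
      \<open>\<sigma> t \<le> \<tau> e\<close>. Conversely the member of \<open>\<sigma>\<close> at
      \<open>t\<close> lies in the flag space of \<open>\<tau>\<close> at \<open>e\<close>, and
      minimality of \<open>\<tau>\<close> gives equality.\<close>
    define e where "e = Min T"
    have eT: "e \<in> T" "T \<subseteq> {e..}" using \<open>T \<noteq> {}\<close> by (auto simp: e_def)
    have "X ! \<tau> e \<in> vec.span (?b ` {t..})" using sub eT(1) by (auto simp: extracted_def)
    then have "\<sigma> t \<le> \<tau> e"
      using no_broken_minimal[OF nb(1), of "\<tau> e" t] bound by (metis linear)
    moreover have "X ! \<sigma> t \<in> vec.span (?a ` {e..})"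
      using bt eT(2) vec.span_mono[of "?a ` T" "?a ` {e..}"] by (auto simp: extracted_def)
    ultimately have "\<sigma> t = \<tau> e"
      using no_broken_minimal[OF nb(2)] bound by blast
    then show ?thesis by simp
  qed
  then have "\<sigma> = \<tau>"
    using bases by (intro strict_mono_eq_of_range) (auto simp: extracted_basis_def)
  with ne show False by simp
qed

text \<open>\<open>Min UNIV\<close> is the first variable; it divides every \<open>b_k\<close> and
  so the image of every coordinate.\<close>

lemma ord_ge_j_mpoly_monom:
  fixes b :: "'s::{finite,linorder} \<Rightarrow> complex ^ 's::{finite,linorder}"
  shows "ord_ge (Min UNIV) (int (\<Sum>i\<in>UNIV. Poly_Mapping.lookup \<alpha> i))
    (j_mpoly b (Poly_Mapping.single \<alpha> 1))"
proof -
  have x: "ord_ge (Min UNIV) 1 (x_image b i)" for i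
    unfolding x_image_eq by (intro ord_ge_sum ord_ge_const_mult ord_ge_monom) (simp add: flag_exp_def)
  have "ord_ge (Min UNIV) (\<Sum>i\<in>UNIV. int (Poly_Mapping.lookup \<alpha> i) * 1)
      (\<Prod>i\<in>UNIV. x_image b i ^ Poly_Mapping.lookup \<alpha> i)"
    by (intro ord_ge_prod ord_ge_power x) simp
  then show ?thesis
    by (simp add: j_mpoly_def laurent_const.msubst_single laurent_const.hom_1)
qed

text \<open>Count in the first variable: the s inverse forms give a pole of order at most s, just
  the order at \<open>- res_exp\<close>, and \<open>x^\<alpha>\<close> lowers it.\<close>

lemma exp_res_basis_fraction_eq_0:
  fixes b :: "'s::{finite,linorder} \<Rightarrow> complex ^ 's::{finite,linorder}"
  assumes b: "invertible (\<chi> k. b k)" and a: "\<And>e. a e \<noteq> 0" and "\<alpha> \<noteq> 0"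
  shows "exp_res b (basis_fraction a) \<alpha> = 0"
proof -
  let ?t = "Min UNIV :: 's" and ?n = "\<Sum>i\<in>UNIV. Poly_Mapping.lookup \<alpha> i"
  let ?M = "of_mpoly (Poly_Mapping.single \<alpha> 1) :: 's ratfun"
  have "?n \<noteq> 0"
    using \<open>\<alpha> \<noteq> 0\<close> by (auto simp: poly_mapping_eq_iff fun_eq_iff)
  have "ord_ge ?t (int ?n + - int (card {e. ?t \<le> lead_index b (a e)}))
      (j_map b (?M * basis_fraction a))"
    using assms unfolding j_map_mult[OF regular_of_mpoly regular_basis_fraction[OF b a]] j_map_of_mpoly
    by (intro ord_ge_mult ord_ge_j_mpoly_monom ord_ge_j_map_basis_fraction)
  moreover have "(- res_exp) $ ?t < int ?n + - int (card {e. ?t \<le> lead_index b (a e)})"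
    using \<open>?n \<noteq> 0\<close> by (simp add: res_exp_nth atLeast_def del: of_nat_sum sum_eq_0_iff)
  ultimately have "res_coeff b (?M * basis_fraction a) = 0"
    unfolding res_coeff_def by (rule ord_geD)
  then show ?thesis
    using assms by (simp add: exp_res_def exp_monom_def mult.assoc res_coeff_rconst_mult
        regular_mult regular_of_mpoly regular_basis_fraction)
qed

lemma point_res_no_broken:
  assumes X: "0 \<notin> set X" and nb: "\<sigma> \<in> no_broken X" "\<tau> \<in> no_broken X"
  shows "point_res (extracted X \<sigma>) 0 (if \<tau> = \<sigma> then 1 else 0) (basis_fraction (extracted X \<tau>))"
proof -
  have bases: "extracted_basis X \<sigma>" "extracted_basis X \<tau>"
    using nb by (auto simp: no_broken_def)
  have b: "invertible (\<chi> k. extracted X \<sigma> k)" by (rule extracted_basis_invertible) fact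
  have a: "extracted X \<tau> e \<noteq> 0" for e by (rule extracted_nonzero) fact+
  have "exp_res (extracted X \<sigma>) (basis_fraction (extracted X \<tau>)) 0 = (if \<tau> = \<sigma> then 1 else 0)"
    using res_coeff_no_broken_eq_0[OF X nb] res_coeff_basis_fraction_same[OF b]
    by (auto simp: exp_res_def exp_monom_0)
  then show ?thesis
    unfolding point_res_def
    using exp_res_basis_fraction_eq_0[OF b, of "extracted X \<tau>"] a
      regular_basis_fraction[OF b, of "extracted X \<tau>"]
    by (metis (no_types))
qed

section \<open>Coefficients and uniqueness of the expansion\<close>

lemma finite_no_broken: "finite (no_broken X)"
proof (rule finite_subset)
  show "no_broken X \<subseteq> PiE UNIV (\<lambda>_. {..<length X})"
    by (auto simp: no_broken_def extracted_basis_def)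
qed (intro finite_PiE, auto)

lemma subspace_R_low: "ratfun.subspace (R_low X)"
  unfolding R_low_def by (rule ratfun.subspace_span)

text \<open>\<open>P_class\<close> yields sets of representatives, so equality of classes gives
  congruence only through a member; \<open>1 / arr_prod X\<close> is one, as it lies in
  \<open>R_alg X\<close>.\<close>

lemma nb_expansion_iff:
  "nb_expansion X p \<longleftrightarrow> p \<in> extensional (no_broken X) \<and>
    1 / arr_prod X - (\<Sum>\<sigma>\<in>no_broken X. diffop (p \<sigma>) (basis_fraction (extracted X \<sigma>))) \<in> R_low X"
proof -
  have "1 / arr_prod X = arr_fraction X 1 (\<lambda>_. 1)"
    by (simp add: arr_fraction_def arr_prod_def)
  then have alg: "1 / arr_prod X \<in> R_alg X" unfolding R_alg_def by blast
  have "P_class X (1 / arr_prod X) = P_class X g \<longleftrightarrow> 1 / arr_prod X - g \<in> R_low X" for g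
  proof
    assume "P_class X (1 / arr_prod X) = P_class X g"
    moreover have "1 / arr_prod X \<in> P_class X (1 / arr_prod X)"
      using alg ratfun.subspace_0[OF subspace_R_low] by (simp add: P_class_def)
    ultimately show "1 / arr_prod X - g \<in> R_low X" by (simp add: P_class_def)
  next
    assume d: "1 / arr_prod X - g \<in> R_low X"
    have "h - 1 / arr_prod X \<in> R_low X \<longleftrightarrow> h - g \<in> R_low X" for h
      using ratfun.subspace_add[OF subspace_R_low d, of "h - 1 / arr_prod X"]
        ratfun.subspace_diff[OF subspace_R_low _ d, of "h - g"] by auto
    then show "P_class X (1 / arr_prod X) = P_class X g" by (simp add: P_class_def)
  qed
  then show ?thesis
    by (simp add: nb_expansion_def basis_fraction_def)
qed

text \<open>Modulo \<open>R_low X\<close>, which \<open>exp_res\<close> kills, the residue at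
  \<open>\<sigma>\<close> isolates the term of \<open>\<sigma>\<close>. The left side does not
  involve \<open>p\<close>, so this also gives uniqueness.\<close>

lemma nb_expansion_coeff:
  fixes X :: "(complex ^ 's::{finite,linorder}) list"
  assumes X: "0 \<notin> set X" and p: "nb_expansion X p" and \<sigma>: "\<sigma> \<in> no_broken X"
  shows "exp_res (extracted X \<sigma>) (1 / arr_prod X) \<alpha> =
    (-1) ^ (\<Sum>i\<in>UNIV. Poly_Mapping.lookup \<alpha> i) * Poly_Mapping.lookup (p \<sigma>) \<alpha>"
proof -
  let ?b = "extracted X \<sigma>"
  let ?D = "\<lambda>\<tau>. diffop (p \<tau>) (basis_fraction (extracted X \<tau>))"
  let ?sgn = "(-1) ^ (\<Sum>i\<in>UNIV. Poly_Mapping.lookup \<alpha> i) :: complex"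
  have b: "invertible (\<chi> k. ?b k)"
    using \<sigma> by (intro extracted_basis_invertible) (simp add: no_broken_def)
  have r: "1 / arr_prod X - (\<Sum>\<tau>\<in>no_broken X. ?D \<tau>) \<in> R_low X"
    using p by (simp add: nb_expansion_iff)
  note D = exp_res_diffop[OF point_res_no_broken[OF X \<sigma>] b]
  have reg: "regular ?b (\<Sum>\<tau>\<in>no_broken X. ?D \<tau>)"
    by (intro regular_sum D(1))
  have "exp_res ?b (1 / arr_prod X) \<alpha> =
      exp_res ?b ((1 / arr_prod X - (\<Sum>\<tau>\<in>no_broken X. ?D \<tau>)) + (\<Sum>\<tau>\<in>no_broken X. ?D \<tau>)) \<alpha>"
    by simp
  also have "\<dots> = (\<Sum>\<tau>\<in>no_broken X. exp_res ?b (?D \<tau>) \<alpha>)"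
    using exp_res_R_low[OF b X r] reg by (simp only: exp_res_add exp_res_sum[OF D(1)] add_0)
  also have "\<dots> = (\<Sum>\<tau>\<in>no_broken X. if \<tau> = \<sigma> then ?sgn * Poly_Mapping.lookup (p \<sigma>) \<alpha> else 0)"
    by (intro sum.cong) (auto simp: D(2))
  also have "\<dots> = ?sgn * Poly_Mapping.lookup (p \<sigma>) \<alpha>"
    using \<sigma> by (simp add: finite_no_broken)
  finally show ?thesis .
qed

lemma nb_expansion_unique:
  assumes "0 \<notin> set X" "nb_expansion X p" "nb_expansion X q"
  shows "p = q"
proof (rule extensionalityI)
  show "p \<in> extensional (no_broken X)" "q \<in> extensional (no_broken X)"
    using assms by (auto simp: nb_expansion_def)
  show "p \<sigma> = q \<sigma>" if "\<sigma> \<in> no_broken X" for \<sigma>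
    using nb_expansion_coeff[OF assms(1,2) that] nb_expansion_coeff[OF assms(1,3) that]
    by (intro poly_mapping_eqI) simp
qed

section \<open>Existence of the expansion\<close>

lemma diffop_superset:
  assumes "finite A" "Poly_Mapping.keys p \<subseteq> A"
  shows "diffop p f = (\<Sum>\<alpha>\<in>A. rconst (Poly_Mapping.lookup p \<alpha>) *
    fold (\<lambda>i. rderiv i ^^ Poly_Mapping.lookup \<alpha> i) (sorted_list_of_set UNIV) f)"
  unfolding diffop_def rscale_eq using assms
  by (intro sum.mono_neutral_left) (auto simp: in_keys_iff rconst.hom_0)

lemma diffop_add: "diffop (p + q) f = diffop p f + diffop q f"
proof -
  let ?A = "Poly_Mapping.keys p \<union> Poly_Mapping.keys q"
  have "diffop r f = (\<Sum>\<alpha>\<in>?A. rconst (Poly_Mapping.lookup r \<alpha>) *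
      fold (\<lambda>i. rderiv i ^^ Poly_Mapping.lookup \<alpha> i) (sorted_list_of_set UNIV) f)"
    if "r \<in> {p, q, p + q}" for r
    using that keys_add[of p q] by (intro diffop_superset) auto
  then show ?thesis
    by (simp add: lookup_add rconst.hom_add distrib_right sum.distrib)
qed

lemma diffop_0 [simp]: "diffop 0 f = 0"
  by (simp add: diffop_def)

lemma diffop_single:
  "diffop (Poly_Mapping.single \<alpha> c) f =
    rconst c * fold (\<lambda>i. rderiv i ^^ Poly_Mapping.lookup \<alpha> i) (sorted_list_of_set UNIV) f"
  by (cases "c = 0") (auto simp: diffop_def rscale_eq rconst.hom_0)

lemma diffop_1: "diffop 1 f = f"
proof -
  have "fold (\<lambda>i. rderiv i ^^ 0) xs f = f" for xs
    by (induction xs) auto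
  then show ?thesis
    using diffop_single[of 0 1 f] by (simp add: rconst.hom_1)
qed

lemma diffop_mconst_mult: "diffop (mconst c * p) f = rconst c * diffop p f"
proof (induction p rule: mpoly_single_induct)
  case (single_add \<alpha> d p)
  have "diffop (mconst c * Poly_Mapping.single \<alpha> d) f = rconst c * diffop (Poly_Mapping.single \<alpha> d) f"
    by (simp add: mconst_def mult_single diffop_single rconst.hom_mult mult.assoc)
  with single_add show ?case by (simp add: distrib_left diffop_add)
qed simp

lemma rderiv_funpow_commute: "rderiv i ((rderiv k ^^ n) f) = (rderiv k ^^ n) (rderiv i f)"
  by (induction n) (simp_all add: rderiv_commute[of i k])

lemma rderiv_fold_commute:
  "rderiv i (fold (\<lambda>k. rderiv k ^^ h k) xs f) = fold (\<lambda>k. rderiv k ^^ h k) xs (rderiv i f)"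
  by (induction xs arbitrary: f) (simp_all add: rderiv_funpow_commute)

text \<open>The fold applies the derivatives in a fixed order. The new one commutes past the others
  to the only place of \<open>i\<close> in \<open>xs\<close> and raises the exponent there.\<close>

lemma rderiv_fold:
  assumes "distinct xs" "i \<in> set xs"
  shows "rderiv i (fold (\<lambda>k. rderiv k ^^ h k) xs f) =
    fold (\<lambda>k. rderiv k ^^ (h(i := Suc (h i))) k) xs f"
  using assms
proof (induction xs arbitrary: f)
  case (Cons k xs)
  show ?case
  proof (cases "k = i")
    case True
    then have "fold (\<lambda>k. rderiv k ^^ (h(i := Suc (h i))) k) xs g = fold (\<lambda>k. rderiv k ^^ h k) xs g" for g
      using Cons.prems by (intro fold_cong) auto
    with True show ?thesis
      by (simp add: rderiv_fold_commute rderiv_funpow_commute funpow_swap1 del: fun_upd_apply)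
        (simp add: funpow_swap1)
  next
    case False
    with Cons show ?thesis by simp
  qed
qed simp

lemma rderiv_diffop: "rderiv i (diffop p f) = diffop (mvar i * p) f"
proof (induction p rule: mpoly_single_induct)
  case (single_add \<alpha> c p)
  have "Poly_Mapping.lookup (Poly_Mapping.single i 1 + \<alpha>) =
      (Poly_Mapping.lookup \<alpha>)(i := Suc (Poly_Mapping.lookup \<alpha> i))"
    by (auto simp: lookup_add lookup_single when_def)
  then have "rderiv i (diffop (Poly_Mapping.single \<alpha> c) f) = diffop (mvar i * Poly_Mapping.single \<alpha> c) f"
    by (simp only: mvar_def mult_single mult_1_left diffop_single rderiv_rconst_mult)
      (simp add: rderiv_fold del: fun_upd_apply)
  with single_add show ?case by (simp add: distrib_left diffop_add rderiv_add)
qed simp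

lemma dirderiv_in_diffop_range:
  assumes "g \<in> range (\<lambda>p. diffop p f)"
  shows "dirderiv v g \<in> range (\<lambda>p. diffop p f)"
proof -
  from assms obtain p where g: "g = diffop p f" by blast
  have "diffop (\<Sum>i\<in>A. mconst (v $ i) * (mvar i * p)) f = (\<Sum>i\<in>A. rconst (v $ i) * rderiv i g)" for A
    by (induction A rule: infinite_finite_induct)
      (simp_all add: diffop_add diffop_mconst_mult rderiv_diffop g)
  from this[of UNIV, symmetric] show ?thesis
    unfolding dirderiv_def by (rule range_eqI)
qed

lemma prod_power_fun_upd_Suc:
  fixes x :: "'i \<Rightarrow> 'a::comm_monoid_mult"
  assumes "finite A" "i \<in> A"
  shows "(\<Prod>j\<in>A. x j ^ (h(i := Suc (h i))) j) = x i * (\<Prod>j\<in>A. x j ^ h j)"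
proof -
  have "(\<Prod>j\<in>A - {i}. x j ^ (h(i := Suc (h i))) j) = (\<Prod>j\<in>A - {i}. x j ^ h j)"
    by (rule prod.cong) auto
  then show ?thesis by (simp add: prod.remove[OF assms] mult.assoc)
qed

lemma sum_mult_fun_upd_Suc:
  fixes w h :: "'i \<Rightarrow> nat"
  assumes "finite A" "i \<in> A"
  shows "(\<Sum>j\<in>A. w j * (h(i := Suc (h i))) j) = w i + (\<Sum>j\<in>A. w j * h j)"
proof -
  have "(\<Sum>j\<in>A - {i}. w j * (h(i := Suc (h i))) j) = (\<Sum>j\<in>A - {i}. w j * h j)"
    by (rule sum.cong) auto
  then show ?thesis by (simp add: sum.remove[OF assms])
qed

text \<open>The derivative along the direction dual to \<open>b_k\<close> leaves the other members
  constant and sends \<open>b_k^(-(m+1))\<close> to \<open>-(m+1) b_k^(-(m+2))\<close>, so each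
  surplus power comes from one derivative. The induction is on the total surplus
  \<open>g\<close>.\<close>

lemma basis_powers_in_diffop_range:
  fixes b :: "'s::{finite,linorder} \<Rightarrow> complex ^ 's::{finite,linorder}"
  assumes b: "invertible (\<chi> k. b k)" and nz: "\<And>e. b e \<noteq> 0"
  shows "(\<Prod>e\<in>UNIV. (1 / of_mpoly (linform (b e))) ^ Suc (g e)) \<in> range (\<lambda>p. diffop p (basis_fraction b))"
proof (induction "\<Sum>e\<in>UNIV. g e" arbitrary: g rule: less_induct)
  case less
  let ?L = "\<lambda>e. of_mpoly (linform (b e)) :: 's ratfun"
  let ?F = "\<lambda>g. \<Prod>e\<in>UNIV. (1 / ?L e) ^ Suc (g e)"
  have L: "?L e \<noteq> 0" for e using nz by simp
  show ?case
  proof (cases "\<forall>e. g e = 0")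
    case True
    then have "?F g = diffop 1 (basis_fraction b)"
      by (simp add: diffop_1 basis_fraction_eq)
    then show ?thesis by blast
  next
    case False
    then obtain k m where k: "g k = Suc m" by (metis not0_implies_Suc)
    let ?g = "g(k := m)"
    let ?v = "column k (matrix_inv (\<chi> k. b k))"
    have g: "g = ?g(k := Suc (?g k))" using k by auto
    have "(\<Sum>e\<in>UNIV. g e) = 1 + (\<Sum>e\<in>UNIV. ?g e)"
      using sum_mult_fun_upd_Suc[of UNIV k "\<lambda>_. 1" ?g] g by (metis (no_types, lifting) UNIV_I finite mult_1 sum.cong)
    then have "?F ?g \<in> range (\<lambda>p. diffop p (basis_fraction b))"
      by (intro less) simp
    then have D: "dirderiv ?v (?F ?g) \<in> range (\<lambda>p. diffop p (basis_fraction b))"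
      by (rule dirderiv_in_diffop_range)
    have dL: "dirderiv ?v (?L e) = (if e = k then 1 else 0)" for e
      using basis_coord_basis[OF b, of e k]
      by (simp add: dirderiv_linform column_def basis_coord_def mult.commute rconst.hom_0 rconst.hom_1)
    let ?R = "\<Prod>e\<in>UNIV - {k}. (1 / ?L e) ^ Suc (g e)"
    have R: "(\<Prod>e\<in>UNIV - {k}. (1 / ?L e) ^ Suc (?g e)) = ?R"
      by (rule prod.cong) auto
    have "dirderiv ?v ?R = 0"
      by (intro dirderiv_prod_0 dirderiv_power_0 dirderiv_inverse_0) (simp add: dL)
    moreover have "?F ?g = (1 / ?L k) ^ Suc m * ?R"
      using R by (simp add: prod.remove[of UNIV k])
    ultimately have "dirderiv ?v (?F ?g) = of_nat (Suc m) * (1 / ?L k) ^ m * (- 1 / ?L k ^ 2) * ?R"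
      by (simp only: dirderiv_mult dirderiv_power_Suc dirderiv_inverse[OF L] dL if_True
          mult_zero_right add_0_right simp_thms)
    also have "\<dots> = rconst (- of_nat (Suc m)) * ((1 / ?L k) ^ Suc (g k) * ?R)"
      unfolding rconst.hom_uminus rconst.hom_of_nat k
      by (simp add: power2_eq_square field_simps del: of_nat_Suc)
    also have "(1 / ?L k) ^ Suc (g k) * ?R = ?F g"
      by (simp only: prod.remove[of UNIV k] finite UNIV_I)
    finally have "rconst (- 1 / of_nat (Suc m)) * dirderiv ?v (?F ?g) =
        (rconst (- 1 / of_nat (Suc m)) * rconst (- of_nat (Suc m))) * ?F g"
      by (simp only: mult.assoc)
    also have "rconst (- 1 / of_nat (Suc m)) * rconst (- of_nat (Suc m)) = (1 :: 's ratfun)"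
      unfolding rconst.hom_mult[symmetric] by (simp add: rconst.hom_1 del: of_nat_Suc)
    finally have "?F g = rconst (- 1 / of_nat (Suc m)) * dirderiv ?v (?F ?g)"
      by (simp only: mult_1_left)
    moreover obtain q where "dirderiv ?v (?F ?g) = diffop q (basis_fraction b)"
      using D by (rule rangeE)
    ultimately have "?F g = diffop (mconst (- 1 / of_nat (Suc m)) * q) (basis_fraction b)"
      by (simp only: diffop_mconst_mult)
    then show ?thesis by (rule range_eqI)
  qed
qed

text \<open>The fractions whose class has an expansion, kept as representatives with a correction in
  \<open>R_low X\<close>. Span induction will use that they are closed under sums and
  scalars.\<close>

definition nb_space :: "(complex ^ 's::{finite,linorder}) list \<Rightarrow> 's ratfun set"
  where "nb_space X =
    {r + (\<Sum>\<sigma>\<in>no_broken X. diffop (p \<sigma>) (basis_fraction (extracted X \<sigma>))) | r p. r \<in> R_low X}"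

lemma nb_space_R_low: "r \<in> R_low X \<Longrightarrow> r \<in> nb_space X"
  unfolding nb_space_def by (rule CollectI, intro exI[of _ r] exI[of _ "\<lambda>_. 0"]) simp

lemma nb_space_diffop:
  assumes "\<sigma> \<in> no_broken X"
  shows "diffop p (basis_fraction (extracted X \<sigma>)) \<in> nb_space X"
proof -
  have "diffop (if \<tau> = \<sigma> then p else 0) f = (if \<tau> = \<sigma> then diffop p f else 0)" for \<tau> f
    by simp
  then have "(\<Sum>\<tau>\<in>no_broken X. diffop (if \<tau> = \<sigma> then p else 0) (basis_fraction (extracted X \<tau>))) =
      diffop p (basis_fraction (extracted X \<sigma>))"
    using assms by (simp add: finite_no_broken)
  then show ?thesis
    unfolding nb_space_def using ratfun.subspace_0[OF subspace_R_low]
    by (intro CollectI exI[of _ 0] exI[of _ "\<lambda>\<tau>. if \<tau> = \<sigma> then p else 0"]) simp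
qed

lemma nb_space_add:
  assumes "f \<in> nb_space X" "g \<in> nb_space X"
  shows "f + g \<in> nb_space X"
proof -
  obtain r p r' p' where fg: "r \<in> R_low X" "r' \<in> R_low X"
    "f = r + (\<Sum>\<sigma>\<in>no_broken X. diffop (p \<sigma>) (basis_fraction (extracted X \<sigma>)))"
    "g = r' + (\<Sum>\<sigma>\<in>no_broken X. diffop (p' \<sigma>) (basis_fraction (extracted X \<sigma>)))"
    using assms unfolding nb_space_def by blast
  then have "f + g = (r + r') +
      (\<Sum>\<sigma>\<in>no_broken X. diffop (p \<sigma> + p' \<sigma>) (basis_fraction (extracted X \<sigma>)))"
    by (simp add: diffop_add sum.distrib)
  moreover have "r + r' \<in> R_low X"
    using fg by (intro ratfun.subspace_add[OF subspace_R_low])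
  ultimately show ?thesis
    unfolding nb_space_def by (intro CollectI exI[of _ "r + r'"] exI[of _ "\<lambda>\<sigma>. p \<sigma> + p' \<sigma>"]) simp
qed

lemma nb_space_rconst_mult:
  assumes "f \<in> nb_space X"
  shows "rconst c * f \<in> nb_space X"
proof -
  obtain r p where f: "r \<in> R_low X"
    "f = r + (\<Sum>\<sigma>\<in>no_broken X. diffop (p \<sigma>) (basis_fraction (extracted X \<sigma>)))"
    using assms unfolding nb_space_def by blast
  then have "rconst c * f = rconst c * r +
      (\<Sum>\<sigma>\<in>no_broken X. diffop (mconst c * p \<sigma>) (basis_fraction (extracted X \<sigma>)))"
    by (simp add: diffop_mconst_mult distrib_left sum_distrib_left)
  moreover have "rconst c * r \<in> R_low X"
    using ratfun.subspace_scale[OF subspace_R_low f(1), of c] by (simp add: rscale_eq)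
  ultimately show ?thesis
    unfolding nb_space_def by (intro CollectI exI[of _ "rconst c * r"] exI[of _ "\<lambda>\<sigma>. mconst c * p \<sigma>"]) simp
qed

text \<open>Insert the indices from the largest down: each new vector avoids the span of all those
  already inserted.\<close>

lemma independent_of_not_in_span_greater:
  fixes f :: "nat \<Rightarrow> complex ^ 's::finite"
  assumes "finite S" "\<And>i. i \<in> S \<Longrightarrow> f i \<notin> vec.span (f ` {c \<in> S. i < c})"
  shows "inj_on f S \<and> vec.independent (f ` S)"
  using assms
proof (induction S rule: finite_linorder_min_induct)
  case empty
  show ?case by (simp add: vec.independent_empty)
next
  case (insert b A)
  have "f i \<notin> vec.span (f ` {c \<in> A. i < c})" if "i \<in> A" for i
  proof -
    have "{c \<in> insert b A. i < c} = {c \<in> A. i < c}" using insert(2) that by auto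
    then show ?thesis using insert.prems[of i] that by auto
  qed
  then have IH: "inj_on f A" "vec.independent (f ` A)" using insert.IH by auto
  have "{c \<in> insert b A. b < c} = A" using insert(2) by auto
  then have b: "f b \<notin> vec.span (f ` A)" using insert.prems[of b] by simp
  then have "f b \<notin> f ` A" using vec.span_base by blast
  with IH b show ?case by (auto simp: vec.independent_insert)
qed

lemma strict_mono_enumeration:
  fixes S :: "nat set"
  assumes "finite S" "card S = CARD('s::{finite,linorder})"
  obtains \<sigma> :: "'s::{finite,linorder} \<Rightarrow> nat" where "strict_mono \<sigma>" "range \<sigma> = S"
proof -
  let ?xs = "sorted_list_of_set S"
  \<comment> \<open>\<open>card {..<e}\<close> is the rank of \<open>e\<close> counted from 0,
    matching the indexing of the sorted list.\<close>
  define \<sigma> where "\<sigma> e = ?xs ! card {..<e}" for e :: 's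
  have len: "length ?xs = CARD('s)" using assms by simp
  have bound: "card {..<e} < CARD('s)" for e :: 's
    by (rule psubset_card_mono) auto
  have mono: "strict_mono \<sigma>"
  proof (rule strict_monoI)
    fix e e' :: 's assume "e < e'"
    then have "{..<e} \<subset> {..<e'}" by auto
    then have "card {..<e} < card {..<e'}" by (simp add: psubset_card_mono)
    then show "\<sigma> e < \<sigma> e'"
      unfolding \<sigma>_def using len bound strict_sorted_list_of_set[of S] by (simp add: sorted_wrt_nth_less)
  qed
  have "\<sigma> e \<in> S" for e
    using nth_mem[of "card {..<e}" ?xs] len bound[of e] assms by (simp add: \<sigma>_def)
  then have "range \<sigma> = S"
    using assms mono by (intro card_subset_eq) (auto simp: card_image strict_mono_imp_inj_on)
  with mono show ?thesis by (rule that)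
qed

text \<open>The hypothesis ranges over all positions. On the support of \<open>h\<close> it yields
  independence, so a spanning support is a basis; elsewhere it excludes further breaking elements,
  so this basis is no broken.\<close>

lemma unbroken_fraction_in_nb_space:
  fixes X :: "(complex ^ 's::{finite,linorder}) list"
  assumes X: "0 \<notin> set X"
    and unbroken: "\<And>i. i < length X \<Longrightarrow>
      X ! i \<notin> vec.span {X ! c | c. i < c \<and> c < length X \<and> h c > 0}"
  shows "(\<Prod>i<length X. (1 / of_mpoly (linform (X ! i))) ^ h i) \<in> nb_space X"
proof -
  let ?F = "\<Prod>i<length X. (1 / of_mpoly (linform (X ! i))) ^ h i :: 's ratfun"
  define S where "S = {i. i < length X \<and> h i > 0}"
  have S: "finite S" "S \<subseteq> {..<length X}" by (auto simp: S_def)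
  have image: "(!) X ` S = {X ! i | i. i < length X \<and> h i > 0}" by (auto simp: S_def)
  show ?thesis
  proof (cases "vec.span ((!) X ` S) = UNIV")
    case False
    then have "arr_fraction X 1 h \<in> R_low X"
      unfolding R_low_def image by (intro ratfun.span_base) blast
    then show ?thesis by (simp add: arr_fraction_eq nb_space_R_low)
  next
    case True
    have "{X ! c | c. i < c \<and> c < length X \<and> h c > 0} = (!) X ` {c \<in> S. i < c}" for i
      by (auto simp: S_def)
    then have "X ! i \<notin> vec.span ((!) X ` {c \<in> S. i < c})" if "i \<in> S" for i
      using unbroken[of i] that S(2) by auto
    from independent_of_not_in_span_greater[OF S(1) this]
    have indep: "inj_on ((!) X) S" "vec.independent ((!) X ` S)" by blast+
    have "card S = card ((!) X ` S)"
      using indep(1) by (simp add: card_image)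
    also have "\<dots> = vec.dim (vec.span ((!) X ` S))"
      using indep(2) by (simp add: vec.dim_eq_card_independent)
    finally have "card S = CARD('s)" by (simp only: True vec_dim_card)
    with S(1) obtain \<sigma> :: "'s \<Rightarrow> nat" where \<sigma>: "strict_mono \<sigma>" "range \<sigma> = S"
      by (rule strict_mono_enumeration)
    have \<sigma>S: "\<sigma> e \<in> S" for e using \<sigma>(2) by blast
    have inj: "inj \<sigma>" using \<sigma>(1) by (rule strict_mono_imp_inj_on)
    have ext: "extracted X \<sigma> = (!) X \<circ> \<sigma>" by (auto simp: extracted_def)
    have range: "range (extracted X \<sigma>) = (!) X ` S" using \<sigma>(2) by (auto simp: ext)
    have basis: "extracted_basis X \<sigma>"
      unfolding extracted_basis_def range using indep True \<sigma> \<sigma>S S inj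
      by (auto simp: ext intro!: comp_inj_on)
    have "breaks X \<sigma> i \<longleftrightarrow> i \<in> range \<sigma>" if i: "i < length X" for i
    proof
      assume "breaks X \<sigma> i"
      then obtain e where e: "i \<le> \<sigma> e" "X ! i \<in> vec.span (extracted X \<sigma> ` {e..})"
        unfolding breaks_def by blast
      show "i \<in> range \<sigma>"
      proof (cases "i = \<sigma> e")
        \<comment> \<open>Here \<open>i < \<sigma> e\<close>, so all members from \<open>e\<close>
          on have positions after \<open>i\<close> in the support of \<open>h\<close>.\<close>
        case False
        have "\<sigma> e \<le> \<sigma> e'" if "e \<le> e'" for e'
          using that \<sigma>(1) by (simp add: strict_mono_less_eq)
        then have "extracted X \<sigma> ` {e..} \<subseteq> {X ! c | c. i < c \<and> c < length X \<and> h c > 0}"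
          using e(1) False \<sigma>S by (fastforce simp: extracted_def S_def)
        then show ?thesis using unbroken[OF i] e(2) vec.span_mono by blast
      qed simp
    next
      assume "i \<in> range \<sigma>"
      then obtain e where "i = \<sigma> e" by blast
      then have "X ! i \<in> vec.span (extracted X \<sigma> ` {e..})"
        by (intro vec.span_base) (simp add: extracted_def)
      with \<open>i = \<sigma> e\<close> show "breaks X \<sigma> i" unfolding breaks_def by blast
    qed
    then have "{i. i < length X \<and> breaks X \<sigma> i} = range \<sigma>"
      using \<sigma>(2) S(2) by auto
    with basis have nb: "\<sigma> \<in> no_broken X"
      using inj by (simp add: no_broken_def card_image)
    have "?F = (\<Prod>i\<in>S. (1 / of_mpoly (linform (X ! i))) ^ h i)"
      using S by (intro prod.mono_neutral_right) (auto simp: S_def)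
    also have "\<dots> = (\<Prod>e\<in>UNIV. (1 / of_mpoly (linform (X ! \<sigma> e))) ^ h (\<sigma> e))"
      unfolding \<sigma>(2)[symmetric] using inj by (simp add: prod.reindex)
    \<comment> \<open>\<open>h (\<sigma> e)\<close> is positive, so the subtraction is
      exact.\<close>
    also have "\<dots> = (\<Prod>e\<in>UNIV. (1 / of_mpoly (linform (extracted X \<sigma> e))) ^ Suc (h (\<sigma> e) - 1))"
      using \<sigma>S by (intro prod.cong) (auto simp: extracted_def S_def simp del: power_Suc)
    also have "\<dots> \<in> range (\<lambda>p. diffop p (basis_fraction (extracted X \<sigma>)))"
      by (intro basis_powers_in_diffop_range extracted_basis_invertible extracted_nonzero X basis)
    finally obtain p where "?F = diffop p (basis_fraction (extracted X \<sigma>))"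
      by (rule rangeE)
    then show ?thesis by (simp only: nb_space_diffop[OF nb])
  qed
qed

lemma fraction_in_nb_space:
  fixes X :: "(complex ^ 's::{finite,linorder}) list"
  assumes X: "0 \<notin> set X"
  shows "(\<Prod>i<length X. (1 / of_mpoly (linform (X ! i))) ^ h i) \<in> nb_space X"
proof (induction "\<Sum>i<length X. i * h i" arbitrary: h rule: less_induct)
  case less
  let ?L = "\<lambda>a. of_mpoly (linform a) :: 's ratfun"
  let ?F = "\<lambda>h. \<Prod>i<length X. (1 / ?L (X ! i)) ^ h i"
  let ?C = "\<lambda>i. {X ! c | c. i < c \<and> c < length X \<and> h c > 0}"
  have L: "?L (X ! i) \<noteq> 0" if "i < length X" for i
    using X that nth_mem by fastforce
  show ?case
  proof (cases "\<exists>i<length X. X ! i \<in> vec.span (?C i)")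
    case False
    with X show ?thesis by (intro unbroken_fraction_in_nb_space) auto
  next
    case True
    then obtain i where i: "i < length X" "X ! i \<in> vec.span (?C i)" by blast
    \<comment> \<open>Multiply and divide by the form of \<open>X ! i\<close>. The claim is linear
      in the numerator \<open>a\<close>, so by span induction the numerator may be taken to be a
      later factor of the denominator, which it cancels.\<close>
    have "?L (X ! i) * (1 / ?L (X ! i) * ?F h) \<in> nb_space X"
    proof (rule vec.span_induct[where P = "\<lambda>a. ?L a * (1 / ?L (X ! i) * ?F h) \<in> nb_space X", OF i(2)])
      show "vec.subspace {a. ?L a * (1 / ?L (X ! i) * ?F h) \<in> nb_space X}"
      proof (rule vec.subspaceI)
        show "0 \<in> {a. ?L a * (1 / ?L (X ! i) * ?F h) \<in> nb_space X}"
          using nb_space_R_low[OF ratfun.subspace_0[OF subspace_R_low]] by simp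
      next
        fix a a' assume "a \<in> {a. ?L a * (1 / ?L (X ! i) * ?F h) \<in> nb_space X}"
          "a' \<in> {a. ?L a * (1 / ?L (X ! i) * ?F h) \<in> nb_space X}"
        then show "a + a' \<in> {a. ?L a * (1 / ?L (X ! i) * ?F h) \<in> nb_space X}"
          using nb_space_add by (simp only: mem_Collect_eq linform_add of_mpoly_add distrib_right)
      next
        fix c a assume "a \<in> {a. ?L a * (1 / ?L (X ! i) * ?F h) \<in> nb_space X}"
        then show "c *s a \<in> {a. ?L a * (1 / ?L (X ! i) * ?F h) \<in> nb_space X}"
          using nb_space_rconst_mult[of _ X c]
          by (simp only: mem_Collect_eq linform_scale of_mpoly_mult rconst_def mult.assoc)
      qed
    next
      fix a assume "a \<in> ?C i"
      then obtain c where c: "a = X ! c" "i < c" "c < length X" "h c > 0" by blast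
      \<comment> \<open>\<open>h1\<close> removes one factor \<open>X ! c\<close> and
        \<open>h2\<close> then adds one factor \<open>X ! i\<close>; the sum of positions changes by
        \<open>i - c < 0\<close>.\<close>
      define h1 where "h1 = h(c := h c - 1)"
      define h2 where "h2 = h1(i := Suc (h1 i))"
      have h: "h = h1(c := Suc (h1 c))" using c(4) by (auto simp: h1_def)
      have "(\<Sum>j<length X. j * h j) = c + (\<Sum>j<length X. j * h1 j)"
        using c(3) by (subst h, subst sum_mult_fun_upd_Suc) auto
      moreover have "(\<Sum>j<length X. j * h2 j) = i + (\<Sum>j<length X. j * h1 j)"
        unfolding h2_def using i(1) by (subst sum_mult_fun_upd_Suc) auto
      ultimately have "?F h2 \<in> nb_space X" using c(2) by (intro less) simp
      moreover have "?F h = 1 / ?L (X ! c) * ?F h1"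
        using c(3) by (subst h, subst prod_power_fun_upd_Suc) auto
      moreover have "?F h2 = 1 / ?L (X ! i) * ?F h1"
        unfolding h2_def using i(1) by (subst prod_power_fun_upd_Suc) auto
      ultimately show "?L a * (1 / ?L (X ! i) * ?F h) \<in> nb_space X"
        using L[OF c(3)] by (simp add: c(1))
    qed
    then show ?thesis using L[OF i(1)] by simp
  qed
qed

lemma nb_expansion_exists:
  assumes "0 \<notin> set X"
  obtains p where "nb_expansion X p"
proof -
  have "1 / arr_prod X \<in> nb_space X"
    using fraction_in_nb_space[OF assms, of "\<lambda>_. 1"] by (simp add: arr_prod_def prod_dividef)
  then obtain r p where r: "r \<in> R_low X"
    "1 / arr_prod X = r + (\<Sum>\<sigma>\<in>no_broken X. diffop (p \<sigma>) (basis_fraction (extracted X \<sigma>)))"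
    unfolding nb_space_def by blast
  \<comment> \<open>Restriction provides the extensionality and leaves the sum over
    \<open>no_broken X\<close> unchanged.\<close>
  then have "nb_expansion X (restrict p (no_broken X))"
    by (simp add: nb_expansion_iff)
  then show ?thesis by (rule that)
qed

theorem theorem11p11:
  fixes X :: "(complex ^ 's::{finite,linorder}) list"
    and \<sigma> :: "'s \<Rightarrow> nat"
  assumes "0 \<notin> set X"
    and "vec.span (set X) = UNIV"
    and "\<sigma> \<in> no_broken X"
  shows "Poly_Mapping.lookup (msubst mconst (\<lambda>i. - mvar i) (nb_poly X \<sigma>)) =
    (\<lambda>\<alpha>. det (\<chi> e. extracted X \<sigma> e) *
         residue_at (extracted X \<sigma>) (exp_pairing_coeff \<alpha> / arr_prod X))"
proof
  fix \<alpha>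
  let ?B = "\<chi> e. extracted X \<sigma> e"
  obtain p where p: "nb_expansion X p"
    using nb_expansion_exists[OF assms(1)] .
  then have nb: "nb_expansion X (nb_poly X)"
    unfolding nb_poly_def by (rule theI[where P = "nb_expansion X"]) (rule nb_expansion_unique[OF assms(1) _ p])
  have "invertible ?B"
    using assms(3) by (intro extracted_basis_invertible) (simp add: no_broken_def)
  \<comment> \<open>The determinant of the inverse matrix inside the residue cancels against
    \<open>det ?B\<close>.\<close>
  then have "det ?B * det (matrix_inv ?B) = 1"
    by (simp add: matrix_inv_right_left(1) flip: det_mul)
  then have "det ?B * residue_at (extracted X \<sigma>) (exp_pairing_coeff \<alpha> / arr_prod X) =
      exp_res (extracted X \<sigma>) (1 / arr_prod X) \<alpha>"
    by (simp add: residue_at_eq exp_pairing_coeff_eq exp_res_def flip: mult.assoc)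
  then show "Poly_Mapping.lookup (msubst mconst (\<lambda>i. - mvar i) (nb_poly X \<sigma>)) \<alpha> =
      det ?B * residue_at (extracted X \<sigma>) (exp_pairing_coeff \<alpha> / arr_prod X)"
    by (simp add: lookup_msubst_uminus nb_expansion_coeff[OF assms(1) nb assms(3)])
qed

end
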